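(* Let $(M,a,b,g)$ be the data of an $N$-dimensional Finsleroid--Finsler space ($N\ge 2$) with Finsleroid--Finsler metric function $K(x,y)$, where $a_{ij}(x)$ is a Riemannian metric, $b=b_i(x)y^i$ is a 1-form of unit Riemannian length, and $g=g(x)$ is the Finsleroid charge, with $-2<g(x)<2$ and $g(x)\ne0$. If $\nabla_ib_j=0$ (with $\nabla$ the Levi-Civita covariant derivative of $a_{ij}$) and $\frac{\partial g}{\partial x^i}=\mu(x)b_i(x)$ for some scalar function $\mu(x)$ on $M$, then $$\dot\alpha_i=0,$$ and, equivalently, the normalized Cartan tensor satisfies $\dot\alpha_{ijk}=0$.
   Context: Finsleroid--Finsler space. Let $M$ be an $N$-dimensional $C^\infty$ manifold ($N\ge2$) with a positive-definite Riemannian metric $a_{ij}(x)$ and a non-vanishing 1-form $b=b_i(x)y^i$ with $a^{ij}b_ib_j=1$. For a nonzero tangent vector $y$ put $S=\sqrt{a_{ij}(x)y^iy^j}$ and $q=\sqrt{S^2-b^2}$. Let $g=g(x)$ be a scalar function with $-2<g(x)<2$ (the Finsleroid charge), and put $$h=\sqrt{1-\tfrac14 g^2},\quad G=\frac gh,\quad B=b^2+gbq+q^2,\quad L=q+\frac g2 b,$$ $$K(x,y)=\sqrt{B}\;e^{-\frac12 G f},\qquad f=-\arctan\frac G2+\arctan\frac{L}{hb}\ \text{ if } b\ge0,\qquad f=\pi-\arctan\frac G2+\arctan\frac{L}{hb}\ \text{ if } b\le0$$ (at $b=0$, $f=\frac{\pi}{2}-\arctan\frac G2$). $K$ is the Finsleroid--Finsler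 metric function. All tensors are considered at $y$ with $q>0$. Finslerian objects. $g_{ij}=\frac12\frac{\partial^2K^2}{\partial y^i\partial y^j}$ is the Finslerian metric tensor, $g^{ij}$ its inverse (used for raising indices of Finslerian tensors), $l^i=y^i/K$, $A_{ijk}=\frac K2\frac{\partial g_{ij}}{\partial y^k}$ (Cartan tensor), $A_k=g^{ij}A_{ijk}$, $||A||=\sqrt{A^kA_k}$, $\alpha_{ijk}=A_{ijk}/||A||$ (normalized Cartan tensor), $\alpha_k=A_k/||A||$. Connection. $\gamma^k{}_{ij}=\frac12 g^{kn}\left(\frac{\partial g_{ni}}{\partial x^j}+\frac{\partial g_{nj}}{\partial x^i}-\frac{\partial g_{ji}}{\partial x^n}\right)$, $\ 2\bar G^k=\gamma^k{}_{ij}y^iy^j$, $\ \bar G^k{}_j=\partial\bar G^k/\partial y^j$, $\ \bar G^{kn}=\bar G^k{}_m g^{mn}$, $\ C_{nij}=A_{nij}/K$, $\ C_n{}^k{}_j=g^{km}C_{nmj}$, $$\Gamma^k{}_{ij}=\gamma^k{}_{ij}-\bar G^n{}_i C_n{}^k{}_j-\bar G^n{}_jC_n{}^k{}_i+\bar G^{kn}C_{nij}.$$ The $h$-covariant derivative is $\alpha_{i|j}=\frac{\partial \alpha_i}{\partial x^j}-\bar G^k{}_j\frac{\partial \alpha_i}{\partial y^k}-\Gamma^k{}_{ij}\alpha_k$, extended to tensors of higher rank in the usual way (one $\Gamma$-term for each index). The overdot denotes $\dot\alpha_i=\alpha_{i|m}l^m$, $\dot\alpha_{ijk}=\alpha_{ijk|m}l^m$.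 *)

theory Defs
  imports "HOL-Analysis.Analysis"
begin

section \<open>Partial derivatives and smoothness on open subsets of \<open>\<real>\<^sup>N\<close>\<close>

definition partial_deriv :: "'n \<Rightarrow> (real^'n::finite \<Rightarrow> real) \<Rightarrow> real^'n \<Rightarrow> real" where
  "partial_deriv i f x = deriv (\<lambda>t. f (x + t *\<^sub>R axis i 1)) 0"

primrec Ck_on :: "nat \<Rightarrow> (real^'n::finite) set \<Rightarrow> (real^'n \<Rightarrow> real) \<Rightarrow> bool" where
  "Ck_on 0 U f \<longleftrightarrow> continuous_on U f"
| "Ck_on (Suc k) U f \<longleftrightarrow> f differentiable_on U \<and> (\<forall>i. Ck_on k U (partial_deriv i f))"

definition smooth_on :: "(real^'n::finite) set \<Rightarrow> (real^'n \<Rightarrow> real) \<Rightarrow> bool" where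
  "smooth_on U f \<longleftrightarrow> (\<forall>k. Ck_on k U f)"


section \<open>Manifolds and tensor fields in index notation\<close>

text \<open>
  The manifold is the whole type \<open>'m\<close>, its dimension is \<open>CARD('n)\<close>. A tensor field is given, as
  in classical index notation, by its components with respect to every chart of the atlas, subject
  to the tensorial transformation law on overlaps.
\<close>

type_synonym ('m, 'n) chart = "'m set \<times> ('m \<Rightarrow> real^'n)"

abbreviation chart_dom :: "('m, 'n) chart \<Rightarrow> 'm set" where
  "chart_dom c \<equiv> fst c"

definition chart_im :: "('m, 'n) chart \<Rightarrow> (real^'n) set" where
  "chart_im c = snd c ` fst c"

definition chart_inv :: "('m, 'n) chart \<Rightarrow> real^'n \<Rightarrow> 'm" where
  "chart_inv c = inv_into (fst c) (snd c)"

definition overlap :: "('m, 'n) chart \<Rightarrow> ('m, 'n) chart \<Rightarrow> (real^'n) set" where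
  "overlap c d = snd c ` (chart_dom c \<inter> chart_dom d)"

definition transition :: "('m, 'n) chart \<Rightarrow> ('m, 'n) chart \<Rightarrow> real^'n \<Rightarrow> real^'n" where
  "transition c d x = snd d (chart_inv c x)"

definition jacobian ::
  "('m, 'n::finite) chart \<Rightarrow> ('m, 'n) chart \<Rightarrow> real^'n \<Rightarrow> 'n \<Rightarrow> 'n \<Rightarrow> real" where
  "jacobian c d x k i = partial_deriv i (\<lambda>z. transition c d z $ k) x"

definition smooth_atlas ::
  "('m::{t2_space, second_countable_topology}, 'n::finite) chart set \<Rightarrow> bool" where
  "smooth_atlas \<A> \<longleftrightarrow>
     (\<Union>c\<in>\<A>. chart_dom c) = UNIV \<and>
     (\<forall>c\<in>\<A>. open (chart_dom c) \<and> open (chart_im c) \<and>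
        homeomorphism (chart_dom c) (chart_im c) (snd c) (chart_inv c)) \<and>
     (\<forall>c\<in>\<A>. \<forall>d\<in>\<A>. \<forall>k. smooth_on (overlap c d) (\<lambda>x. transition c d x $ k))"

definition smooth_scalar ::
  "('m, 'n::finite) chart set \<Rightarrow> ('m \<Rightarrow> real) \<Rightarrow> bool" where
  "smooth_scalar \<A> g \<longleftrightarrow> (\<forall>c\<in>\<A>. smooth_on (chart_im c) (\<lambda>x. g (chart_inv c x)))"

definition smooth_one_form ::
  "('m, 'n::finite) chart set \<Rightarrow> (('m, 'n) chart \<Rightarrow> real^'n \<Rightarrow> real^'n) \<Rightarrow> bool" where
  "smooth_one_form \<A> b \<longleftrightarrow>
     (\<forall>c\<in>\<A>. \<forall>i. smooth_on (chart_im c) (\<lambda>x. b c x $ i)) \<and>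
     (\<forall>c\<in>\<A>. \<forall>d\<in>\<A>. \<forall>x\<in>overlap c d. \<forall>i.
        b c x $ i = (\<Sum>k\<in>UNIV. jacobian c d x k i * b d (transition c d x) $ k))"

definition riemannian_metric ::
  "('m, 'n::finite) chart set \<Rightarrow> (('m, 'n) chart \<Rightarrow> real^'n \<Rightarrow> real^'n^'n) \<Rightarrow> bool" where
  "riemannian_metric \<A> a \<longleftrightarrow>
     (\<forall>c\<in>\<A>. \<forall>i j. smooth_on (chart_im c) (\<lambda>x. a c x $ i $ j)) \<and>
     (\<forall>c\<in>\<A>. \<forall>x\<in>chart_im c.
        (\<forall>i j. a c x $ i $ j = a c x $ j $ i) \<and> (\<forall>v. v \<noteq> 0 \<longrightarrow> v \<bullet> (a c x *v v) > 0)) \<and>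
     (\<forall>c\<in>\<A>. \<forall>d\<in>\<A>. \<forall>x\<in>overlap c d. \<forall>i j.
        a c x $ i $ j = (\<Sum>k\<in>UNIV. \<Sum>l\<in>UNIV.
          jacobian c d x k i * jacobian c d x l j * a d (transition c d x) $ k $ l))"


section \<open>Local expressions: Riemannian objects\<close>

text \<open>\<open>christoffel m k i j\<close> has upper index \<open>k\<close>.\<close>

definition christoffel ::
  "(real^'n::finite \<Rightarrow> real^'n^'n) \<Rightarrow> 'n \<Rightarrow> 'n \<Rightarrow> 'n \<Rightarrow> real^'n \<Rightarrow> real" where
  "christoffel m k i j x = 1/2 * (\<Sum>n\<in>UNIV. matrix_inv (m x) $ k $ n *
     (partial_deriv j (\<lambda>z. m z $ n $ i) x + partial_deriv i (\<lambda>z. m z $ n $ j) x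
        - partial_deriv n (\<lambda>z. m z $ j $ i) x))"

text \<open>\<open>nabla_one_form a b i j\<close> is \<open>\<nabla>\<^sub>i b\<^sub>j\<close>.\<close>

definition nabla_one_form ::
  "(real^'n::finite \<Rightarrow> real^'n^'n) \<Rightarrow> (real^'n \<Rightarrow> real^'n) \<Rightarrow> 'n \<Rightarrow> 'n \<Rightarrow> real^'n \<Rightarrow> real" where
  "nabla_one_form a b i j x =
     partial_deriv i (\<lambda>z. b z $ j) x - (\<Sum>k\<in>UNIV. christoffel a k i j x * b x $ k)"


section \<open>Local expressions: the Finsleroid metric function\<close>

definition form_b :: "(real^'n::finite \<Rightarrow> real^'n) \<Rightarrow> real^'n \<Rightarrow> real^'n \<Rightarrow> real" where
  "form_b b x y = (\<Sum>i\<in>UNIV. b x $ i * y $ i)"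

definition riem_S :: "(real^'n::finite \<Rightarrow> real^'n^'n) \<Rightarrow> real^'n \<Rightarrow> real^'n \<Rightarrow> real" where
  "riem_S a x y = sqrt (\<Sum>i\<in>UNIV. \<Sum>j\<in>UNIV. a x $ i $ j * y $ i * y $ j)"

definition fin_q ::
  "(real^'n::finite \<Rightarrow> real^'n^'n) \<Rightarrow> (real^'n \<Rightarrow> real^'n) \<Rightarrow> real^'n \<Rightarrow> real^'n \<Rightarrow> real" where
  "fin_q a b x y = sqrt ((riem_S a x y)\<^sup>2 - (form_b b x y)\<^sup>2)"

text \<open>
  The following functions take the numerical values of the charge \<open>g\<close>, of \<open>b\<close> and of \<open>q\<close>.
\<close>

definition fin_h :: "real \<Rightarrow> real" where
  "fin_h g = sqrt (1 - g\<^sup>2 / 4)"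

definition fin_G :: "real \<Rightarrow> real" where
  "fin_G g = g / fin_h g"

definition fin_B :: "real \<Rightarrow> real \<Rightarrow> real \<Rightarrow> real" where
  "fin_B g b q = b\<^sup>2 + g * b * q + q\<^sup>2"

definition fin_L :: "real \<Rightarrow> real \<Rightarrow> real \<Rightarrow> real" where
  "fin_L g b q = q + g / 2 * b"

definition fin_f :: "real \<Rightarrow> real \<Rightarrow> real \<Rightarrow> real" where
  "fin_f g b q =
     (if b > 0 then - arctan (fin_G g / 2) + arctan (fin_L g b q / (fin_h g * b))
      else if b = 0 then pi / 2 - arctan (fin_G g / 2)
      else pi - arctan (fin_G g / 2) + arctan (fin_L g b q / (fin_h g * b)))"

definition finsleroid_K ::
  "(real^'n::finite \<Rightarrow> real^'n^'n) \<Rightarrow> (real^'n \<Rightarrow> real^'n) \<Rightarrow> (real^'n \<Rightarrow> real)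
     \<Rightarrow> real^'n \<Rightarrow> real^'n \<Rightarrow> real" where
  "finsleroid_K a b g x y =
     sqrt (fin_B (g x) (form_b b x y) (fin_q a b x y))
       * exp (- (1/2) * fin_G (g x) * fin_f (g x) (form_b b x y) (fin_q a b x y))"


section \<open>Local expressions: Finslerian objects of a metric function \<open>K x y\<close>\<close>

type_synonym 'n finsler_fun = "real^'n \<Rightarrow> real^'n \<Rightarrow> real"

definition fund_tensor :: "'n::finite finsler_fun \<Rightarrow> real^'n \<Rightarrow> real^'n \<Rightarrow> real^'n^'n" where
  "fund_tensor K x y =
     (\<chi> i j. 1/2 * partial_deriv i (partial_deriv j (\<lambda>v. (K x v)\<^sup>2)) y)"

definition fund_inv :: "'n::finite finsler_fun \<Rightarrow> real^'n \<Rightarrow> real^'n \<Rightarrow> real^'n^'n" where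
  "fund_inv K x y = matrix_inv (fund_tensor K x y)"

definition unit_l :: "'n::finite finsler_fun \<Rightarrow> 'n \<Rightarrow> 'n finsler_fun" where
  "unit_l K i x y = y $ i / K x y"

definition cartan_A :: "'n::finite finsler_fun \<Rightarrow> 'n \<Rightarrow> 'n \<Rightarrow> 'n \<Rightarrow> 'n finsler_fun" where
  "cartan_A K i j k x y = K x y / 2 * partial_deriv k (\<lambda>v. fund_tensor K x v $ i $ j) y"

definition cartan_cov :: "'n::finite finsler_fun \<Rightarrow> 'n \<Rightarrow> 'n finsler_fun" where
  "cartan_cov K k x y = (\<Sum>i\<in>UNIV. \<Sum>j\<in>UNIV. fund_inv K x y $ i $ j * cartan_A K i j k x y)"

definition cartan_norm :: "'n::finite finsler_fun \<Rightarrow> 'n finsler_fun" where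
  "cartan_norm K x y =
     sqrt (\<Sum>k\<in>UNIV. \<Sum>n\<in>UNIV. fund_inv K x y $ k $ n * cartan_cov K n x y * cartan_cov K k x y)"

definition alpha_cov :: "'n::finite finsler_fun \<Rightarrow> 'n \<Rightarrow> 'n finsler_fun" where
  "alpha_cov K k x y = cartan_cov K k x y / cartan_norm K x y"

definition alpha_tensor :: "'n::finite finsler_fun \<Rightarrow> 'n \<Rightarrow> 'n \<Rightarrow> 'n \<Rightarrow> 'n finsler_fun" where
  "alpha_tensor K i j k x y = cartan_A K i j k x y / cartan_norm K x y"

text \<open>
  The connection. In \<open>fin_gamma K k i j\<close>, \<open>nonlin_conn K k j\<close>, \<open>nonlin_conn_up K k n\<close>,
  \<open>cartan_C_mixed K n k j\<close> and \<open>fin_Gamma K k i j\<close> the indices stand in the order in which they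
  occur in \<open>\<gamma>\<^sup>k\<^sub>i\<^sub>j\<close>, \<open>G\<^sup>k\<^sub>j\<close>, \<open>G\<^sup>k\<^sup>n\<close>, \<open>C\<^sub>n\<^sup>k\<^sub>j\<close> and \<open>\<Gamma>\<^sup>k\<^sub>i\<^sub>j\<close>.
\<close>

definition fin_gamma :: "'n::finite finsler_fun \<Rightarrow> 'n \<Rightarrow> 'n \<Rightarrow> 'n \<Rightarrow> 'n finsler_fun" where
  "fin_gamma K k i j x y = christoffel (\<lambda>z. fund_tensor K z y) k i j x"

definition spray :: "'n::finite finsler_fun \<Rightarrow> 'n \<Rightarrow> 'n finsler_fun" where
  "spray K k x y = 1/2 * (\<Sum>i\<in>UNIV. \<Sum>j\<in>UNIV. fin_gamma K k i j x y * y $ i * y $ j)"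

definition nonlin_conn :: "'n::finite finsler_fun \<Rightarrow> 'n \<Rightarrow> 'n \<Rightarrow> 'n finsler_fun" where
  "nonlin_conn K k j x y = partial_deriv j (\<lambda>v. spray K k x v) y"

definition nonlin_conn_up :: "'n::finite finsler_fun \<Rightarrow> 'n \<Rightarrow> 'n \<Rightarrow> 'n finsler_fun" where
  "nonlin_conn_up K k n x y = (\<Sum>m\<in>UNIV. nonlin_conn K k m x y * fund_inv K x y $ m $ n)"

definition cartan_C :: "'n::finite finsler_fun \<Rightarrow> 'n \<Rightarrow> 'n \<Rightarrow> 'n \<Rightarrow> 'n finsler_fun" where
  "cartan_C K n i j x y = cartan_A K n i j x y / K x y"

definition cartan_C_mixed :: "'n::finite finsler_fun \<Rightarrow> 'n \<Rightarrow> 'n \<Rightarrow> 'n \<Rightarrow> 'n finsler_fun" where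
  "cartan_C_mixed K n k j x y = (\<Sum>m\<in>UNIV. fund_inv K x y $ k $ m * cartan_C K n m j x y)"

definition fin_Gamma :: "'n::finite finsler_fun \<Rightarrow> 'n \<Rightarrow> 'n \<Rightarrow> 'n \<Rightarrow> 'n finsler_fun" where
  "fin_Gamma K k i j x y =
     fin_gamma K k i j x y
     - (\<Sum>n\<in>UNIV. nonlin_conn K n i x y * cartan_C_mixed K n k j x y)
     - (\<Sum>n\<in>UNIV. nonlin_conn K n j x y * cartan_C_mixed K n k i x y)
     + (\<Sum>n\<in>UNIV. nonlin_conn_up K k n x y * cartan_C K n i j x y)"

definition horiz_deriv :: "'n::finite finsler_fun \<Rightarrow> 'n finsler_fun \<Rightarrow> 'n \<Rightarrow> 'n finsler_fun" where
  "horiz_deriv K T j x y =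
     partial_deriv j (\<lambda>z. T z y) x
     - (\<Sum>k\<in>UNIV. nonlin_conn K k j x y * partial_deriv k (\<lambda>v. T x v) y)"

text \<open>The \<open>h\<close>-covariant derivatives \<open>T\<^sub>i\<^sub>|\<^sub>m\<close> and \<open>T\<^sub>i\<^sub>j\<^sub>k\<^sub>|\<^sub>m\<close>; the last index is that of the derivative.\<close>

definition h_cov1 ::
  "'n::finite finsler_fun \<Rightarrow> ('n \<Rightarrow> 'n finsler_fun) \<Rightarrow> 'n \<Rightarrow> 'n \<Rightarrow> 'n finsler_fun" where
  "h_cov1 K T i m x y =
     horiz_deriv K (T i) m x y - (\<Sum>n\<in>UNIV. fin_Gamma K n i m x y * T n x y)"

definition h_cov3 ::
  "'n::finite finsler_fun \<Rightarrow> ('n \<Rightarrow> 'n \<Rightarrow> 'n \<Rightarrow> 'n finsler_fun)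
     \<Rightarrow> 'n \<Rightarrow> 'n \<Rightarrow> 'n \<Rightarrow> 'n \<Rightarrow> 'n finsler_fun" where
  "h_cov3 K T i j k m x y =
     horiz_deriv K (T i j k) m x y
     - (\<Sum>n\<in>UNIV. fin_Gamma K n i m x y * T n j k x y)
     - (\<Sum>n\<in>UNIV. fin_Gamma K n j m x y * T i n k x y)
     - (\<Sum>n\<in>UNIV. fin_Gamma K n k m x y * T i j n x y)"

definition alpha_cov_dot :: "'n::finite finsler_fun \<Rightarrow> 'n \<Rightarrow> 'n finsler_fun" where
  "alpha_cov_dot K i x y = (\<Sum>m\<in>UNIV. h_cov1 K (alpha_cov K) i m x y * unit_l K m x y)"

definition alpha_tensor_dot :: "'n::finite finsler_fun \<Rightarrow> 'n \<Rightarrow> 'n \<Rightarrow> 'n \<Rightarrow> 'n finsler_fun" where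
  "alpha_tensor_dot K i j k x y =
     (\<Sum>m\<in>UNIV. h_cov3 K (alpha_tensor K) i j k m x y * unit_l K m x y)"

end

(*
  Idea. Write g_ij = l_i l_j + h_ij for the fundamental tensor and let w be the covector of unit
  length which is orthogonal to l inside span(b_i, a_ij y^j). Explicit differentiation of K^2 gives
  A_ijk = (g/2) (h_ij w_k + h_ik w_j + h_jk w_i - w_i w_j w_k), hence A_k = (N g/2) w_k,
  ||A|| = N |g| / 2, and both normalized tensors are, up to the locally constant factor sgn g,
  constant-coefficient expressions in h and w.

  As nabla b = 0, the functions b, S and q are constant along the Levi-Civita horizontal
  directions, so there K varies only through the charge, and dg = mu b makes the geodesic spray
  differ from the Riemannian one by p b^k + s y^k with explicit functions p and s of (g, b, q).
  Along the spray the fundamental tensor, y_i and K are parallel for the nonlinear connection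
  dG^k/dy^i, which coincides with the contraction of the Cartan connection with y. A direct
  computation with p and s shows that w is parallel as well; the theorem follows by the
  product rule.
*)
theory Submission
  imports Defs
begin

section \<open>Partial derivatives from joint derivatives\<close>

text \<open>The charge enters \<open>finsleroid_K\<close> through an arctangent, so p and s contain
  the non-algebraic function \<open>MM\<close>, the derivative of log (K^2/B) in g. It occurs only
  linearly and its derivative in y is rational in g, b, q. Hence every identity about the spray
  becomes polynomial once \<open>MM\<close> is treated as an independent unknown and the powers of q
  and B are cleared.

  Why w has to be parallel: with dg = mu b, the transport along the spray differs from the
  Levi-Civita one by a multiple of the identity and maps into the plane spanned by y and the vector
  beta dual to b. This plane is therefore preserved. As y and the metric are preserved too, so is
  the unit covector of the plane orthogonal to y. In the code this conclusion takes the form of an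
  explicit identity.

  The inverse of g_ij is never computed: a covector is raised by exhibiting the vector that lowers
  to it. All derivatives contracted with y are values of one joint derivative in the direction
  \<open>(y, - GV x y)\<close>, which is tangent to the flow of the spray in the tangent
  bundle.\<close>

lemma partial_deriv_eqI:
  fixes f :: "real^'n::finite \<Rightarrow> real"
  assumes "(f has_derivative D) (at x)"
  shows "partial_deriv i f x = D (axis i 1)"
proof -
  have 1: "((\<lambda>t. x + t *\<^sub>R axis i 1) has_derivative (\<lambda>t. t *\<^sub>R axis i 1)) (at (0::real))"
    by (auto intro!: derivative_eq_intros)
  have 2: "(f has_derivative D) (at (x + 0 *\<^sub>R axis i 1))"
    using assms by simp
  have "((\<lambda>t. f (x + t *\<^sub>R axis i 1)) has_derivative (\<lambda>t. D (t *\<^sub>R axis i 1))) (at (0::real))"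
    using has_derivative_compose[OF 1 2] by simp
  moreover have "(\<lambda>t::real. D (t *\<^sub>R axis i 1)) = (*) (D (axis i 1))"
    using linear_cmul[OF has_derivative_linear[OF assms]] by (auto simp: mult.commute)
  ultimately have "((\<lambda>t. f (x + t *\<^sub>R axis i 1)) has_real_derivative D (axis i 1)) (at 0)"
    by (simp add: has_field_derivative_def)
  then show ?thesis
    unfolding partial_deriv_def by (rule DERIV_imp_deriv)
qed

lemma linear_vec_expand:
  fixes D :: "real^'n::finite \<Rightarrow> real"
  assumes "linear D"
  shows "D X = (\<Sum>m\<in>UNIV. X $ m * D (axis m 1))"
proof -
  have "D X = D (\<Sum>m\<in>UNIV. X $ m *\<^sub>R axis m 1)"
    by (metis (no_types) basis_expansion scalar_mult_eq_scaleR sum.cong)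
  also have "\<dots> = (\<Sum>m\<in>UNIV. X $ m * D (axis m 1))"
    using assms by (simp add: linear_sum linear_cmul)
  finally show ?thesis .
qed

lemma has_derivative_partial_derivs:
  fixes f :: "real^'n::finite \<Rightarrow> real"
  assumes "f differentiable (at x)"
  shows "(f has_derivative (\<lambda>X. \<Sum>m\<in>UNIV. X $ m * partial_deriv m f x)) (at x)"
proof -
  obtain D where D: "(f has_derivative D) (at x)"
    using assms by (auto simp: differentiable_def)
  have "D = (\<lambda>X. \<Sum>m\<in>UNIV. X $ m * partial_deriv m f x)"
    unfolding partial_deriv_eqI[OF D]
    by (rule ext) (rule linear_vec_expand[OF has_derivative_linear[OF D]])
  then show ?thesis using D by simp
qed

lemma has_derivative_nhds:
  assumes "(f has_derivative D) (at z)" "\<forall>\<^sub>F w in nhds z. f w = h w"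
  shows "(h has_derivative D) (at z)"
  using has_derivative_transform_eventually[OF assms(1), of h] assms(2)
    eventually_nhds_x_imp_x[OF assms(2)]
  by (simp add: eventually_at_filter eventually_mono)

lemma has_derivative_sub_open:
  assumes "(f has_derivative D) (at z)" "open S" "z \<in> S" "\<And>w. w \<in> S \<Longrightarrow> f w = h w"
  shows "(h has_derivative D) (at z)"
  using has_derivative_transform_within_open[OF assms(1-3)] assms(4) by blast

text \<open>A curried Frechet derivative on pairs of a position and a tangent vector;
  \<open>D X Y\<close> is its value in the direction with position part \<open>X\<close> and vector
  part \<open>Y\<close>. One such fact supplies both kinds of partial derivative in the definitions
  as well as the derivative along the spray.\<close>

definition hasD :: "'n::finite finsler_fun \<Rightarrow> 'n finsler_fun \<Rightarrow> real^'n \<Rightarrow> real^'n \<Rightarrow> bool" where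
  "hasD T D x y \<longleftrightarrow>
     ((\<lambda>z. T (fst z) (snd z)) has_derivative (\<lambda>w. D (fst w) (snd w))) (at (x, y))"

lemma hasD_x:
  assumes "hasD T D x y"
  shows "((\<lambda>z. T z y) has_derivative (\<lambda>X. D X 0)) (at x)"
proof -
  have 1: "((\<lambda>z. (z, y)) has_derivative (\<lambda>X. (X, 0))) (at x)"
    by (auto intro!: derivative_eq_intros)
  show ?thesis
    using has_derivative_compose[OF 1 assms[unfolded hasD_def]] by simp
qed

lemma hasD_y:
  assumes "hasD T D x y"
  shows "((\<lambda>v. T x v) has_derivative (\<lambda>Y. D 0 Y)) (at y)"
proof -
  have 1: "((\<lambda>v. (x, v)) has_derivative (\<lambda>Y. (0, Y))) (at y)"
    by (auto intro!: derivative_eq_intros)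
  show ?thesis
    using has_derivative_compose[OF 1 assms[unfolded hasD_def]] by simp
qed

text \<open>Linearity separates the position slots from the vector slots. Read from right to left,
  it collects a sum of partial derivatives into one directional derivative.\<close>

lemma hasD_split:
  assumes "hasD T D x y"
  shows "D X Y = (\<Sum>m\<in>UNIV. X $ m * D (axis m 1) 0) + (\<Sum>m\<in>UNIV. Y $ m * D 0 (axis m 1))"
proof -
  have l: "linear (\<lambda>w. D (fst w) (snd w))"
    using assms has_derivative_linear unfolding hasD_def by blast
  have "D X Y = D X 0 + D 0 Y"
    using linear_add[OF l, of "(X,0)" "(0,Y)"] by simp
  then show ?thesis
    using linear_vec_expand[OF has_derivative_linear[OF hasD_x[OF assms]], of X]
      linear_vec_expand[OF has_derivative_linear[OF hasD_y[OF assms]], of Y] by simp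
qed

lemma hasD_fst:
  assumes "f differentiable (at x)"
  shows "hasD (\<lambda>x y. f x) (\<lambda>X Y. \<Sum>m\<in>UNIV. X $ m * partial_deriv m f x) x y"
proof -
  have 1: "(fst has_derivative fst) (at (x, y))"
    by (rule bounded_linear_imp_has_derivative[OF bounded_linear_fst])
  have 2: "(f has_derivative (\<lambda>X. \<Sum>m\<in>UNIV. X $ m * partial_deriv m f x)) (at (fst (x, y)))"
    using has_derivative_partial_derivs[OF assms] by simp
  show ?thesis
    unfolding hasD_def by (rule has_derivative_compose[OF 1 2])
qed

lemma hasD_snd: "hasD (\<lambda>x y. y $ i) (\<lambda>X Y. Y $ i) x (y::real^'n::finite)"
proof -
  have "bounded_linear (\<lambda>w::(real^'n) \<times> (real^'n). snd w $ i)"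
    by (intro bounded_linear_compose[OF bounded_linear_vec_nth] bounded_linear_snd)
  then show ?thesis
    unfolding hasD_def by (rule bounded_linear_imp_has_derivative)
qed

lemma hasD_const: "hasD (\<lambda>x y. c) (\<lambda>X Y. 0) x y"
  unfolding hasD_def by simp

lemma hasD_add: "hasD S D x y \<Longrightarrow> hasD T F x y \<Longrightarrow>
    hasD (\<lambda>x y. S x y + T x y) (\<lambda>X Y. D X Y + F X Y) x y"
  unfolding hasD_def by (rule has_derivative_add)

lemma hasD_diff: "hasD S D x y \<Longrightarrow> hasD T F x y \<Longrightarrow>
    hasD (\<lambda>x y. S x y - T x y) (\<lambda>X Y. D X Y - F X Y) x y"
  unfolding hasD_def by (rule has_derivative_diff)

lemma hasD_mult: "hasD S D x y \<Longrightarrow> hasD T F x y \<Longrightarrow>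
    hasD (\<lambda>x y. S x y * T x y) (\<lambda>X Y. S x y * F X Y + D X Y * T x y) x y"
  unfolding hasD_def by (drule (1) has_derivative_mult) simp

lemma hasD_divide: "hasD S D x y \<Longrightarrow> hasD T F x y \<Longrightarrow> T x y \<noteq> 0 \<Longrightarrow>
    hasD (\<lambda>x y. S x y / T x y) (\<lambda>X Y. (D X Y * T x y - S x y * F X Y) / (T x y * T x y)) x y"
  unfolding hasD_def by (drule (1) has_derivative_divide') simp_all

lemma hasD_sum: "(\<And>i. i \<in> I \<Longrightarrow> hasD (S i) (D i) x y) \<Longrightarrow>
    hasD (\<lambda>x y. \<Sum>i\<in>I. S i x y) (\<lambda>X Y. \<Sum>i\<in>I. D i X Y) x y"
  unfolding hasD_def by (rule has_derivative_sum)

lemma hasD_eq: "hasD T D x y \<Longrightarrow> (\<And>X Y. D X Y = F X Y) \<Longrightarrow> hasD T F x y"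
  unfolding hasD_def by simp

lemma hasD_cong_open:
  assumes "hasD S D x y" "open \<Omega>" "(x, y) \<in> \<Omega>" "\<And>x y. (x, y) \<in> \<Omega> \<Longrightarrow> S x y = T x y"
  shows "hasD T D x y"
  using assms(1) unfolding hasD_def
  by (rule has_derivative_sub_open[OF _ assms(2,3)]) (auto intro: assms(4))

lemma hasD_cong:
  assumes "hasD S D x y" "\<And>x y. T x y = S x y" "\<And>X Y. D X Y = F X Y"
  shows "hasD T F x y"
  using assms unfolding hasD_def by simp

lemma hasD_unique:
  assumes "hasD T D x y" "hasD T F x y"
  shows "D X Y = F X Y"
  using has_derivative_unique[OF assms[unfolded hasD_def]] by (metis fst_conv snd_conv)

section \<open>The angular function and the exponential factor\<close>

text \<open>The derivative of \<open>fin_f\<close> in the charge at fixed b and q. The first term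
  stems from arctan (G/2), the second from arctan (L/(h b)).\<close>

definition fin_f_g :: "real \<Rightarrow> real \<Rightarrow> real \<Rightarrow> real" where
  "fin_f_g g b q = - 1 / (2 * fin_h g) + b * (2 * b + g * q) / (4 * fin_h g * fin_B g b q)"

lemma fin_B_pos:
  assumes "- 2 < g" "g < 2" "q \<noteq> 0"
  shows "0 < fin_B g b q"
proof -
  have "g\<^sup>2 < 2\<^sup>2" using assms abs_square_less_1 by (intro power2_strict_mono) auto
  moreover have "fin_B g b q = (b + g / 2 * q)\<^sup>2 + (1 - g\<^sup>2/4) * q\<^sup>2"
    by (simp add: fin_B_def power2_eq_square field_simps)
  moreover have "0 < (1 - g\<^sup>2/4) * q\<^sup>2" using assms(3) calculation(1) by simp
  ultimately show ?thesis by (simp add: add_nonneg_pos)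
qed

lemma fin_h_pos:
  assumes "- 2 < g" "g < 2"
  shows "0 < fin_h g" "(fin_h g)\<^sup>2 = 1 - g\<^sup>2/4"
proof -
  have "g\<^sup>2 < 2\<^sup>2" using assms by (intro power2_strict_mono) auto
  then show "0 < fin_h g" "(fin_h g)\<^sup>2 = 1 - g\<^sup>2/4" by (auto simp: fin_h_def)
qed

lemma fin_h_derivative:
  assumes "- 2 < g z" "g z < 2" and [derivative_intros]: "(g has_derivative g') (at z)"
  shows "((\<lambda>z. fin_h (g z)) has_derivative (\<lambda>w. - g z / (4 * fin_h (g z)) * g' w)) (at z)"
proof -
  have "0 < 1 - (g z)\<^sup>2/4" using fin_h_pos[OF assms(1,2)] by (metis zero_less_power)
  then show ?thesis unfolding fin_h_def
    by (auto intro!: derivative_eq_intros simp: field_simps)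
qed

text \<open>From h^2 + g^2/4 = 1 the quotient rule gives dG = (h^2 + g^2/4) / h^3 dg.\<close>

lemma fin_G_derivative:
  assumes "- 2 < g z" "g z < 2" and g': "(g has_derivative g') (at z)"
  shows "((\<lambda>z. fin_G (g z)) has_derivative (\<lambda>w. g' w / fin_h (g z) ^ 3)) (at z)"
proof -
  note h = fin_h_pos[OF assms(1,2)]
  have e: "g' w * fin_h (g z) - g z * (- g z / (4 * fin_h (g z)) * g' w)
     = (g' w / fin_h (g z) ^ 3) * (fin_h (g z) * fin_h (g z))" for w
  proof -
    have "g' w * fin_h (g z) - g z * (- g z / (4 * fin_h (g z)) * g' w)
       = ((fin_h (g z))\<^sup>2 + (g z)\<^sup>2/4) * g' w / fin_h (g z)"
      using h(1) by (simp add: field_simps power2_eq_square)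
    also have "\<dots> = g' w / fin_h (g z)" by (simp add: h(2))
    also have "\<dots> = (g' w / fin_h (g z) ^ 3) * (fin_h (g z) * fin_h (g z))"
      using h(1) by (simp add: field_simps power3_eq_cube)
    finally show ?thesis .
  qed
  show ?thesis unfolding fin_G_def
    using h(1) e
    by (intro has_derivative_eq_rhs[OF has_derivative_divide'[OF g' fin_h_derivative[OF assms]]]) auto
qed

text \<open>B is the squared radius of the point (h b, L), so the factor 1 + (L/(h b))^2 produced by
  the arctangent equals B / (h b)^2.\<close>

lemma fin_B_L:
  assumes "- 2 < g" "g < 2"
  shows "(fin_h g * b)\<^sup>2 + (fin_L g b q)\<^sup>2 = fin_B g b q"
proof -
  have "(fin_h g * b)\<^sup>2 = (1 - g\<^sup>2/4) * b\<^sup>2"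
    by (simp add: power_mult_distrib fin_h_pos(2)[OF assms])
  then show ?thesis by (simp add: fin_L_def fin_B_def power2_eq_square field_simps)
qed

lemma fin_L_derivative:
  assumes [derivative_intros]: "(g has_derivative g') (at z)" "(b has_derivative b') (at z)" "(q has_derivative q') (at z)"
  shows "((\<lambda>z. fin_L (g z) (b z) (q z)) has_derivative
    (\<lambda>w. q' w + g z / 2 * b' w + g' w / 2 * b z)) (at z)"
  unfolding fin_L_def by (auto intro!: derivative_eq_intros)

lemma open_vimage_has_derivative:
  fixes b :: "'a::real_normed_vector \<Rightarrow> real"
  assumes "(b has_derivative b') (at z)" "open S" "b z \<in> S"
  shows "\<forall>\<^sub>F w in nhds z. b w \<in> S"
proof -
  have "(b \<longlongrightarrow> b z) (nhds z)"
    using has_derivative_continuous[OF assms(1)] by (simp add: continuous_at tendsto_at_iff_tendsto_nhds)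
  then show ?thesis using assms(2,3) by (rule topological_tendstoD)
qed

text \<open>Up to the term arctan (G/2), \<open>fin_f\<close> is the polar angle of the point (h b,
  L). Its differential (h b dL - L d(h b)) / B has no singularity at b = 0, which is why a single
  formula covers all branches of the definition.\<close>

lemma fin_f_derivative:
  assumes g: "- 2 < g z" "g z < 2" and q: "0 < q z"
    and g': "(g has_derivative g') (at z)" and b': "(b has_derivative b') (at z)"
    and q': "(q has_derivative q') (at z)"
  shows "((\<lambda>z. fin_f (g z) (b z) (q z)) has_derivative
    (\<lambda>w. fin_f_g (g z) (b z) (q z) * g' w
      + fin_h (g z) / fin_B (g z) (b z) (q z) * (b z * q' w - q z * b' w))) (at z)"
proof -
  note h = fin_h_pos[OF g]
  define H where "H = fin_h (g z)"
  define L where "L = fin_L (g z) (b z) (q z)"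
  define B where "B = fin_B (g z) (b z) (q z)"
  have H: "0 < H" "H\<^sup>2 = 1 - (g z)\<^sup>2 / 4" and B: "0 < B" "(H * b z)\<^sup>2 + L\<^sup>2 = B"
    using h fin_B_pos[OF g, of "q z"] q fin_B_L[OF g] by (auto simp: H_def B_def L_def)
  note dh = fin_h_derivative[OF g g', folded H_def]
  note dL = fin_L_derivative[OF g' b' q']
  define hb where "hb = (\<lambda>z. fin_h (g z) * b z)"
  have dhb: "(hb has_derivative (\<lambda>w. H * b' w - g z / (4 * H) * g' w * b z)) (at z)"
    unfolding hb_def by (rule has_derivative_eq_rhs[OF has_derivative_mult[OF dh b']]) (auto simp: H_def)
  define D where "D = (\<lambda>w. (H * b z * (q' w + g z / 2 * b' w + g' w / 2 * b z) -
      L * (H * b' w - g z / (4 * H) * g' w * b z)) / B)"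
  have dG: "((\<lambda>z. arctan (fin_G (g z) / 2)) has_derivative (\<lambda>w. g' w / (2 * H))) (at z)"
  proof -
    have "1 + (fin_G (g z) / 2)\<^sup>2 = (H\<^sup>2 + (g z)\<^sup>2 / 4) / H\<^sup>2"
      using H(1) by (simp add: fin_G_def H_def[symmetric] field_simps)
    then have "1 + (fin_G (g z) / 2)\<^sup>2 = 1 / H\<^sup>2" by (simp add: H(2))
    then have "inverse (1 + (fin_G (g z) / 2)\<^sup>2) = H\<^sup>2" by simp
    then show ?thesis
      using fin_G_derivative[OF g g', folded H_def] H(1)
      by (auto intro!: derivative_eq_intros simp: power2_eq_square power3_eq_cube field_simps)
  qed
  have "((\<lambda>z. fin_f (g z) (b z) (q z)) has_derivative (\<lambda>w. D w - g' w / (2 * H))) (at z)"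
  proof (cases "b z = 0")
    case False
    have "((\<lambda>z. arctan (fin_L (g z) (b z) (q z) / hb z)) has_derivative D) (at z)"
    proof -
      have n: "hb z \<noteq> 0" using False H by (simp add: hb_def H_def)
      then have n': "(hb z)\<^sup>2 + L\<^sup>2 = B" "B \<noteq> 0" using B by (auto simp: hb_def H_def)
      have "inverse (1 + (L / hb z)\<^sup>2) = (hb z)\<^sup>2 / B"
        using n n' by (simp add: field_simps)
      then have "((\<lambda>z. arctan (fin_L (g z) (b z) (q z) / hb z)) has_derivative
        (\<lambda>w. ((q' w + g z / 2 * b' w + g' w / 2 * b z) * hb z -
          L * (H * b' w - g z / (4 * H) * g' w * b z)) / (hb z * hb z) * ((hb z)\<^sup>2 / B))) (at z)"
        using has_derivative_compose[OF has_derivative_divide'[OF dL dhb n] DERIV_arctan[THEN has_field_derivative_imp_has_derivative]]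
        by (simp add: L_def mult.commute)
      moreover have "(\<lambda>w. ((q' w + g z / 2 * b' w + g' w / 2 * b z) * hb z -
          L * (H * b' w - g z / (4 * H) * g' w * b z)) / (hb z * hb z) * ((hb z)\<^sup>2 / B)) = D"
        using n unfolding D_def by (auto simp: power2_eq_square) (simp add: hb_def H_def mult.commute)
      ultimately show ?thesis by simp
    qed
    then have A: "((\<lambda>z. c - arctan (fin_G (g z) / 2) + arctan (fin_L (g z) (b z) (q z) / hb z))
        has_derivative (\<lambda>w. D w - g' w / (2 * H))) (at z)" for c
      by (intro has_derivative_eq_rhs[OF has_derivative_add[OF has_derivative_diff[OF has_derivative_const dG]]]) auto
    show ?thesis
    proof (cases "b z > 0")
      case True
      then have "\<forall>\<^sub>F w in nhds z. b w > 0"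
        using open_vimage_has_derivative[OF b', of "{0<..}"] by simp
      then have "\<forall>\<^sub>F w in nhds z. 0 - arctan (fin_G (g w) / 2) + arctan (fin_L (g w) (b w) (q w) / hb w) =
         fin_f (g w) (b w) (q w)"
        by eventually_elim (simp add: fin_f_def hb_def)
      then show ?thesis by (rule has_derivative_nhds[OF A])
    next
      case F: False
      then have "\<forall>\<^sub>F w in nhds z. b w < 0"
        using open_vimage_has_derivative[OF b', of "{..<0}"] False by simp
      then have "\<forall>\<^sub>F w in nhds z. pi - arctan (fin_G (g w) / 2) + arctan (fin_L (g w) (b w) (q w) / hb w) =
         fin_f (g w) (b w) (q w)"
        by eventually_elim (simp add: fin_f_def hb_def)
      then show ?thesis by (rule has_derivative_nhds[OF A])
    qed
  next
    case True
    \<comment> \<open>At b = 0 the quotient L/(h b) breaks down, but L = q > 0 there, so the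
      reciprocal can be used nearby. Since arctan (1/X) = sgn X * pi/2 - arctan X, both branches and
      the value at b = 0 agree with pi/2 - arctan (G/2) - arctan (h b/L).\<close>
    then have L: "L > 0" using q by (simp add: L_def fin_L_def)
    have "((\<lambda>z. arctan (hb z / fin_L (g z) (b z) (q z))) has_derivative (\<lambda>w. - D w)) (at z)"
    proof -
      have n: "fin_L (g z) (b z) (q z) \<noteq> 0" using L by (simp add: L_def)
      have hb0: "hb z = 0" using True by (simp add: hb_def)
      have BL: "B = L * L" using B True by (simp add: power2_eq_square)
      have "((\<lambda>z. arctan (hb z / fin_L (g z) (b z) (q z))) has_derivative
        (\<lambda>w. ((H * b' w - g z / (4 * H) * g' w * b z) * L) / (L * L))) (at z)"
        using has_derivative_compose[OF has_derivative_divide'[OF dhb dL n] DERIV_arctan[THEN has_field_derivative_imp_has_derivative]]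
        by (simp add: L_def[symmetric] hb0)
      then show ?thesis unfolding D_def using True BL by simp
    qed
    then have A: "((\<lambda>z. pi / 2 - arctan (fin_G (g z) / 2) - arctan (hb z / fin_L (g z) (b z) (q z)))
        has_derivative (\<lambda>w. D w - g' w / (2 * H))) (at z)"
      by (intro has_derivative_eq_rhs[OF has_derivative_diff[OF has_derivative_diff[OF has_derivative_const dG]]]) auto
    have "\<forall>\<^sub>F w in nhds z. fin_L (g w) (b w) (q w) > 0"
      using open_vimage_has_derivative[OF dL, of "{0<..}"] L by (simp add: L_def)
    moreover have "\<forall>\<^sub>F w in nhds z. fin_h (g w) > 0"
      using open_vimage_has_derivative[OF dh, of "{0<..}"] H by (simp add: H_def)
    ultimately have "\<forall>\<^sub>F w in nhds z.
      pi / 2 - arctan (fin_G (g w) / 2) - arctan (hb w / fin_L (g w) (b w) (q w)) =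
         fin_f (g w) (b w) (q w)"
    proof eventually_elim
      case (elim w)
      define X where "X = hb w / fin_L (g w) (b w) (q w)"
      have inv: "arctan (1 / X) = sgn X * pi / 2 - arctan X" if "X \<noteq> 0"
        using that by (rule Transcendental.arctan_inverse)
      have "fin_L (g w) (b w) (q w) / (fin_h (g w) * b w) = 1 / X"
        by (simp add: X_def hb_def)
      moreover have "sgn X = sgn (b w)"
        using elim by (simp add: X_def hb_def sgn_mult sgn_divide)
      ultimately show ?case
        using inv unfolding fin_f_def X_def[symmetric]
        by (cases "b w" "0::real" rule: linorder_cases) (auto simp: sgn_real_def split: if_splits)
    qed
    then show ?thesis by (rule has_derivative_nhds[OF A])
  qed
  moreover have "D w - g' w / (2 * H) = fin_f_g (g z) (b z) (q z) * g' w
      + H / B * (b z * q' w - q z * b' w)" for w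
  proof -
    \<comment> \<open>The coefficient of \<open>g' w\<close> in \<open>D w * B\<close>; it collapses
      because h^2 + g^2/4 = 1.\<close>
    have "H * (b z * b z * g' w) / 2 + L * g z / (4 * H) * g' w * b z
        = b z * (2 * b z * (H\<^sup>2 + (g z)\<^sup>2 / 4) + g z * q z) / (4 * H) * g' w"
      using H(1) by (simp add: L_def fin_L_def field_simps power2_eq_square)
    also have "\<dots> = b z * (2 * b z + g z * q z) / (4 * H) * g' w"
      by (simp add: H(2))
    finally have *: "H * (b z * b z * g' w) / 2 + L * g z / (4 * H) * g' w * b z
       = b z * (2 * b z + g z * q z) / (4 * H) * g' w" .
    have "D w * B = H * (b z * q' w - q z * b' w) +
         (H * (b z * b z * g' w) / 2 + L * g z / (4 * H) * g' w * b z)"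
    proof -
      have "D w * B = H * b z * (q' w + g z / 2 * b' w + g' w / 2 * b z) -
          L * (H * b' w - g z / (4 * H) * g' w * b z)"
        using B(1) by (simp add: D_def)
      also have "\<dots> = H * (b z * q' w - q z * b' w) +
         (H * (b z * b z * g' w) / 2 + L * g z / (4 * H) * g' w * b z)"
        using H(1) by (simp add: L_def fin_L_def field_simps)
      finally show ?thesis .
    qed
    then have "D w = (H * (b z * q' w - q z * b' w) + b z * (2 * b z + g z * q z) / (4 * H) * g' w) / B"
      unfolding * using B(1) by (simp add: nonzero_eq_divide_eq)
    also have "\<dots> = H / B * (b z * q' w - q z * b' w) + b z * (2 * b z + g z * q z) / (4 * H * B) * g' w"
      by (simp add: add_divide_distrib)
    finally have "D w = H / B * (b z * q' w - q z * b' w) + b z * (2 * b z + g z * q z) / (4 * H * B) * g' w" .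
    then show ?thesis
      by (simp add: fin_f_g_def H_def[symmetric] B_def[symmetric] algebra_simps)
  qed
  ultimately show ?thesis by (simp add: H_def B_def)
qed

section \<open>The exponential factor of the squared metric function\<close>

definition fin_E :: "real \<Rightarrow> real \<Rightarrow> real \<Rightarrow> real" where
  "fin_E g b q = exp (- (fin_G g * fin_f g b q))"

definition fin_M :: "real \<Rightarrow> real \<Rightarrow> real \<Rightarrow> real" where
  "fin_M g b q = - fin_f g b q / fin_h g ^ 3 - fin_G g * fin_f_g g b q"

text \<open>Since G h = g, the square roots cancel in the b and q directions and the logarithmic
  differential there is g/B times the form q db - b dq. With dq = v_i dy^i / q this form is the
  source of the covector \<open>wh\<close>.\<close>

lemma fin_E_derivative:
  assumes g: "- 2 < g z" "g z < 2" and q: "0 < q z"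
    and g': "(g has_derivative g') (at z)" and b': "(b has_derivative b') (at z)"
    and q': "(q has_derivative q') (at z)"
  shows "((\<lambda>z. fin_E (g z) (b z) (q z)) has_derivative
    (\<lambda>w. fin_E (g z) (b z) (q z) * (fin_M (g z) (b z) (q z) * g' w
      + g z / fin_B (g z) (b z) (q z) * (q z * b' w - b z * q' w)))) (at z)"
proof -
  note h = fin_h_pos[OF g]
  have "((\<lambda>z. exp (- (fin_G (g z) * fin_f (g z) (b z) (q z)))) has_derivative
    (\<lambda>w. exp (- (fin_G (g z) * fin_f (g z) (b z) (q z))) *
       - (fin_G (g z) * (fin_f_g (g z) (b z) (q z) * g' w
      + fin_h (g z) / fin_B (g z) (b z) (q z) * (b z * q' w - q z * b' w))
      + g' w / fin_h (g z) ^ 3 * fin_f (g z) (b z) (q z)))) (at z)"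
    using has_derivative_exp[OF has_derivative_minus[OF has_derivative_mult[OF
      fin_G_derivative[OF g g'] fin_f_derivative[OF g q g' b' q']]]]
    by (simp add: mult.commute)
  moreover have "- (fin_G (g z) * (fin_f_g (g z) (b z) (q z) * g' w
      + fin_h (g z) / fin_B (g z) (b z) (q z) * (b z * q' w - q z * b' w))
      + g' w / fin_h (g z) ^ 3 * fin_f (g z) (b z) (q z)) = (fin_M (g z) (b z) (q z) * g' w
      + g z / fin_B (g z) (b z) (q z) * (q z * b' w - b z * q' w))" for w
    using h(1) fin_B_pos[OF g, of "q z" "b z"] q
    by (simp add: fin_M_def fin_G_def field_simps)
  ultimately show ?thesis unfolding fin_E_def by simp
qed

lemma fin_B_derivative:
  assumes "(g has_derivative g') (at z)" "(b has_derivative b') (at z)" "(q has_derivative q') (at z)"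
  shows "((\<lambda>z. fin_B (g z) (b z) (q z)) has_derivative
    (\<lambda>w. b z * q z * g' w + (2 * b z + g z * q z) * b' w + (g z * b z + 2 * q z) * q' w)) (at z)"
  unfolding fin_B_def power2_eq_square
  by (rule has_derivative_eq_rhs, (rule has_derivative_add has_derivative_mult assms)+)
    (auto simp: algebra_simps)

text \<open>The charge is held fixed because only derivatives in y are taken of
  \<open>fin_M\<close>. The coefficient is the one dictated by equality of mixed derivatives of log
  E: the derivative of g/B in g is (b^2 + q^2) / B^2.\<close>

lemma fin_M_derivative:
  fixes b q :: "'a::real_normed_vector \<Rightarrow> real"
  assumes g: "- 2 < g" "g < 2" and q: "0 < q z"
    and b': "(b has_derivative b') (at z)" and q': "(q has_derivative q') (at z)"
  shows "((\<lambda>z. fin_M g (b z) (q z)) has_derivative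
    (\<lambda>w. ((b z)\<^sup>2 + (q z)\<^sup>2) / (fin_B g (b z) (q z))\<^sup>2 * (q z * b' w - b z * q' w))) (at z)"
proof -
  define H where "H = fin_h g"
  define B where "B = fin_B g (b z) (q z)"
  have H: "0 < H" "H\<^sup>2 = 1 - g\<^sup>2/4" using fin_h_pos[OF g] by (auto simp: H_def)
  have B: "0 < B" using fin_B_pos[OF g, of "q z" "b z"] q by (auto simp: B_def)
  note dg = has_derivative_const[of g]
  have df: "((\<lambda>z. fin_f g (b z) (q z)) has_derivative (\<lambda>w. H / B * (b z * q' w - q z * b' w))) (at z)"
    using fin_f_derivative[of "\<lambda>_. g", OF g q dg b' q'] by (simp add: H_def B_def)
  have dB: "((\<lambda>z. fin_B g (b z) (q z)) has_derivative
    (\<lambda>w. (2 * b z + g * q z) * b' w + (g * b z + 2 * q z) * q' w)) (at z)"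
    using fin_B_derivative[OF dg b' q'] by simp
  have dN: "((\<lambda>z. b z * (2 * b z + g * q z)) has_derivative
    (\<lambda>w. (4 * b z + g * q z) * b' w + g * b z * q' w)) (at z)"
    by (rule has_derivative_eq_rhs, (rule has_derivative_add has_derivative_mult has_derivative_const b' q')+)
      (auto simp: algebra_simps)
  define k where "k = (\<lambda>w. q z * b' w - b z * q' w)"
  have dQ: "((\<lambda>z. b z * (2 * b z + g * q z) / fin_B g (b z) (q z)) has_derivative
    (\<lambda>w. (4 * b z * q z + g * (b z)\<^sup>2 + g * (q z)\<^sup>2) / B\<^sup>2 * k w)) (at z)"
  proof (rule has_derivative_eq_rhs[OF has_derivative_divide'[OF dN dB]])
    show "fin_B g (b z) (q z) \<noteq> 0" using B by (simp add: B_def)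
    have "((4 * b z + g * q z) * b' w + g * b z * q' w) * B
        - b z * (2 * b z + g * q z) * ((2 * b z + g * q z) * b' w + (g * b z + 2 * q z) * q' w)
        = (4 * b z * q z + g * (b z)\<^sup>2 + g * (q z)\<^sup>2) * k w" for w
      unfolding B_def fin_B_def k_def by algebra
    then show "(\<lambda>w. (((4 * b z + g * q z) * b' w + g * b z * q' w) * fin_B g (b z) (q z)
        - b z * (2 * b z + g * q z) * ((2 * b z + g * q z) * b' w + (g * b z + 2 * q z) * q' w))
        / (fin_B g (b z) (q z) * fin_B g (b z) (q z)))
      = (\<lambda>w. (4 * b z * q z + g * (b z)\<^sup>2 + g * (q z)\<^sup>2) / B\<^sup>2 * k w)"
      using B by (auto simp: B_def[symmetric] power2_eq_square)
  qed
  have M: "fin_M g (b z) (q z) = - (1 / H ^ 3) * fin_f g (b z) (q z)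
      + (g / (2 * H\<^sup>2)) - (g / (4 * H\<^sup>2)) * (b z * (2 * b z + g * q z) / fin_B g (b z) (q z))" for z
  proof -
    define X where "X = b z * (2 * b z + g * q z) / fin_B g (b z) (q z)"
    have *: "b z * (2 * b z + g * q z) / (4 * H * fin_B g (b z) (q z)) = X / (4 * H)"
      by (simp add: X_def)
    show ?thesis
      unfolding fin_M_def fin_f_g_def fin_G_def H_def[symmetric] * X_def[symmetric]
      using H(1) by (simp add: power2_eq_square field_simps)
  qed
  have "((\<lambda>z. fin_M g (b z) (q z)) has_derivative
    (\<lambda>w. - (1 / H ^ 3) * (H / B * (b z * q' w - q z * b' w)) -
       (g / (4 * H\<^sup>2)) * ((4 * b z * q z + g * (b z)\<^sup>2 + g * (q z)\<^sup>2) / B\<^sup>2 * k w))) (at z)"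
    unfolding M
    by (rule has_derivative_eq_rhs, (rule has_derivative_add has_derivative_diff has_derivative_mult
       has_derivative_const df dQ)+) auto
  moreover have "- (1 / H ^ 3) * (H / B * (b z * q' w - q z * b' w)) -
       (g / (4 * H\<^sup>2)) * ((4 * b z * q z + g * (b z)\<^sup>2 + g * (q z)\<^sup>2) / B\<^sup>2 * k w)
     = ((b z)\<^sup>2 + (q z)\<^sup>2) / B\<^sup>2 * k w" for w
  proof -
    have "- (1 / H ^ 3) * (H / B * (b z * q' w - q z * b' w)) -
       (g / (4 * H\<^sup>2)) * ((4 * b z * q z + g * (b z)\<^sup>2 + g * (q z)\<^sup>2) / B\<^sup>2 * k w)
      = (4 * B - g * (4 * b z * q z + g * (b z)\<^sup>2 + g * (q z)\<^sup>2)) / (4 * H\<^sup>2 * B\<^sup>2) * k w"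
      using H(1) B unfolding k_def by (simp add: field_simps power2_eq_square power3_eq_cube)
    \<comment> \<open>The factor 4 - g^2 = 4 h^2 splits off and cancels the denominator.\<close>
    also have "4 * B - g * (4 * b z * q z + g * (b z)\<^sup>2 + g * (q z)\<^sup>2)
       = 4 * H\<^sup>2 * ((b z)\<^sup>2 + (q z)\<^sup>2)"
      unfolding H(2) B_def fin_B_def by algebra
    finally show ?thesis using H(1) by simp
  qed
  ultimately show ?thesis by (simp add: k_def B_def)
qed

lemma finsleroid_K_sq:
  assumes "- 2 < g x" "g x < 2" "0 < fin_q a b x y"
  shows "(finsleroid_K a b g x y)\<^sup>2 = fin_B (g x) (form_b b x y) (fin_q a b x y)
      * fin_E (g x) (form_b b x y) (fin_q a b x y)"
    and "0 < finsleroid_K a b g x y"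
proof -
  have B: "0 < fin_B (g x) (form_b b x y) (fin_q a b x y)"
    using assms by (intro fin_B_pos) auto
  then show "0 < finsleroid_K a b g x y" by (simp add: finsleroid_K_def)
  show "(finsleroid_K a b g x y)\<^sup>2 = fin_B (g x) (form_b b x y) (fin_q a b x y)
      * fin_E (g x) (form_b b x y) (fin_q a b x y)"
    using B by (simp add: finsleroid_K_def fin_E_def power_mult_distrib flip: exp_double)
qed

section \<open>Scalar identities\<close>

text \<open>The third derivative of K^2 with indices replaced by reals: \<open>bi\<close>,
  \<open>vi\<close> and the like are components, while \<open>bt\<close>, \<open>vt\<close>,
  \<open>ai\<close>, \<open>aj\<close> are contractions with a vector theta. \<open>br'\<close> and
  \<open>B'\<close> are the vertical derivatives of \<open>br\<close> and \<open>B\<close> along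
  theta. The right-hand side has the shape of the Cartan tensor; multiplying by q^3 and B leaves a
  polynomial identity.\<close>

lemma cartan_algebra:
  fixes b g q B bi bj vi vj aij ai aj bt vt :: real
  assumes B: "B = b\<^sup>2 + g * b * q + q\<^sup>2" and nz: "B \<noteq> 0" "q \<noteq> 0"
  defines "br \<equiv> q * (b + g * q) * (bi * bj) + q * (bi * vj + vi * bj) - b / q * (vi * vj)"
    and "br' \<equiv> (vt / q * (b + g * q) + q * (bt + g * (vt / q))) * (bi * bj) + vt / q * (bi * vj + vi * bj)
        + q * (bi * (aj - bt * bj) + (ai - bt * bi) * bj) - (bt / q - b * (vt / q) / (q * q)) * (vi * vj)
        - b / q * ((ai - bt * bi) * vj + vi * (aj - bt * bj))"
    and "B' \<equiv> (2 * b + g * q) * bt + (g * b + 2 * q) * (vt / q)"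
    and "wi \<equiv> q * bi - b / q * vi" and "wj \<equiv> q * bj - b / q * vj" and "wt \<equiv> q * bt - b / q * vt"
  shows "wt * (aij + g / B * br) + br' - B' / B * br =
      (aij - bi * bj - vi * vj / q\<^sup>2 + wi * wj / B) * wt
      + (ai - bi * bt - vi * vt / q\<^sup>2 + wi * wt / B) * wj
      + (aj - bj * bt - vj * vt / q\<^sup>2 + wj * wt / B) * wi - wi * wj * wt / B"
proof -
  have "q ^ 3 * ((g * wt - B') * br) = q ^ 3 * (2 * (wi * wj * wt)
     + B * ((- bi * bj - vi * vj / q\<^sup>2) * wt + (- bi * bt - vi * vt / q\<^sup>2) * wj
      + (- bj * bt - vj * vt / q\<^sup>2) * wi - (br' - ai * wj - aj * wi)))"
    unfolding br_def br'_def B'_def wi_def wj_def wt_def B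
    using nz(2) by (simp add: divide_simps) algebra
  then have *: "(g * wt - B') * br = 2 * (wi * wj * wt)
     + B * ((- bi * bj - vi * vj / q\<^sup>2) * wt + (- bi * bt - vi * vt / q\<^sup>2) * wj
      + (- bj * bt - vj * vt / q\<^sup>2) * wi - (br' - ai * wj - aj * wi))"
    using nz(2) by simp
  have "(wt * (aij + g / B * br) + br' - B' / B * br) * B = wt * aij * B + br' * B + (g * wt - B') * br"
    using nz(1) by (simp add: field_simps)
  also have "\<dots> = ((aij - bi * bj - vi * vj / q\<^sup>2 + wi * wj / B) * wt
      + (ai - bi * bt - vi * vt / q\<^sup>2 + wi * wt / B) * wj
      + (aj - bj * bt - vj * vt / q\<^sup>2 + wj * wt / B) * wi - wi * wj * wt / B) * B"
    unfolding * using nz(1) by (simp add: algebra_simps)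
  finally show ?thesis using nz(1) by simp
qed

text \<open>Splits the Hessian form of g_ij into its angular part and the square of the covector
  \<open>vi + (b + g * q) * bi\<close>, which is y_i / E.\<close>

lemma angular_algebra:
  fixes b g q B bi bj vi vj aij :: real
  assumes B: "B = b\<^sup>2 + g * b * q + q\<^sup>2" and nz: "B \<noteq> 0" "q \<noteq> 0"
  shows "aij + g / B * (q * (b + g * q) * (bi * bj) + q * (bi * vj + vi * bj) - b / q * (vi * vj))
    = (aij - bi * bj - vi * vj / q\<^sup>2 + (q * bi - b / q * vi) * (q * bj - b / q * vj) / B)
      + (vi + (b + g * q) * bi) * (vj + (b + g * q) * bj) / B"
proof -
  have "q\<^sup>2 * (g * (q * (b + g * q) * (bi * bj) + q * (bi * vj + vi * bj) - b / q * (vi * vj)))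
     = q\<^sup>2 * ((- bi * bj - vi * vj / q\<^sup>2) * B + (q * bi - b / q * vi) * (q * bj - b / q * vj)
      + (vi + (b + g * q) * bi) * (vj + (b + g * q) * bj))"
    unfolding B using nz(2) by (simp add: divide_simps) algebra
  then have *: "g * (q * (b + g * q) * (bi * bj) + q * (bi * vj + vi * bj) - b / q * (vi * vj))
     = (- bi * bj - vi * vj / q\<^sup>2) * B + (q * bi - b / q * vi) * (q * bj - b / q * vj)
      + (vi + (b + g * q) * bi) * (vj + (b + g * q) * bj)"
    using nz(2) by simp
  have "g / B * (q * (b + g * q) * (bi * bj) + q * (bi * vj + vi * bj) - b / q * (vi * vj))
     = ((- bi * bj - vi * vj / q\<^sup>2) * B + (q * bi - b / q * vi) * (q * bj - b / q * vj)
      + (vi + (b + g * q) * bi) * (vj + (b + g * q) * bj)) / B"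
    unfolding *[symmetric] by simp
  also have "\<dots> = (- bi * bj - vi * vj / q\<^sup>2) + (q * bi - b / q * vi) * (q * bj - b / q * vj) / B
      + (vi + (b + g * q) * bi) * (vj + (b + g * q) * bj) / B"
    using nz(1) by (simp add: add_divide_distrib)
  finally show ?thesis by simp
qed

text \<open>What remains of \<open>connection_identity\<close> after division by E and after the
  multiples of g_ij and of the angular metric have been matched. \<open>B'\<close>,
  \<open>M'\<close> and \<open>p'\<close> are vertical derivatives in the i-th direction, and
  \<open>m\<close> is the gradient factor of the charge.\<close>

lemma spray_algebra:
  fixes b g q B M m bi bj vi vj :: real
  assumes B: "B = b\<^sup>2 + g * b * q + q\<^sup>2" and nz: "B \<noteq> 0" "q \<noteq> 0"
  defines "wi \<equiv> q * bi - b / q * vi" and "wj \<equiv> q * bj - b / q * vj"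
    and "li \<equiv> vi + (b + g * q) * bi" and "lj \<equiv> vj + (b + g * q) * bj"
    and "B' \<equiv> (2 * b + g * q) * bi + (g * b + 2 * q) * (vi / q)"
    and "br \<equiv> q * (b + g * q) * (bj * bi) + q * (bj * vi + vj * bi) - b / q * (vj * vi)"
  defines "M' \<equiv> (b\<^sup>2 + q\<^sup>2) / B\<^sup>2 * wi"
    and "p \<equiv> m / 2 * (b * q - B * M)"
  defines "p' \<equiv> m / 2 * (q * bi + b * (vi / q) - (B' * M + B * M'))"
  shows "m * b * ((B - g * (b * q)) / B\<^sup>2 * br + g / B * (q\<^sup>2 * (bj * bi))) - m * bj * M * li - p * g * q * wj * wi / B\<^sup>2
    = p' * bj + (m * b * M' - g * (vi / q * B - q * B') / B\<^sup>2 * p) * lj - g * q / B\<^sup>2 * p * lj * li"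
proof -
  define Vi Vj where "Vi = vi / q" and "Vj = vj / q"
  have v: "vi = q * Vi" "vj = q * Vj" using nz by (auto simp: Vi_def Vj_def)
  have wi: "wi = q * bi - b * Vi" and wj: "wj = q * bj - b * Vj"
    unfolding wi_def wj_def v using nz by auto
  have br: "br = q * (b + g * q) * (bj * bi) + q * (bj * (q * Vi) + (q * Vj) * bi) - b * q * (Vj * Vi)"
    unfolding br_def v using nz by auto
  have B': "B' = (2 * b + g * q) * bi + (g * b + 2 * q) * Vi" unfolding B'_def Vi_def ..
  have MM: "B\<^sup>2 * M' = (b\<^sup>2 + q\<^sup>2) * wi" unfolding M'_def using nz by simp
  have p: "2 * p = m * (b * q - B * M)" unfolding p_def by simp
  have p': "2 * B * p' = m * (B * (q * bi + b * Vi) - B * B' * M - (b\<^sup>2 + q\<^sup>2) * wi)"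
    unfolding p'_def MM[symmetric] Vi_def by (simp add: algebra_simps power2_eq_square)
  \<comment> \<open>An explicit reciprocal of B: the equations become polynomial, and B * I = 1 is
    applied by rewriting.\<close>
  define I where "I = 1 / B"
  have I: "B * I = 1" using nz by (simp add: I_def)
  have dI: "c / B = c * I" "c / B\<^sup>2 = c * I\<^sup>2" for c
    by (simp_all add: I_def power_one_over)
  have "2 * B\<^sup>2 * (m * b * ((B - g * (b * q)) / B\<^sup>2 * br + g / B * (q\<^sup>2 * (bj * bi))) - m * bj * M * li - p * g * q * wj * wi / B\<^sup>2)
     = 2 * m * b * ((B - g * (b * q)) * br * (B * I)\<^sup>2 + g * B * (q\<^sup>2 * (bj * bi)) * (B * I)) - 2 * B\<^sup>2 * m * bj * M * li - (2 * p) * g * q * wj * wi * (B * I)\<^sup>2"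
    unfolding dI by algebra
  also have "\<dots> = 2 * m * b * ((B - g * (b * q)) * br + g * B * (q\<^sup>2 * (bj * bi))) - 2 * B\<^sup>2 * m * bj * M * li - (2 * p) * g * q * wj * wi"
    unfolding I by simp
  also have "\<dots> = B * (2 * B * p') * bj + (2 * m * b * (B\<^sup>2 * M') - g * (Vi * B - q * B') * (2 * p)) * lj - g * q * (2 * p) * lj * li"
    unfolding p p' MM unfolding wi wj br B' li_def lj_def v unfolding B by algebra
  also have "\<dots> = 2 * B\<^sup>2 * p' * bj + (2 * m * b * (B\<^sup>2 * M') - g * (Vi * B - q * B') * (2 * p) * (B * I)\<^sup>2) * lj - g * q * (2 * p) * lj * li * (B * I)\<^sup>2"
    unfolding I by (simp add: power2_eq_square)
  also have "\<dots> = 2 * B\<^sup>2 * (p' * bj + (m * b * M' - g * (vi / q * B - q * B') / B\<^sup>2 * p) * lj - g * q / B\<^sup>2 * p * lj * li)"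
    unfolding Vi_def[symmetric] dI by algebra
  finally show ?thesis using nz by simp
qed

text \<open>The parallelism of w in components, up to the factor K/B and without the Levi-Civita
  terms: the left side comes from the derivative of w along the spray, the right side from
  contracting the nonlinear connection with w.\<close>

lemma transport_algebra:
  fixes b g q B M m bi vi :: real
  assumes B: "B = b\<^sup>2 + g * b * q + q\<^sup>2" and nz: "B \<noteq> 0" "q \<noteq> 0"
  defines "wi \<equiv> q * bi - b / q * vi"
    and "B' \<equiv> (2 * b + g * q) * bi + (g * b + 2 * q) * (vi / q)"
  defines "M' \<equiv> (b\<^sup>2 + q\<^sup>2) / B\<^sup>2 * wi"
    and "p \<equiv> m / 2 * (b * q - B * M)"
  defines "p' \<equiv> m / 2 * (q * bi + b * (vi / q) - (B' * M + B * M'))"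
    and "s \<equiv> m * b * M - g * q / B * p"
  shows "m * b / 2 * (M - b * q / B) * wi + p * (b / B * wi + vi / q) = p' * q / 2 + s * wi / 2"
proof -
  define Vi where "Vi = vi / q"
  have v: "vi = q * Vi" using nz by (auto simp: Vi_def)
  have wi: "wi = q * bi - b * Vi" unfolding wi_def v using nz by auto
  have B': "B' = (2 * b + g * q) * bi + (g * b + 2 * q) * Vi" unfolding B'_def Vi_def ..
  have MM: "B\<^sup>2 * M' = (b\<^sup>2 + q\<^sup>2) * wi" unfolding M'_def using nz by simp
  have p: "2 * p = m * (b * q - B * M)" unfolding p_def by simp
  have p': "2 * B * p' = m * (B * (q * bi + b * Vi) - B * B' * M - (b\<^sup>2 + q\<^sup>2) * wi)"
    unfolding p'_def MM[symmetric] Vi_def by (simp add: algebra_simps power2_eq_square)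
  have s: "2 * B * s = 2 * B * m * b * M - g * q * (2 * p)" unfolding s_def using nz by (simp add: field_simps)
  have "4 * B * (m * b / 2 * (M - b * q / B) * wi + p * (b / B * wi + vi / q)) =
     2 * m * b * (B * M - b * q) * wi + 2 * (2 * p) * (b * wi + B * Vi)"
    unfolding Vi_def[symmetric] using nz by (simp add: field_simps)
  also have "\<dots> = (2 * B * p') * q + (2 * B * s) * wi"
    unfolding s p' p unfolding wi B' unfolding B by algebra
  also have "\<dots> = 4 * B * (p' * q / 2 + s * wi / 2)" by (simp add: field_simps)
  finally show ?thesis using nz by simp
qed

section \<open>Finsleroid geometry in a chart\<close>

lemma matrix_inv_mult:
  fixes A :: "real^'n::finite^'n"
  assumes "invertible A"
  shows "A ** matrix_inv A = mat 1" "matrix_inv A ** A = mat 1"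
proof -
  have "\<exists>A'. A ** A' = mat 1 \<and> A' ** A = mat 1"
    using assms by (simp add: invertible_def)
  then have "A ** matrix_inv A = mat 1 \<and> matrix_inv A ** A = mat 1"
    unfolding matrix_inv_def by (rule someI_ex)
  then show "A ** matrix_inv A = mat 1" "matrix_inv A ** A = mat 1" by auto
qed

text \<open>The data as seen in one chart, with \<open>mu\<close> the factor in the gradient of the
  charge. The theorem interprets the locale for each chart of the atlas.\<close>

locale finsleroid_chart =
  fixes U :: "(real^'n::finite) set"
    and a :: "real^'n \<Rightarrow> real^'n^'n"
    and b :: "real^'n \<Rightarrow> real^'n"
    and g \<mu> :: "real^'n \<Rightarrow> real"
  assumes open_U: "open U"
    and a_differentiable: "x \<in> U \<Longrightarrow> (\<lambda>x. a x $ i $ j) differentiable (at x)"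
    and b_differentiable: "x \<in> U \<Longrightarrow> (\<lambda>x. b x $ i) differentiable (at x)"
    and g_differentiable: "x \<in> U \<Longrightarrow> g differentiable (at x)"
    and a_sym: "x \<in> U \<Longrightarrow> a x $ i $ j = a x $ j $ i"
    and a_pos: "x \<in> U \<Longrightarrow> v \<noteq> 0 \<Longrightarrow> v \<bullet> (a x *v v) > 0"
    and b_unit: "x \<in> U \<Longrightarrow> (\<Sum>i\<in>UNIV. \<Sum>j\<in>UNIV. matrix_inv (a x) $ i $ j * b x $ i * b x $ j) = 1"
    and g_range: "x \<in> U \<Longrightarrow> - 2 < g x" "x \<in> U \<Longrightarrow> g x < 2"
    and g_nonzero: "x \<in> U \<Longrightarrow> g x \<noteq> 0"
    and b_parallel: "x \<in> U \<Longrightarrow> nabla_one_form a b i j x = 0"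
    and g_gradient: "x \<in> U \<Longrightarrow> partial_deriv i g x = \<mu> x * b x $ i"
begin

section \<open>The Levi-Civita connection of the chart metric\<close>

lemma a_invertible:
  assumes "x \<in> U"
  shows "invertible (a x)"
proof -
  have "v = 0" if "a x *v v = 0" for v
    using a_pos[OF assms, of v] that by (cases "v = 0") auto
  then show ?thesis
    by (metis invertible_left_inverse matrix_left_invertible_ker)
qed

lemma a_inv:
  assumes "x \<in> U"
  shows "a x *v (matrix_inv (a x) *v c) = c" "matrix_inv (a x) *v (a x *v c) = c"
  using matrix_inv_mult[OF a_invertible[OF assms]]
  by (simp_all add: matrix_vector_mul_assoc)

abbreviation "chr k i j x \<equiv> christoffel a k i j x"

lemma partial_a_sym:
  assumes "x \<in> U"
  shows "partial_deriv m (\<lambda>z. a z $ i $ j) x = partial_deriv m (\<lambda>z. a z $ j $ i) x"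
proof -
  let ?D = "\<lambda>X. \<Sum>m\<in>UNIV. X $ m * partial_deriv m (\<lambda>z. a z $ i $ j) x"
  have 1: "((\<lambda>z. a z $ i $ j) has_derivative ?D) (at x)"
    by (rule has_derivative_partial_derivs[OF a_differentiable[OF assms]])
  then have "((\<lambda>z. a z $ j $ i) has_derivative ?D) (at x)"
    by (rule has_derivative_sub_open[OF _ open_U assms]) (rule a_sym)
  then show ?thesis using partial_deriv_eqI[OF 1, of m] partial_deriv_eqI[of _ ?D x m] by simp
qed

lemma chr_sym:
  assumes "x \<in> U"
  shows "chr k i j x = chr k j i x"
  unfolding christoffel_def using partial_a_sym[OF assms, of _ i j] by (simp add: add.commute)

lemma chr_lower:
  assumes "x \<in> U"
  shows "(\<Sum>k\<in>UNIV. a x $ n $ k * chr k i j x) =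
     1/2 * (partial_deriv j (\<lambda>z. a z $ n $ i) x + partial_deriv i (\<lambda>z. a z $ n $ j) x
        - partial_deriv n (\<lambda>z. a z $ j $ i) x)"
proof -
  define c :: "real^'n" where "c = (\<chi> n. 1/2 * (partial_deriv j (\<lambda>z. a z $ n $ i) x + partial_deriv i (\<lambda>z. a z $ n $ j) x
        - partial_deriv n (\<lambda>z. a z $ j $ i) x))"
  have "chr k i j x = (matrix_inv (a x) *v c) $ k" for k
    unfolding christoffel_def c_def by (simp add: matrix_vector_mult_def sum_distrib_left field_simps)
  then have "(\<Sum>k\<in>UNIV. a x $ n $ k * chr k i j x) = (a x *v (matrix_inv (a x) *v c)) $ n"
    by (simp add: matrix_vector_mult_def[of "a x"])
  then show ?thesis by (simp add: a_inv[OF assms] c_def)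
qed

text \<open>Metric compatibility in solved form: the two lowered Christoffel symbols add up so that
  all but one of the derivatives cancel.\<close>

lemma partial_a:
  assumes "x \<in> U"
  shows "partial_deriv m (\<lambda>z. a z $ i $ j) x =
    (\<Sum>k\<in>UNIV. chr k m i x * a x $ k $ j) + (\<Sum>k\<in>UNIV. chr k m j x * a x $ i $ k)"
proof -
  have "(\<Sum>k\<in>UNIV. chr k m i x * a x $ k $ j) = (\<Sum>k\<in>UNIV. a x $ j $ k * chr k m i x)"
    by (intro sum.cong refl) (simp add: a_sym[OF assms, of j] mult.commute)
  moreover have "(\<Sum>k\<in>UNIV. chr k m j x * a x $ i $ k) = (\<Sum>k\<in>UNIV. a x $ i $ k * chr k m j x)"
    by (simp add: mult.commute)
  ultimately show ?thesis
    unfolding chr_lower[OF assms]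
    using partial_a_sym[OF assms, of _ i j] partial_a_sym[OF assms, of _ j m] partial_a_sym[OF assms, of _ i m]
    by (simp add: field_simps)
qed

lemma partial_b:
  assumes "x \<in> U"
  shows "partial_deriv m (\<lambda>z. b z $ j) x = (\<Sum>k\<in>UNIV. chr k m j x * b x $ k)"
  using b_parallel[OF assms, of m j] by (simp add: nabla_one_form_def)

text \<open>
  \<open>vert x y X Y\<close> is the vertical part of the tangent vector \<open>(X, Y)\<close> at \<open>(x, y)\<close> with respect to the
  Levi-Civita connection of \<open>a\<close>. In terms of it the derivative of every covector or tensor below is
  a connection term in \<open>W\<close>, a charge term in \<open>\<mu>\<close> and a term in the vertical part, and
  the Christoffel symbols never have to be expanded. A lower index comes as the first argument.
\<close>

definition W :: "real^'n \<Rightarrow> 'n \<Rightarrow> 'n \<Rightarrow> real^'n \<Rightarrow> real" where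
  "W x k n X = (\<Sum>m\<in>UNIV. X $ m * chr k m n x)"

definition vert :: "real^'n \<Rightarrow> real^'n \<Rightarrow> real^'n \<Rightarrow> real^'n \<Rightarrow> real^'n" where
  "vert x y X Y = (\<chi> k. Y $ k + (\<Sum>i\<in>UNIV. W x k i X * y $ i))"

abbreviation "bb x y \<equiv> form_b b x y"
abbreviation "q x y \<equiv> fin_q a b x y"
definition "uu i x y = (\<Sum>j\<in>UNIV. a x $ i $ j * y $ j)"
definition "S2 x y = (\<Sum>i\<in>UNIV. uu i x y * y $ i)"
definition "vv i x y = uu i x y - bb x y * b x $ i"
definition "vf x y \<theta> = (\<Sum>i\<in>UNIV. vv i x y * \<theta> $ i)"

section \<open>Joint derivatives of the charge, of b, S and q\<close>

lemma hasD_g: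
  assumes "x \<in> U"
  shows "hasD (\<lambda>x y. g x) (\<lambda>X Y. \<mu> x * bb x X) x y"
  by (rule hasD_eq[OF hasD_fst[OF g_differentiable[OF assms]]])
    (simp add: g_gradient[OF assms] form_b_def sum_distrib_left mult_ac)

lemma hasD_b:
  assumes "x \<in> U"
  shows "hasD (\<lambda>x y. b x $ n) (\<lambda>X Y. \<Sum>k\<in>UNIV. W x k n X * b x $ k) x y"
proof (rule hasD_eq[OF hasD_fst[OF b_differentiable[OF assms]]])
  fix X
  show "(\<Sum>m\<in>UNIV. X $ m * partial_deriv m (\<lambda>x. b x $ n) x) = (\<Sum>k\<in>UNIV. W x k n X * b x $ k)"
    unfolding partial_b[OF assms] W_def sum_distrib_left sum_distrib_right
    by (subst sum.swap) (simp add: mult_ac)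
qed

lemma hasD_a:
  assumes "x \<in> U"
  shows "hasD (\<lambda>x y. a x $ i $ j)
    (\<lambda>X Y. (\<Sum>k\<in>UNIV. W x k i X * a x $ k $ j) + (\<Sum>k\<in>UNIV. W x k j X * a x $ i $ k)) x y"
proof (rule hasD_eq[OF hasD_fst[OF a_differentiable[OF assms]]])
  fix X
  have *: "(\<Sum>m\<in>UNIV. X $ m * (\<Sum>k\<in>UNIV. chr k m i x * c k)) = (\<Sum>k\<in>UNIV. W x k i X * c k)" for i c
    unfolding W_def sum_distrib_left sum_distrib_right
    by (subst sum.swap) (simp add: mult_ac)
  show "(\<Sum>m\<in>UNIV. X $ m * partial_deriv m (\<lambda>x. a x $ i $ j) x) =
    (\<Sum>k\<in>UNIV. W x k i X * a x $ k $ j) + (\<Sum>k\<in>UNIV. W x k j X * a x $ i $ k)"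
    unfolding partial_a[OF assms] distrib_left sum.distrib * ..
qed

text \<open>Because b is parallel, its connection term is exactly the correction contained in
  \<open>vert\<close>; nothing but the vertical part is left.\<close>

lemma hasD_bb:
  assumes "x \<in> U"
  shows "hasD bb (\<lambda>X Y. bb x (vert x y X Y)) x y"
proof -
  have "hasD (\<lambda>x y. \<Sum>i\<in>UNIV. b x $ i * y $ i)
     (\<lambda>X Y. \<Sum>i\<in>UNIV. b x $ i * Y $ i + (\<Sum>k\<in>UNIV. W x k i X * b x $ k) * y $ i) x y"
    by (intro hasD_sum hasD_mult hasD_b hasD_snd assms)
  moreover have "(\<Sum>i\<in>UNIV. b x $ i * Y $ i + (\<Sum>k\<in>UNIV. W x k i X * b x $ k) * y $ i)
     = bb x (vert x y X Y)" for X Y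
  proof -
    have "(\<Sum>i\<in>UNIV. (\<Sum>k\<in>UNIV. W x k i X * b x $ k) * y $ i) =
       (\<Sum>k\<in>UNIV. b x $ k * (\<Sum>i\<in>UNIV. W x k i X * y $ i))"
      unfolding sum_distrib_left sum_distrib_right
      by (subst sum.swap) (simp add: mult_ac)
    then show ?thesis
      by (simp add: form_b_def vert_def distrib_left sum.distrib)
  qed
  ultimately show ?thesis unfolding form_b_def[abs_def] by simp
qed

lemma hasD_uu:
  assumes "x \<in> U"
  shows "hasD (uu n) (\<lambda>X Y. (\<Sum>k\<in>UNIV. W x k n X * uu k x y) + uu n x (vert x y X Y)) x y"
proof -
  have "hasD (\<lambda>x y. \<Sum>j\<in>UNIV. a x $ n $ j * y $ j)
     (\<lambda>X Y. \<Sum>j\<in>UNIV. a x $ n $ j * Y $ j + ((\<Sum>k\<in>UNIV. W x k n X * a x $ k $ j)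
        + (\<Sum>k\<in>UNIV. W x k j X * a x $ n $ k)) * y $ j) x y"
    by (intro hasD_sum hasD_mult hasD_a hasD_snd assms)
  moreover have "(\<Sum>j\<in>UNIV. a x $ n $ j * Y $ j + ((\<Sum>k\<in>UNIV. W x k n X * a x $ k $ j)
        + (\<Sum>k\<in>UNIV. W x k j X * a x $ n $ k)) * y $ j)
     = (\<Sum>k\<in>UNIV. W x k n X * uu k x y) + uu n x (vert x y X Y)" for X Y
  proof -
    have 1: "(\<Sum>j\<in>UNIV. (\<Sum>k\<in>UNIV. W x k j X * a x $ n $ k) * y $ j) =
       (\<Sum>k\<in>UNIV. a x $ n $ k * (\<Sum>j\<in>UNIV. W x k j X * y $ j))"
      unfolding sum_distrib_left sum_distrib_right
      by (subst sum.swap) (simp add: mult_ac)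
    have 2: "(\<Sum>j\<in>UNIV. (\<Sum>k\<in>UNIV. W x k n X * a x $ k $ j) * y $ j) =
       (\<Sum>k\<in>UNIV. W x k n X * (\<Sum>j\<in>UNIV. a x $ k $ j * y $ j))"
      unfolding sum_distrib_left sum_distrib_right
      by (subst sum.swap) (simp add: mult_ac)
    show ?thesis
      by (simp add: uu_def vert_def distrib_left distrib_right sum.distrib 1 2)
  qed
  ultimately show ?thesis unfolding uu_def[abs_def] by simp
qed

lemma uu_pair_sym:
  assumes "x \<in> U"
  shows "(\<Sum>i\<in>UNIV. uu i x v * w $ i) = (\<Sum>i\<in>UNIV. uu i x w * v $ i)"
  unfolding uu_def sum_distrib_right
  by (subst sum.swap) (simp add: a_sym[OF assms] mult_ac)

lemma hasD_S2:
  assumes "x \<in> U"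
  shows "hasD S2 (\<lambda>X Y. 2 * (\<Sum>i\<in>UNIV. uu i x y * vert x y X Y $ i)) x y"
proof -
  have "hasD (\<lambda>x y. \<Sum>i\<in>UNIV. uu i x y * y $ i)
     (\<lambda>X Y. \<Sum>i\<in>UNIV. uu i x y * Y $ i + ((\<Sum>k\<in>UNIV. W x k i X * uu k x y) + uu i x (vert x y X Y)) * y $ i) x y"
    by (intro hasD_sum hasD_mult hasD_uu hasD_snd assms)
  moreover have "(\<Sum>i\<in>UNIV. uu i x y * Y $ i + ((\<Sum>k\<in>UNIV. W x k i X * uu k x y) + uu i x (vert x y X Y)) * y $ i)
     = 2 * (\<Sum>i\<in>UNIV. uu i x y * vert x y X Y $ i)" for X Y
  proof -
    have 1: "(\<Sum>j\<in>UNIV. (\<Sum>k\<in>UNIV. W x k j X * uu k x y) * y $ j) =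
       (\<Sum>k\<in>UNIV. uu k x y * (\<Sum>j\<in>UNIV. W x k j X * y $ j))"
      unfolding sum_distrib_left sum_distrib_right
      by (subst sum.swap) (simp add: mult_ac)
    show ?thesis
      by (simp add: distrib_left distrib_right sum.distrib 1 uu_pair_sym[OF assms, of _ y])
        (simp add: vert_def distrib_left distrib_right sum.distrib 1)
  qed
  ultimately show ?thesis unfolding S2_def[abs_def] by simp
qed

lemma hasD_vv:
  assumes "x \<in> U"
  shows "hasD (vv n) (\<lambda>X Y. (\<Sum>k\<in>UNIV. W x k n X * vv k x y) + vv n x (vert x y X Y)) x y"
proof -
  have "hasD (\<lambda>x y. uu n x y - bb x y * b x $ n)
     (\<lambda>X Y. ((\<Sum>k\<in>UNIV. W x k n X * uu k x y) + uu n x (vert x y X Y)) -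
       (bb x y * (\<Sum>k\<in>UNIV. W x k n X * b x $ k) + bb x (vert x y X Y) * b x $ n)) x y"
    by (intro hasD_diff hasD_mult hasD_b hasD_uu hasD_bb assms)
  then show ?thesis
    unfolding vv_def[abs_def]
    by (rule hasD_eq) (simp add: right_diff_distrib sum_subtractf sum_distrib_left mult_ac)
qed

lemma S2_eq:
  assumes "x \<in> U"
  shows "(riem_S a x y)\<^sup>2 = S2 x y"
proof -
  have "S2 x y = y \<bullet> (a x *v y)"
    by (simp add: S2_def uu_def inner_vec_def matrix_vector_mult_def mult.commute)
  then have "0 \<le> S2 x y" using a_pos[OF assms, of y] by (cases "y = 0") auto
  moreover have "(\<Sum>i\<in>UNIV. \<Sum>j\<in>UNIV. a x $ i $ j * y $ i * y $ j) = S2 x y"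
    by (simp add: S2_def uu_def sum_distrib_right sum_distrib_left mult_ac)
  ultimately show ?thesis by (simp add: riem_S_def)
qed

lemma q_eq:
  assumes "x \<in> U"
  shows "q x y = sqrt (S2 x y - (bb x y)\<^sup>2)"
  by (simp add: fin_q_def S2_eq[OF assms])

text \<open>The domain of all later formulas. A partial derivative needs them in a neighbourhood, so
  they are stated on this open set of pairs instead of at a single point.\<close>

definition \<Omega> :: "((real^'n) \<times> (real^'n)) set" where
  "\<Omega> = {(x, y). x \<in> U \<and> 0 < q x y}"

lemma \<Omega>D: "(x, y) \<in> \<Omega> \<Longrightarrow> x \<in> U" "(x, y) \<in> \<Omega> \<Longrightarrow> 0 < q x y"
  by (auto simp: \<Omega>_def)

lemma q_sq:
  assumes "(x, y) \<in> \<Omega>"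
  shows "(q x y)\<^sup>2 = S2 x y - (bb x y)\<^sup>2"
  using \<Omega>D[OF assms] by (simp add: q_eq)

text \<open>Stated for q^2 and all y, so that it can provide the continuity behind the openness of
  \<open>\<Omega>\<close>; the derivative of q itself is available only on that set.\<close>

lemma hasD_qq:
  assumes "x \<in> U"
  shows "hasD (\<lambda>x y. S2 x y - (bb x y)\<^sup>2) (\<lambda>X Y. 2 * vf x y (vert x y X Y)) x y"
proof -
  have 1: "hasD (\<lambda>x y. S2 x y - bb x y * bb x y) (\<lambda>X Y. 2 * (\<Sum>i\<in>UNIV. uu i x y * vert x y X Y $ i)
     - (bb x y * bb x (vert x y X Y) + bb x (vert x y X Y) * bb x y)) x y"
    by (intro hasD_diff hasD_mult hasD_bb hasD_S2 assms)
  have 2: "2 * (\<Sum>i\<in>UNIV. uu i x y * \<theta> $ i) - (bb x y * bb x \<theta> + bb x \<theta> * bb x y) = 2 * vf x y \<theta>" for \<theta>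
    unfolding vf_def vv_def form_b_def[of b x \<theta>]
    by (simp add: algebra_simps sum_subtractf sum_distrib_left)
  show ?thesis unfolding power2_eq_square by (rule hasD_eq[OF 1]) (rule 2)
qed

lemma open_\<Omega>: "open \<Omega>"
proof -
  have "continuous_on (U \<times> UNIV) (\<lambda>z. S2 (fst z) (snd z) - (bb (fst z) (snd z))\<^sup>2)"
    using hasD_qq unfolding hasD_def
    by (intro continuous_at_imp_continuous_on ballI) (auto dest!: has_derivative_continuous)
  then have "open ((U \<times> UNIV) \<inter> (\<lambda>z. S2 (fst z) (snd z) - (bb (fst z) (snd z))\<^sup>2) -` {0<..})"
    by (rule continuous_open_preimage) (auto intro: open_Times open_U)
  also have "(U \<times> UNIV) \<inter> (\<lambda>z. S2 (fst z) (snd z) - (bb (fst z) (snd z))\<^sup>2) -` {0<..} = \<Omega>"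
    by (auto simp: \<Omega>_def q_eq)
  finally show ?thesis .
qed

lemma hasD_q:
  assumes "(x, y) \<in> \<Omega>"
  shows "hasD q (\<lambda>X Y. vf x y (vert x y X Y) / q x y) x y"
proof (rule hasD_cong_open[OF _ open_\<Omega> assms])
  have p: "0 < S2 x y - (bb x y)\<^sup>2" using \<Omega>D[OF assms] by (simp add: q_eq)
  show "hasD (\<lambda>x y. sqrt (S2 x y - (bb x y)\<^sup>2)) (\<lambda>X Y. vf x y (vert x y X Y) / q x y) x y"
    using has_derivative_real_sqrt[OF _ hasD_qq[OF \<Omega>D(1)[OF assms], unfolded hasD_def]] p
    unfolding hasD_def by (simp add: q_eq[OF \<Omega>D(1)[OF assms]] field_simps)
qed (auto simp: \<Omega>_def q_eq)

subsection \<open>The fundamental tensor and its derivatives\<close>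

text \<open>The connection term of one lower index with the covector as an argument, so that its
  linearity can serve as a set of rewrite rules.\<close>

definition wc :: "real^'n \<Rightarrow> real^'n \<Rightarrow> 'n \<Rightarrow> ('n \<Rightarrow> real) \<Rightarrow> real" where
  "wc x X n c = (\<Sum>k\<in>UNIV. W x k n X * c k)"

lemma wc_simps:
  "wc x X n (\<lambda>k. c k + d k) = wc x X n c + wc x X n d"
  "wc x X n (\<lambda>k. c k - d k) = wc x X n c - wc x X n d"
  "wc x X n (\<lambda>k. r * c k) = r * wc x X n c"
  "wc x X n (\<lambda>k. c k * r) = wc x X n c * r"
  "wc x X n (\<lambda>k. c k / r) = wc x X n c / r"
  unfolding wc_def
  by (simp_all add: sum.distrib sum_subtractf sum_distrib_left sum_divide_distrib algebra_simps)

text \<open>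
  \<open>EE\<close> is \<open>K\<^sup>2 / B\<close>, and \<open>MM\<close> is its logarithmic derivative in \<open>g\<close> at fixed \<open>b\<close> and \<open>q\<close>. The tensors
  are \<open>gm\<close> for \<open>g\<^sub>i\<^sub>j\<close>, \<open>yl\<close> for \<open>g\<^sub>i\<^sub>j y\<^sup>j\<close>, \<open>hm\<close> for the angular metric, and \<open>wh\<close> for \<open>q b\<^sub>i - (b/q) v\<^sub>i\<close>, a multiple
  of \<open>\<alpha>\<^sub>i\<close>. The functions \<open>gf\<close>, \<open>ylf\<close>, \<open>hf\<close>, \<open>whf\<close> are their contractions with a vector \<open>\<theta>\<close>;
  \<open>gg\<close> and \<open>yg\<close> are the derivatives of \<open>gm\<close> and \<open>yl\<close> in \<open>g\<close> at fixed \<open>b\<close> and \<open>q\<close>, and \<open>Cf\<close> is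
  \<open>2 C\<^sub>i\<^sub>j\<^sub>k \<theta>\<^sup>k\<close>.
\<close>

definition "BB x y = fin_B (g x) (bb x y) (q x y)"
definition "EE x y = fin_E (g x) (bb x y) (q x y)"
definition "MM x y = fin_M (g x) (bb x y) (q x y)"
definition "wh n x y = q x y * b x $ n - bb x y / q x y * vv n x y"
definition "whf x y \<theta> = q x y * bb x \<theta> - bb x y / q x y * vf x y \<theta>"
definition "br i j x y = q x y * (bb x y + g x * q x y) * (b x $ i * b x $ j)
   + q x y * (b x $ i * vv j x y + vv i x y * b x $ j) - bb x y / q x y * (vv i x y * vv j x y)"
definition "gm i j x y = EE x y * (a x $ i $ j + g x / BB x y * br i j x y)"
definition "yl i x y = EE x y * (vv i x y + (bb x y + g x * q x y) * b x $ i)"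
definition "hm i j x y = EE x y * (a x $ i $ j - b x $ i * b x $ j - vv i x y * vv j x y / (q x y)\<^sup>2
   + wh i x y * wh j x y / BB x y)"
definition "hf i x y \<theta> = EE x y * (uu i x \<theta> - b x $ i * bb x \<theta> - vv i x y * vf x y \<theta> / (q x y)\<^sup>2
   + wh i x y * whf x y \<theta> / BB x y)"
definition "ylf x y \<theta> = EE x y * (vf x y \<theta> + (bb x y + g x * q x y) * bb x \<theta>)"
definition "gf i x y \<theta> = hf i x y \<theta> + yl i x y * ylf x y \<theta> / (BB x y * EE x y)"
definition "Cf i j x y \<theta> = g x / BB x y * (hm i j x y * whf x y \<theta> + hf i x y \<theta> * wh j x y
   + hf j x y \<theta> * wh i x y - EE x y / BB x y * (wh i x y * wh j x y * whf x y \<theta>))"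
definition "gg i j x y = MM x y * gm i j x y + EE x y *
   ((BB x y - g x * (bb x y * q x y)) / (BB x y)\<^sup>2 * br i j x y + g x / BB x y * ((q x y)\<^sup>2 * (b x $ i * b x $ j)))"
definition "yg i x y = MM x y * yl i x y + EE x y * (q x y * b x $ i)"

section \<open>Joint derivatives of y_i and of the fundamental tensor\<close>

lemma BB_pos:
  assumes "(x, y) \<in> \<Omega>"
  shows "0 < BB x y"
  unfolding BB_def using \<Omega>D[OF assms] g_range by (intro fin_B_pos) auto

lemma EE_pos: "0 < EE x y"
  by (simp add: EE_def fin_E_def)

lemma BB_eq: "BB x y = (bb x y)\<^sup>2 + g x * bb x y * q x y + (q x y)\<^sup>2"
  by (simp add: BB_def fin_B_def)

lemma hasD_BB:
  assumes "(x, y) \<in> \<Omega>"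
  shows "hasD BB (\<lambda>X Y. bb x y * q x y * (\<mu> x * bb x X)
     + (2 * bb x y + g x * q x y) * bb x (vert x y X Y)
     + (g x * bb x y + 2 * q x y) * (vf x y (vert x y X Y) / q x y)) x y"
  using fin_B_derivative[OF hasD_g[OF \<Omega>D(1)[OF assms], unfolded hasD_def]
      hasD_bb[OF \<Omega>D(1)[OF assms], unfolded hasD_def] hasD_q[OF assms, unfolded hasD_def]]
  unfolding hasD_def BB_def by simp

lemma hasD_EE:
  assumes "(x, y) \<in> \<Omega>"
  shows "hasD EE (\<lambda>X Y. EE x y * (MM x y * (\<mu> x * bb x X) + g x / BB x y * whf x y (vert x y X Y))) x y"
  using fin_E_derivative[OF _ _ _ hasD_g[OF \<Omega>D(1)[OF assms], unfolded hasD_def]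
      hasD_bb[OF \<Omega>D(1)[OF assms], unfolded hasD_def] hasD_q[OF assms, unfolded hasD_def]]
    g_range[OF \<Omega>D(1)[OF assms]] \<Omega>D(2)[OF assms]
  unfolding hasD_def EE_def MM_def BB_def whf_def by simp

lemma gm_hm:
  assumes "(x, y) \<in> \<Omega>"
  shows "gm i j x y = hm i j x y + yl i x y * yl j x y / (BB x y * EE x y)"
proof -
  have "gm i j x y = EE x y * ((a x $ i $ j - b x $ i * b x $ j - vv i x y * vv j x y / (q x y)\<^sup>2
     + wh i x y * wh j x y / BB x y) + (vv i x y + (bb x y + g x * q x y) * b x $ i)
      * (vv j x y + (bb x y + g x * q x y) * b x $ j) / BB x y)"
    unfolding gm_def br_def wh_def using BB_pos[OF assms] \<Omega>D(2)[OF assms]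
    by (subst angular_algebra[OF BB_eq]) auto
  also have "\<dots> = hm i j x y + yl i x y * yl j x y / (BB x y * EE x y)"
    unfolding hm_def yl_def using EE_pos[of x y] BB_pos[OF assms] by (simp add: field_simps)
  finally show ?thesis .
qed

lemma gm_sym:
  assumes "(x, y) \<in> \<Omega>"
  shows "gm i j x y = gm j i x y"
  unfolding gm_def br_def using a_sym[OF \<Omega>D(1)[OF assms], of i j] by (simp add: mult_ac add_ac)

lemma hasD_gdivB:
  assumes "(x, y) \<in> \<Omega>"
  shows "hasD (\<lambda>x y. g x / BB x y) (\<lambda>X Y. (BB x y - g x * (bb x y * q x y)) / (BB x y)\<^sup>2 * (\<mu> x * bb x X)
    - g x / (BB x y)\<^sup>2 * ((2 * bb x y + g x * q x y) * bb x (vert x y X Y)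
     + (g x * bb x y + 2 * q x y) * (vf x y (vert x y X Y) / q x y))) x y"
  using BB_pos[OF assms]
  by (intro hasD_eq[OF hasD_divide[OF hasD_g[OF \<Omega>D(1)[OF assms]] hasD_BB[OF assms]]])
    (auto simp: field_simps power2_eq_square)

lemma hasD_bdivq:
  assumes "(x, y) \<in> \<Omega>"
  shows "hasD (\<lambda>x y. bb x y / q x y) (\<lambda>X Y. bb x (vert x y X Y) / q x y
    - bb x y * (vf x y (vert x y X Y) / q x y) / (q x y * q x y)) x y"
  using \<Omega>D(2)[OF assms]
  by (intro hasD_eq[OF hasD_divide[OF hasD_bb[OF \<Omega>D(1)[OF assms]] hasD_q[OF assms]]])
    (auto simp: field_simps)

text \<open>The vertical slot shows \<open>gm\<close> to be the derivative of \<open>yl\<close> in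
  y; this is what identifies \<open>gm\<close> as half the Hessian of K^2 in
  \<open>fund_tensor_eq\<close>.\<close>

lemma hasD_yl:
  assumes "(x, y) \<in> \<Omega>"
  shows "hasD (yl i) (\<lambda>X Y. wc x X i (\<lambda>k. yl k x y) + \<mu> x * bb x X * yg i x y + gf i x y (vert x y X Y)) x y"
proof -
  note [simp] = \<Omega>D(1)[OF assms]
  have 1: "hasD (\<lambda>x y. EE x y * (vv i x y + (bb x y + g x * q x y) * b x $ i))
    (\<lambda>X Y. EE x y * (((\<Sum>k\<in>UNIV. W x k i X * vv k x y) + vv i x (vert x y X Y)) +
      ((bb x y + g x * q x y) * (\<Sum>k\<in>UNIV. W x k i X * b x $ k) + (bb x (vert x y X Y) +
       (g x * (vf x y (vert x y X Y) / q x y) + \<mu> x * bb x X * q x y)) * b x $ i))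
     + EE x y * (MM x y * (\<mu> x * bb x X) + g x / BB x y * whf x y (vert x y X Y))
        * (vv i x y + (bb x y + g x * q x y) * b x $ i)) x y"
    by (intro hasD_mult hasD_add hasD_EE hasD_vv hasD_bb hasD_g hasD_q hasD_b assms) auto
  show ?thesis
  proof (rule hasD_cong[OF 1 yl_def])
    fix X Y
    define \<theta> where "\<theta> = vert x y X Y"
    have A: "gf i x y \<theta> = EE x y * (vv i x \<theta> + (bb x \<theta> + g x * (vf x y \<theta> / q x y)) * b x $ i)
       + EE x y * (g x / BB x y * whf x y \<theta>) * (vv i x y + (bb x y + g x * q x y) * b x $ i)"
      (is "_ = ?r")
    proof -
      have r: "?r = EE x y * (uu i x \<theta> + (g x * (vf x y \<theta> / q x y)) * b x $ i +
         (g x / BB x y * whf x y \<theta>) * (vv i x y + (bb x y + g x * q x y) * b x $ i))"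
        using BB_pos[OF assms] by (simp add: vv_def[of i x \<theta>] field_simps)
      have l: "gf i x y \<theta> = EE x y * (uu i x \<theta> - b x $ i * bb x \<theta> - vv i x y * vf x y \<theta> / (q x y)\<^sup>2
         + wh i x y * whf x y \<theta> / BB x y + (vv i x y + (bb x y + g x * q x y) * b x $ i) *
           (vf x y \<theta> + (bb x y + g x * q x y) * bb x \<theta>) / BB x y)"
        unfolding gf_def hf_def ylf_def yl_def using EE_pos[of x y] BB_pos[OF assms] by (simp add: field_simps)
      have "BB x y * (q x y)\<^sup>2 * (- b x $ i * bb x \<theta> - vv i x y * vf x y \<theta> / (q x y)\<^sup>2
         + wh i x y * whf x y \<theta> / BB x y + (vv i x y + (bb x y + g x * q x y) * b x $ i) *
           (vf x y \<theta> + (bb x y + g x * q x y) * bb x \<theta>) / BB x y)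
        = BB x y * (q x y)\<^sup>2 * ((g x * (vf x y \<theta> / q x y)) * b x $ i +
         (g x / BB x y * whf x y \<theta>) * (vv i x y + (bb x y + g x * q x y) * b x $ i))"
      proof -
        \<comment> \<open>Generic reals reduce the claim to a polynomial identity; passing from
          \<open>wt\<close> to \<open>Q * wt\<close> removes the last quotient.\<close>
        have "B * Q\<^sup>2 * (- bi * bt - vi * vt / Q\<^sup>2 + (Q * bi - c / Q * vi) * wt / B +
              (vi + (c + G * Q) * bi) * (vt + (c + G * Q) * bt) / B)
            = B * Q\<^sup>2 * ((G * (vt / Q)) * bi + (G / B * wt) * (vi + (c + G * Q) * bi))"
          if "B = c\<^sup>2 + G * c * Q + Q\<^sup>2" "B \<noteq> 0" "Q \<noteq> 0" "wt = Q * bt - c / Q * vt"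
          for B Q bi bt vi vt wt c G :: real
        proof -
          have "B * Q\<^sup>2 * (- bi * bt - vi * vt / Q\<^sup>2 + (Q * bi - c / Q * vi) * wt / B +
              (vi + (c + G * Q) * bi) * (vt + (c + G * Q) * bt) / B)
            = B * (- Q\<^sup>2 * bi * bt - vi * vt) + (Q\<^sup>2 * bi - c * vi) * (Q * wt) +
              Q\<^sup>2 * (vi + (c + G * Q) * bi) * (vt + (c + G * Q) * bt)"
            using that(2,3) by (simp add: field_simps power2_eq_square)
          moreover have "B * Q\<^sup>2 * ((G * (vt / Q)) * bi + (G / B * wt) * (vi + (c + G * Q) * bi))
            = B * Q * G * vt * bi + G * Q * (Q * wt) * (vi + (c + G * Q) * bi)"
            using that(2,3) by (simp add: field_simps power2_eq_square)
          moreover have "Q * wt = Q\<^sup>2 * bt - c * vt" using that(3,4) by (simp add: field_simps power2_eq_square)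
          ultimately show ?thesis using that(1) by algebra
        qed
        from this[OF BB_eq _ _ whf_def[of x y \<theta>]] show ?thesis
          using BB_pos[OF assms] \<Omega>D(2)[OF assms] by (simp add: wh_def)
      qed
      then show ?thesis unfolding l r using BB_pos[OF assms] \<Omega>D(2)[OF assms] by auto
    qed
    show "EE x y * (((\<Sum>k\<in>UNIV. W x k i X * vv k x y) + vv i x (vert x y X Y)) +
      ((bb x y + g x * q x y) * (\<Sum>k\<in>UNIV. W x k i X * b x $ k) + (bb x (vert x y X Y) +
       (g x * (vf x y (vert x y X Y) / q x y) + \<mu> x * bb x X * q x y)) * b x $ i))
     + EE x y * (MM x y * (\<mu> x * bb x X) + g x / BB x y * whf x y (vert x y X Y))
        * (vv i x y + (bb x y + g x * q x y) * b x $ i)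
      = wc x X i (\<lambda>k. yl k x y) + \<mu> x * bb x X * yg i x y + gf i x y (vert x y X Y)"
      unfolding wc_def[symmetric] \<theta>_def[symmetric] A unfolding yl_def yg_def wc_simps
      using BB_pos[OF assms] by (simp add: field_simps)
  qed
qed

text \<open>The derivatives of the factors are sorted into one connection term per index, the charge
  slot and the vertical slot; \<open>cartan_algebra\<close> puts the last into symmetric
  form.\<close>

lemma hasD_gm:
  assumes "(x, y) \<in> \<Omega>"
  shows "hasD (gm i j) (\<lambda>X Y. wc x X i (\<lambda>k. gm k j x y) + wc x X j (\<lambda>k. gm i k x y)
     + \<mu> x * bb x X * gg i j x y + Cf i j x y (vert x y X Y)) x y"
proof -
  note [simp] = \<Omega>D(1)[OF assms]
  define D where "D = (\<lambda>X Y. (q x y * (bb x y + g x * q x y)) * (b x $ i * wc x X j (\<lambda>k. b x $ k) + wc x X i (\<lambda>k. b x $ k) * b x $ j)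
     + (q x y * (bb x (vert x y X Y) + (g x * (vf x y (vert x y X Y) / q x y) + \<mu> x * bb x X * q x y))
       + vf x y (vert x y X Y) / q x y * (bb x y + g x * q x y)) * (b x $ i * b x $ j)
     + (q x y * ((b x $ i * (wc x X j (\<lambda>k. vv k x y) + vv j x (vert x y X Y)) + wc x X i (\<lambda>k. b x $ k) * vv j x y)
         + (vv i x y * wc x X j (\<lambda>k. b x $ k) + (wc x X i (\<lambda>k. vv k x y) + vv i x (vert x y X Y)) * b x $ j))
       + vf x y (vert x y X Y) / q x y * (b x $ i * vv j x y + vv i x y * b x $ j))
     - (bb x y / q x y * (vv i x y * (wc x X j (\<lambda>k. vv k x y) + vv j x (vert x y X Y)) + (wc x X i (\<lambda>k. vv k x y) + vv i x (vert x y X Y)) * vv j x y)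
       + (bb x (vert x y X Y) / q x y - bb x y * (vf x y (vert x y X Y) / q x y) / (q x y * q x y)) * (vv i x y * vv j x y)))"
  have dbr: "hasD (br i j) D x y"
    unfolding D_def wc_def
    by (rule hasD_cong[OF _ br_def refl], intro hasD_mult hasD_add hasD_diff hasD_EE hasD_vv hasD_bb hasD_g hasD_q hasD_b hasD_bdivq assms) auto
  define F where "F = (\<lambda>X Y. (BB x y - g x * (bb x y * q x y)) / (BB x y)\<^sup>2 * (\<mu> x * bb x X)
    - g x / (BB x y)\<^sup>2 * ((2 * bb x y + g x * q x y) * bb x (vert x y X Y)
     + (g x * bb x y + 2 * q x y) * (vf x y (vert x y X Y) / q x y)))"
  have 1: "hasD (\<lambda>x y. EE x y * (a x $ i $ j + g x / BB x y * br i j x y))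
    (\<lambda>X Y. EE x y * ((wc x X i (\<lambda>k. a x $ k $ j) + wc x X j (\<lambda>k. a x $ i $ k)) + (g x / BB x y * D X Y + F X Y * br i j x y))
     + EE x y * (MM x y * (\<mu> x * bb x X) + g x / BB x y * whf x y (vert x y X Y))
        * (a x $ i $ j + g x / BB x y * br i j x y)) x y"
    unfolding F_def wc_def by (intro hasD_mult hasD_add hasD_EE hasD_a dbr hasD_gdivB assms) auto
  show ?thesis
  proof (rule hasD_cong[OF 1 gm_def])
    fix X Y
    define \<theta> where "\<theta> = vert x y X Y"
    define br' where "br' = (vf x y \<theta> / q x y * (bb x y + g x * q x y) + q x y * (bb x \<theta> + g x * (vf x y \<theta> / q x y))) * (b x $ i * b x $ j) + vf x y \<theta> / q x y * (b x $ i * vv j x y + vv i x y * b x $ j)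
        + q x y * (b x $ i * (uu j x \<theta> - bb x \<theta> * b x $ j) + (uu i x \<theta> - bb x \<theta> * b x $ i) * b x $ j) - (bb x \<theta> / q x y - bb x y * (vf x y \<theta> / q x y) / (q x y * q x y)) * (vv i x y * vv j x y)
        - bb x y / q x y * ((uu i x \<theta> - bb x \<theta> * b x $ i) * vv j x y + vv i x y * (uu j x \<theta> - bb x \<theta> * b x $ j))"
    define B' where "B' = (2 * bb x y + g x * q x y) * bb x \<theta> + (g x * bb x y + 2 * q x y) * (vf x y \<theta> / q x y)"
    have D: "D X Y = wc x X i (\<lambda>k. br k j x y) + wc x X j (\<lambda>k. br i k x y)
       + \<mu> x * bb x X * ((q x y)\<^sup>2 * (b x $ i * b x $ j)) + br'"
      unfolding D_def br'_def \<theta>_def[symmetric] br_def wc_simps vv_def[of _ x \<theta>]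
      by (simp add: algebra_simps power2_eq_square)
    have F: "F X Y = (BB x y - g x * (bb x y * q x y)) / (BB x y)\<^sup>2 * (\<mu> x * bb x X) - g x / (BB x y)\<^sup>2 * B'"
      unfolding F_def B'_def \<theta>_def[symmetric] ..
    have "whf x y \<theta> * (a x $ i $ j + g x / BB x y * br i j x y) + br' - B' / BB x y * br i j x y =
      (a x $ i $ j - b x $ i * b x $ j - vv i x y * vv j x y / (q x y)\<^sup>2 + wh i x y * wh j x y / BB x y) * whf x y \<theta>
      + (uu i x \<theta> - b x $ i * bb x \<theta> - vv i x y * vf x y \<theta> / (q x y)\<^sup>2 + wh i x y * whf x y \<theta> / BB x y) * wh j x y
      + (uu j x \<theta> - b x $ j * bb x \<theta> - vv j x y * vf x y \<theta> / (q x y)\<^sup>2 + wh j x y * whf x y \<theta> / BB x y) * wh i x y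
       - wh i x y * wh j x y * whf x y \<theta> / BB x y" (is "?l = ?r")
      using cartan_algebra[OF BB_eq[of x y]] BB_pos[OF assms] \<Omega>D(2)[OF assms]
      unfolding whf_def wh_def br_def br'_def B'_def by simp
    then have "EE x y * (g x / BB x y) * ?l = EE x y * (g x / BB x y) * ?r" by simp
    also have "\<dots> = Cf i j x y \<theta>"
      unfolding Cf_def hm_def hf_def by (simp add: algebra_simps)
    finally have C: "Cf i j x y \<theta> = EE x y * (g x / BB x y) * ?l" by simp
    have "EE x y * (g x / BB x y) * ?l = EE x y * (g x / BB x y * whf x y \<theta>) * (a x $ i $ j + g x / BB x y * br i j x y)
       + EE x y * (g x / BB x y * br' - g x / (BB x y)\<^sup>2 * B' * br i j x y)"
      using BB_pos[OF assms] by (simp add: field_simps power2_eq_square)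
    note C' = C[unfolded this]
    show "EE x y * ((wc x X i (\<lambda>k. a x $ k $ j) + wc x X j (\<lambda>k. a x $ i $ k)) + (g x / BB x y * D X Y + F X Y * br i j x y))
     + EE x y * (MM x y * (\<mu> x * bb x X) + g x / BB x y * whf x y (vert x y X Y))
        * (a x $ i $ j + g x / BB x y * br i j x y)
      = wc x X i (\<lambda>k. gm k j x y) + wc x X j (\<lambda>k. gm i k x y)
     + \<mu> x * bb x X * gg i j x y + Cf i j x y (vert x y X Y)"
      unfolding D F \<theta>_def[symmetric] C' unfolding gg_def gm_def wc_simps
      by (simp add: algebra_simps)
  qed
qed

subsection \<open>The Cartan tensor\<close>

lemma W_zero [simp]: "W x k i 0 = 0"
  by (simp add: W_def)

lemma vert_zero [simp]: "vert x y 0 Y = Y"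
  by (simp add: vert_def vec_eq_iff)

lemma wc_zero [simp]: "wc x 0 i c = 0"
  by (simp add: wc_def)

lemma bb_zero [simp]: "bb x 0 = 0"
  by (simp add: form_b_def)

lemma sum_axis: "(\<Sum>i\<in>UNIV. c i * axis k 1 $ i) = (c k :: real)"
  by (simp add: axis_def if_distrib cong: if_cong)

lemma bb_axis [simp]: "bb x (axis k 1) = b x $ k"
  by (simp add: form_b_def sum_axis)

lemma uu_axis [simp]: "uu i x (axis k 1) = a x $ i $ k"
  by (simp add: uu_def sum_axis)

lemma vf_axis [simp]: "vf x y (axis k 1) = vv k x y"
  by (simp add: vf_def sum_axis)

lemma whf_axis [simp]: "whf x y (axis k 1) = wh k x y"
  by (simp add: whf_def wh_def)

lemma hf_axis [simp]: "hf i x y (axis k 1) = hm i k x y"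
  by (simp add: hf_def hm_def)

lemma ylf_axis [simp]: "ylf x y (axis k 1) = yl k x y"
  by (simp add: ylf_def yl_def)

lemma gf_axis: "(x, y) \<in> \<Omega> \<Longrightarrow> gf i x y (axis k 1) = gm i k x y"
  by (simp add: gf_def gm_hm)

lemma ylf_sum: "ylf x y \<theta> = (\<Sum>k\<in>UNIV. yl k x y * \<theta> $ k)"
  unfolding ylf_def yl_def vf_def form_b_def[of b x \<theta>]
  by (simp add: sum.distrib sum_distrib_left algebra_simps)

lemma whf_sum: "whf x y \<theta> = (\<Sum>k\<in>UNIV. wh k x y * \<theta> $ k)"
  unfolding whf_def wh_def vf_def form_b_def[of b x \<theta>]
  by (simp add: sum_subtractf sum_distrib_left algebra_simps)

lemma hf_sum: "hf i x y \<theta> = (\<Sum>k\<in>UNIV. hm i k x y * \<theta> $ k)"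
proof -
  have "(\<Sum>k\<in>UNIV. hm i k x y * \<theta> $ k) = EE x y * ((\<Sum>k\<in>UNIV. a x $ i $ k * \<theta> $ k) - b x $ i * (\<Sum>k\<in>UNIV. b x $ k * \<theta> $ k)
     - vv i x y * (\<Sum>k\<in>UNIV. vv k x y * \<theta> $ k) / (q x y)\<^sup>2 + wh i x y * (\<Sum>k\<in>UNIV. wh k x y * \<theta> $ k) / BB x y)"
    unfolding hm_def by (simp add: sum.distrib sum_subtractf sum_distrib_left sum_divide_distrib algebra_simps)
  then show ?thesis unfolding hf_def uu_def form_b_def vf_def whf_sum by simp
qed

lemma gf_sum:
  assumes "(x, y) \<in> \<Omega>"
  shows "gf i x y \<theta> = (\<Sum>k\<in>UNIV. gm i k x y * \<theta> $ k)"
  unfolding gf_def gm_hm[OF assms] hf_sum ylf_sum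
  by (simp add: sum.distrib sum_distrib_left sum_divide_distrib algebra_simps)

lemma gf_pair_sym:
  assumes "(x, y) \<in> \<Omega>"
  shows "(\<Sum>i\<in>UNIV. gf i x y \<theta> * \<eta> $ i) = (\<Sum>i\<in>UNIV. gf i x y \<eta> * \<theta> $ i)"
  unfolding gf_sum[OF assms] sum_distrib_right
  by (subst sum.swap) (simp add: gm_sym[OF assms] mult_ac)

section \<open>Metric tensor and Cartan tensor of the Finsleroid function\<close>

abbreviation "K \<equiv> finsleroid_K a b g"

lemma K_sq:
  assumes "(x, y) \<in> \<Omega>"
  shows "(K x y)\<^sup>2 = BB x y * EE x y" "0 < K x y"
  using finsleroid_K_sq[of g x a b y] g_range \<Omega>D[OF assms] by (auto simp: BB_def EE_def)

text \<open>In the vertical slot dB and the angular form g (q db - b dq) coming from dE merge into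
  twice v + (b + g q) b. This explains the shape of \<open>yl\<close>.\<close>

lemma hasD_K_sq:
  assumes "(x, y) \<in> \<Omega>"
  shows "hasD (\<lambda>x y. (K x y)\<^sup>2) (\<lambda>X Y. \<mu> x * bb x X * (EE x y * (bb x y * q x y + BB x y * MM x y))
     + 2 * ylf x y (vert x y X Y)) x y"
proof (rule hasD_cong_open[OF _ open_\<Omega> assms])
  show "hasD (\<lambda>x y. BB x y * EE x y) (\<lambda>X Y. \<mu> x * bb x X * (EE x y * (bb x y * q x y + BB x y * MM x y))
     + 2 * ylf x y (vert x y X Y)) x y"
    using BB_pos[OF assms] \<Omega>D(2)[OF assms]
    by (intro hasD_eq[OF hasD_mult[OF hasD_BB hasD_EE]] assms) (simp add: whf_def ylf_def field_simps)
qed (simp add: K_sq)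

lemma open_slices:
  "open {v. (x, v) \<in> \<Omega>}" "open {z. (z, y) \<in> \<Omega>}"
proof -
  have "open (Pair x -` \<Omega>)"
    by (rule open_vimage[OF open_\<Omega>]) (intro continuous_intros)
  moreover have "open ((\<lambda>z. (z, y)) -` \<Omega>)"
    by (rule open_vimage[OF open_\<Omega>]) (intro continuous_intros)
  ultimately show "open {v. (x, v) \<in> \<Omega>}" "open {z. (z, y) \<in> \<Omega>}"
    by (auto simp: vimage_def)
qed

lemma partial_y:
  assumes "(x, y) \<in> \<Omega>" "hasD T D x y" "\<And>v. (x, v) \<in> \<Omega> \<Longrightarrow> f v = T x v"
  shows "partial_deriv k f y = D 0 (axis k 1)"
  by (rule partial_deriv_eqI[OF has_derivative_sub_open[OF hasD_y[OF assms(2)] open_slices(1)[of x]]])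
    (simp_all add: assms(1,3))

lemma partial_x:
  assumes "(x, y) \<in> \<Omega>" "hasD T D x y" "\<And>z. (z, y) \<in> \<Omega> \<Longrightarrow> f z = T z y"
  shows "partial_deriv k f x = D (axis k 1) 0"
  by (rule partial_deriv_eqI[OF has_derivative_sub_open[OF hasD_x[OF assms(2)] open_slices(2)[of y]]])
    (simp_all add: assms(1,3))

lemma fund_tensor_eq:
  assumes "(x, y) \<in> \<Omega>"
  shows "fund_tensor K x y $ i $ j = gm i j x y"
proof -
  have 1: "partial_deriv j (\<lambda>v. (K x v)\<^sup>2) v = 2 * yl j x v" if "(x, v) \<in> \<Omega>" for v
    using partial_y[OF that hasD_K_sq[OF that]] by simp
  have "hasD (\<lambda>x y. 2 * yl j x y) (\<lambda>X Y. 2 * (wc x X j (\<lambda>k. yl k x y) + \<mu> x * bb x X * yg j x y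
     + gf j x y (vert x y X Y)) + 0 * yl j x y) x y"
    by (intro hasD_mult hasD_const hasD_yl assms)
  from partial_y[OF assms this 1, of i]
  have "partial_deriv i (partial_deriv j (\<lambda>v. (K x v)\<^sup>2)) y = 2 * gm j i x y"
    by (simp add: gf_axis[OF assms])
  then show ?thesis by (simp add: fund_tensor_def gm_sym[OF assms, of j i])
qed

text \<open>The unit covector w: the factor K/B normalizes \<open>wh\<close>, as
  \<open>ww_sums\<close> and \<open>gi_ww\<close> confirm.\<close>

definition "ww i x y = K x y / BB x y * wh i x y"

definition "cubic i j k x y = hm i j x y * ww k x y + hm i k x y * ww j x y + hm j k x y * ww i x y
   - ww i x y * ww j x y * ww k x y"

lemma Cf_axis:
  assumes "(x, y) \<in> \<Omega>"
  shows "K x y / 2 * Cf i j x y (axis k 1) = g x / 2 * cubic i j k x y"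
proof -
  have "ww i x y * ww j x y * ww k x y = (K x y)\<^sup>2 * K x y / BB x y ^ 3 * (wh i x y * wh j x y * wh k x y)"
    unfolding ww_def by (simp add: power3_eq_cube power2_eq_square field_simps)
  also have "\<dots> = K x y / BB x y * (EE x y / BB x y * (wh i x y * wh j x y * wh k x y))"
    unfolding K_sq[OF assms] using BB_pos[OF assms] by (simp add: power3_eq_cube field_simps)
  finally show ?thesis
    unfolding Cf_def cubic_def using BB_pos[OF assms] by (simp add: ww_def field_simps)
qed

lemma cartan_A_eq:
  assumes "(x, y) \<in> \<Omega>"
  shows "cartan_A K i j k x y = g x / 2 * cubic i j k x y"
  using partial_y[OF assms hasD_gm[OF assms, of i j] fund_tensor_eq, of k] Cf_axis[OF assms]
  by (simp add: cartan_A_def)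

section \<open>Raising of indices, trace and norm of the Cartan tensor\<close>

definition "\<beta> x = matrix_inv (a x) *v b x"

lemma uu_matrix: "uu i x v = (a x *v v) $ i"
  by (simp add: uu_def matrix_vector_mult_def)

lemma beta_simps:
  assumes "(x, y) \<in> \<Omega>"
  shows "uu i x (\<beta> x) = b x $ i" "bb x (\<beta> x) = 1" "vf x y (\<beta> x) = 0"
    "whf x y (\<beta> x) = q x y" "ylf x y (\<beta> x) = EE x y * (bb x y + g x * q x y)"
proof -
  note U = \<Omega>D(1)[OF assms]
  show u: "uu i x (\<beta> x) = b x $ i" for i
    by (simp add: uu_matrix \<beta>_def a_inv[OF U])
  show bb: "bb x (\<beta> x) = 1"
    unfolding b_unit[OF U, symmetric]
    by (simp add: form_b_def \<beta>_def matrix_vector_mult_def sum_distrib_left mult_ac)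
  have "vf x y (\<beta> x) = (\<Sum>i\<in>UNIV. uu i x y * \<beta> x $ i) - bb x y * bb x (\<beta> x)"
    unfolding vf_def vv_def form_b_def[of b x "\<beta> x"]
    by (simp add: sum_subtractf sum_distrib_left algebra_simps)
  also have "\<dots> = 0"
    unfolding uu_pair_sym[OF U, of y] u bb by (simp add: form_b_def)
  finally show "vf x y (\<beta> x) = 0" .
  then show "whf x y (\<beta> x) = q x y" "ylf x y (\<beta> x) = EE x y * (bb x y + g x * q x y)"
    by (simp_all add: whf_def ylf_def bb)
qed

lemma y_simps:
  assumes "(x, y) \<in> \<Omega>"
  shows "vf x y y = (q x y)\<^sup>2" "whf x y y = 0" "ylf x y y = BB x y * EE x y" "hf i x y y = 0"
    "gf i x y y = yl i x y"
proof -
  have "vf x y y = S2 x y - bb x y * bb x y"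
    unfolding vf_def vv_def S2_def form_b_def[of b x y]
    by (simp add: sum_subtractf sum_distrib_left algebra_simps)
  then show v: "vf x y y = (q x y)\<^sup>2" by (simp only: q_sq[OF assms] power2_eq_square[of "bb x y"])
  show w: "whf x y y = 0" using \<Omega>D(2)[OF assms] by (simp add: whf_def v power2_eq_square)
  show y: "ylf x y y = BB x y * EE x y"
    by (simp add: ylf_def v BB_eq algebra_simps power2_eq_square)
  show h: "hf i x y y = 0"
    using \<Omega>D(2)[OF assms] by (simp add: hf_def v w) (simp add: vv_def mult.commute)
  show "gf i x y y = yl i x y"
    using BB_pos[OF assms] EE_pos[of x y] by (simp add: gf_def h y)
qed

text \<open>Lowering the dual vector of b stays within the span of b_i and y_i, because E q
  \<open>wh\<close> + b \<open>yl\<close> = E B b_i. This rule fixes both \<open>wu\<close> and the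
  spray.\<close>

lemma gf_beta:
  assumes "(x, y) \<in> \<Omega>"
  shows "gf i x y (\<beta> x) = EE x y * b x $ i + g x * q x y / BB x y * yl i x y"
proof -
  have "gf i x y (\<beta> x) = (EE x y * q x y * wh i x y + (bb x y + g x * q x y) * yl i x y) / BB x y"
    using BB_pos[OF assms] EE_pos[of x y]
    by (simp add: gf_def hf_def beta_simps[OF assms] field_simps)
  also have "EE x y * q x y * wh i x y + bb x y * yl i x y = EE x y * BB x y * b x $ i"
    using \<Omega>D(2)[OF assms] by (simp add: wh_def yl_def BB_eq field_simps power2_eq_square)
  then have "EE x y * q x y * wh i x y + (bb x y + g x * q x y) * yl i x y
     = EE x y * BB x y * b x $ i + g x * q x y * yl i x y" by (simp add: algebra_simps)
  finally show ?thesis using BB_pos[OF assms] by (simp add: field_simps)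
qed

lemma gf_vector:
  assumes "(x, y) \<in> \<Omega>"
  shows "(fund_tensor K x y *v \<theta>) $ i = gf i x y \<theta>"
  by (simp add: gf_sum[OF assms] matrix_vector_mult_def fund_tensor_eq[OF assms])

text \<open>By symmetry a kernel vector theta pairs to zero with the lowered y and the lowered beta.
  This kills y_i theta^i and b(theta), hence v(theta), and then g_ij theta^j reduces to E a_ij
  theta^j.\<close>

lemma fund_invertible:
  assumes "(x, y) \<in> \<Omega>"
  shows "invertible (fund_tensor K x y)"
proof -
  have "\<theta> = 0" if "fund_tensor K x y *v \<theta> = 0" for \<theta>
  proof -
    have 0: "gf i x y \<theta> = 0" for i using that gf_vector[OF assms, of \<theta> i] by simp
    have "(\<Sum>i\<in>UNIV. gf i x y \<eta> * \<theta> $ i) = 0" for \<eta>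
      using gf_pair_sym[OF assms, of \<theta> \<eta>] by (simp add: 0)
    note * = this[of y] this[of "\<beta> x"]
    have y: "ylf x y \<theta> = 0" using *(1) by (simp add: y_simps[OF assms] ylf_sum)
    have "EE x y * bb x \<theta> + g x * q x y / BB x y * ylf x y \<theta> = 0"
      using *(2) by (simp add: gf_beta[OF assms] ylf_sum form_b_def[of b x \<theta>] sum_distrib_left sum.distrib sum_divide_distrib algebra_simps)
    then have b: "bb x \<theta> = 0" using EE_pos[of x y] y by simp
    have v: "vf x y \<theta> = 0" using y EE_pos[of x y] by (simp add: ylf_def b)
    have "uu i x \<theta> = 0" for i
      using 0[of i] EE_pos[of x y] by (simp add: gf_def hf_def y b v whf_def)
    then have "a x *v \<theta> = 0" by (simp add: vec_eq_iff uu_matrix)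
    then show ?thesis using a_inv(2)[OF \<Omega>D(1)[OF assms], of \<theta>] by simp
  qed
  then show ?thesis
    by (metis invertible_left_inverse matrix_left_invertible_ker)
qed

lemma gi_gf:
  assumes "(x, y) \<in> \<Omega>"
  shows "(\<Sum>n\<in>UNIV. fund_inv K x y $ k $ n * gf n x y \<theta>) = \<theta> $ k"
proof -
  have "(\<Sum>n\<in>UNIV. fund_inv K x y $ k $ n * gf n x y \<theta>) = (fund_inv K x y *v (fund_tensor K x y *v \<theta>)) $ k"
    by (simp add: matrix_vector_mult_def[of "fund_inv K x y"] gf_vector[OF assms])
  then show ?thesis
    by (simp add: fund_inv_def matrix_vector_mul_assoc matrix_inv_mult[OF fund_invertible[OF assms]])
qed

lemma gi_sym:
  assumes "(x, y) \<in> \<Omega>"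
  shows "fund_inv K x y $ i $ j = fund_inv K x y $ j $ i"
proof -
  let ?g = "fund_tensor K x y" and ?i = "fund_inv K x y"
  have inv: "?g ** ?i = mat 1"
    unfolding fund_inv_def by (rule matrix_inv_mult(1)[OF fund_invertible[OF assms]])
  have "transpose ?g = ?g"
    by (simp add: vec_eq_iff transpose_def fund_tensor_eq[OF assms] gm_sym[OF assms])
  then have left: "transpose ?i ** ?g = mat 1"
    using arg_cong[OF inv, of transpose] by (simp add: matrix_transpose_mul transpose_mat)
  have "transpose ?i = transpose ?i ** (?g ** ?i)" by (simp add: inv)
  also have "\<dots> = ?i" by (simp add: matrix_mul_assoc left)
  finally have "transpose ?i $ j $ i = ?i $ j $ i" by simp
  then show ?thesis by (simp add: transpose_def)
qed

text \<open>The vector that lowers to \<open>ww\<close>: by \<open>gf_beta\<close>, B beta - (b + g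
  q) y lowers to B E b_i - b y_i = E q \<open>wh\<close>, and the prefactor turns \<open>wh\<close>
  into \<open>ww\<close>.\<close>

definition "wu x y = (K x y / (BB x y * EE x y * q x y)) *\<^sub>R (BB x y *\<^sub>R \<beta> x - (bb x y + g x * q x y) *\<^sub>R y)"

lemma gf_linear:
  assumes "(x, y) \<in> \<Omega>"
  shows "linear (gf i x y)"
  unfolding gf_sum[OF assms, abs_def]
  by (auto intro!: linearI simp: sum.distrib sum_distrib_left algebra_simps)

lemma gf_wu:
  assumes "(x, y) \<in> \<Omega>"
  shows "gf i x y (wu x y) = ww i x y"
proof -
  have "gf i x y (wu x y) = K x y / (BB x y * EE x y * q x y) * (BB x y * gf i x y (\<beta> x) - (bb x y + g x * q x y) * gf i x y y)"
    unfolding wu_def by (simp add: linear_cmul[OF gf_linear[OF assms]] linear_diff[OF gf_linear[OF assms]])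
  also have "BB x y * gf i x y (\<beta> x) - (bb x y + g x * q x y) * gf i x y y = BB x y * EE x y * b x $ i - bb x y * yl i x y"
    using BB_pos[OF assms] by (simp add: gf_beta[OF assms] y_simps[OF assms] field_simps)
  also have "\<dots> = EE x y * q x y * wh i x y"
    using \<Omega>D(2)[OF assms] by (simp add: wh_def yl_def BB_eq field_simps power2_eq_square)
  finally show ?thesis
    using \<Omega>D(2)[OF assms] EE_pos[of x y] by (simp add: ww_def)
qed

lemma ww_sums:
  assumes "(x, y) \<in> \<Omega>"
  shows "(\<Sum>i\<in>UNIV. ww i x y * y $ i) = 0" "(\<Sum>i\<in>UNIV. ww i x y * wu x y $ i) = 1"
    "(\<Sum>i\<in>UNIV. yl i x y * wu x y $ i) = 0"
    "(\<Sum>i\<in>UNIV. hm k i x y * wu x y $ i) = ww k x y"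
proof -
  have w: "(\<Sum>i\<in>UNIV. ww i x y * \<theta> $ i) = K x y / BB x y * whf x y \<theta>" for \<theta>
    by (simp add: ww_def whf_sum sum_distrib_left sum_divide_distrib mult_ac)
  show 0: "(\<Sum>i\<in>UNIV. ww i x y * y $ i) = 0" by (simp add: w y_simps[OF assms])
  have "whf x y (wu x y) = K x y / (BB x y * EE x y * q x y) * (BB x y * whf x y (\<beta> x) - (bb x y + g x * q x y) * whf x y y)"
  proof -
    have "whf x y (c *\<^sub>R (d *\<^sub>R \<theta> - e *\<^sub>R \<eta>)) = c * (d * whf x y \<theta> - e * whf x y \<eta>)" for c d e \<theta> \<eta>
      unfolding whf_sum by (simp add: sum_subtractf sum_distrib_left algebra_simps)
    then show ?thesis unfolding wu_def .
  qed
  also have "\<dots> = K x y / EE x y"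
    using BB_pos[OF assms] \<Omega>D(2)[OF assms] by (simp add: beta_simps[OF assms] y_simps[OF assms])
  finally have "K x y / BB x y * whf x y (wu x y) = (K x y)\<^sup>2 / (BB x y * EE x y)"
    by (simp add: power2_eq_square)
  also have "\<dots> = 1" unfolding K_sq[OF assms] using BB_pos[OF assms] EE_pos[of x y] by simp
  finally show "(\<Sum>i\<in>UNIV. ww i x y * wu x y $ i) = 1" by (simp only: w)
  have "(\<Sum>i\<in>UNIV. gf i x y y * wu x y $ i) = (\<Sum>i\<in>UNIV. gf i x y (wu x y) * y $ i)"
    by (rule gf_pair_sym[OF assms])
  then show y: "(\<Sum>i\<in>UNIV. yl i x y * wu x y $ i) = 0" by (simp add: y_simps[OF assms] gf_wu[OF assms] 0)
  have "hf k x y (wu x y) = gf k x y (wu x y)"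
    by (simp add: gf_def ylf_sum y)
  then show "(\<Sum>i\<in>UNIV. hm k i x y * wu x y $ i) = ww k x y"
    by (simp add: hf_sum[symmetric] gf_wu[OF assms])
qed

lemma gi_ww:
  assumes "(x, y) \<in> \<Omega>"
  shows "(\<Sum>n\<in>UNIV. fund_inv K x y $ k $ n * ww n x y) = wu x y $ k"
  using gi_gf[OF assms, of k "wu x y"] by (simp add: gf_wu[OF assms])

lemma gi_yl:
  assumes "(x, y) \<in> \<Omega>"
  shows "(\<Sum>n\<in>UNIV. fund_inv K x y $ k $ n * yl n x y) = y $ k"
  using gi_gf[OF assms, of k y] by (simp add: y_simps[OF assms])

lemma hm_sym:
  assumes "(x, y) \<in> \<Omega>"
  shows "hm i j x y = hm j i x y"
  unfolding hm_def using a_sym[OF \<Omega>D(1)[OF assms], of i j] by (simp add: mult_ac)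

text \<open>The angular metric is g_ij minus the rank-one part along y, whose trace is 1.\<close>

lemma gi_hm_trace:
  assumes "(x, y) \<in> \<Omega>"
  shows "(\<Sum>i\<in>UNIV. \<Sum>j\<in>UNIV. fund_inv K x y $ i $ j * hm i j x y) = real CARD('n) - 1"
proof -
  have "(\<Sum>j\<in>UNIV. fund_inv K x y $ i $ j * hm i j x y) = 1 - yl i x y * y $ i / (BB x y * EE x y)" for i
  proof -
    have "(\<Sum>j\<in>UNIV. fund_inv K x y $ i $ j * hm i j x y) =
       (\<Sum>j\<in>UNIV. fund_inv K x y $ i $ j * gf j x y (axis i 1)) -
       yl i x y / (BB x y * EE x y) * (\<Sum>j\<in>UNIV. fund_inv K x y $ i $ j * yl j x y)"
      unfolding gf_axis[OF assms] gm_sym[OF assms, of _ i]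
      by (simp add: gm_hm[OF assms] sum_distrib_left sum_subtractf[symmetric] algebra_simps)
    then show ?thesis unfolding gi_gf[OF assms] gi_yl[OF assms] by simp
  qed
  moreover have "(\<Sum>i\<in>UNIV. yl i x y * y $ i) = BB x y * EE x y"
    using y_simps(3)[OF assms] by (simp add: ylf_sum)
  ultimately show ?thesis
    using BB_pos[OF assms] EE_pos[of x y]
    by (simp add: sum_subtractf sum_divide_distrib[symmetric])
qed

text \<open>Counting multiples of w: the trace of h gives N - 1, the two mixed terms 1 each, and the
  product of three w gives -1, altogether N.\<close>

lemma cartan_cov_eq:
  assumes "(x, y) \<in> \<Omega>"
  shows "cartan_cov K k x y = real CARD('n) * g x / 2 * ww k x y"
proof -
  let ?i = "\<lambda>i j. fund_inv K x y $ i $ j"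
  have "cartan_cov K k x y = g x / 2 * ((\<Sum>i\<in>UNIV. \<Sum>j\<in>UNIV. ?i i j * hm i j x y) * ww k x y
     + (\<Sum>i\<in>UNIV. hm i k x y * (\<Sum>j\<in>UNIV. ?i i j * ww j x y))
     + (\<Sum>i\<in>UNIV. ww i x y * (\<Sum>j\<in>UNIV. ?i i j * hm j k x y))
     - (\<Sum>i\<in>UNIV. ww i x y * (\<Sum>j\<in>UNIV. ?i i j * ww j x y)) * ww k x y)"
    unfolding cartan_cov_def cartan_A_eq[OF assms] cubic_def
    by (simp add: sum.distrib sum_subtractf sum_distrib_left sum_distrib_right algebra_simps)
  moreover have "(\<Sum>i\<in>UNIV. ww i x y * (\<Sum>j\<in>UNIV. ?i i j * hm j k x y)) =
     (\<Sum>j\<in>UNIV. hm j k x y * (\<Sum>i\<in>UNIV. ?i j i * ww i x y))"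
    unfolding sum_distrib_left
    by (subst sum.swap) (simp add: gi_sym[OF assms] mult_ac)
  ultimately show ?thesis
    unfolding gi_ww[OF assms] gi_hm_trace[OF assms] hm_sym[OF assms, of _ k] ww_sums[OF assms]
    by (simp add: algebra_simps)
qed

lemma cartan_norm_eq:
  assumes "(x, y) \<in> \<Omega>"
  shows "cartan_norm K x y = real CARD('n) * \<bar>g x\<bar> / 2"
proof -
  let ?i = "\<lambda>i j. fund_inv K x y $ i $ j" and ?c = "real CARD('n) * g x / 2"
  have "(\<Sum>k\<in>UNIV. \<Sum>n\<in>UNIV. ?i k n * cartan_cov K n x y * cartan_cov K k x y)
     = ?c * ?c * (\<Sum>k\<in>UNIV. ww k x y * (\<Sum>n\<in>UNIV. ?i k n * ww n x y))"
    unfolding cartan_cov_eq[OF assms] by (simp add: sum_distrib_left sum_distrib_right mult_ac)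
  also have "\<dots> = ?c\<^sup>2" unfolding gi_ww[OF assms] ww_sums[OF assms] by (simp add: power2_eq_square)
  finally show ?thesis unfolding cartan_norm_def by (simp add: abs_mult)
qed

lemma alpha_cov_eq:
  assumes "(x, y) \<in> \<Omega>"
  shows "alpha_cov K k x y = sgn (g x) * ww k x y"
  unfolding alpha_cov_def cartan_cov_eq[OF assms] cartan_norm_eq[OF assms]
  using g_nonzero[OF \<Omega>D(1)[OF assms]] by (simp add: sgn_if field_simps)

lemma alpha_tensor_eq:
  assumes "(x, y) \<in> \<Omega>"
  shows "alpha_tensor K i j k x y = sgn (g x) * (1 / real CARD('n) * cubic i j k x y)"
  unfolding alpha_tensor_def cartan_A_eq[OF assms] cartan_norm_eq[OF assms]
  using g_nonzero[OF \<Omega>D(1)[OF assms]] by (simp add: sgn_if field_simps)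

subsection \<open>The spray and the nonlinear connection\<close>

definition "dgm i j x y X Y = wc x X i (\<lambda>k. gm k j x y) + wc x X j (\<lambda>k. gm i k x y)
     + \<mu> x * bb x X * gg i j x y + Cf i j x y (vert x y X Y)"
definition "dyl i x y X Y = wc x X i (\<lambda>k. yl k x y) + \<mu> x * bb x X * yg i x y + gf i x y (vert x y X Y)"
definition "dK2 x y X Y = \<mu> x * bb x X * (EE x y * (bb x y * q x y + BB x y * MM x y))
     + 2 * ylf x y (vert x y X Y)"

lemmas hasD_gm' = hasD_gm[folded dgm_def]
lemmas hasD_yl' = hasD_yl[folded dyl_def]
lemmas hasD_K_sq' = hasD_K_sq[folded dK2_def]

text \<open>The relation g_ij y^j = y_i holds on an open set, so by uniqueness both sides have the
  same derivative; neither \<open>gg\<close> nor \<open>Cf\<close> has to be expanded.\<close>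

lemma dgm_contract:
  assumes "(x, y) \<in> \<Omega>"
  shows "(\<Sum>i\<in>UNIV. gm n i x y * Y $ i + dgm n i x y X Y * y $ i) = dyl n x y X Y"
proof -
  have 1: "hasD (\<lambda>x y. \<Sum>i\<in>UNIV. gm n i x y * y $ i)
    (\<lambda>X Y. \<Sum>i\<in>UNIV. gm n i x y * Y $ i + dgm n i x y X Y * y $ i) x y"
    by (intro hasD_sum hasD_mult hasD_gm' hasD_snd assms)
  have "hasD (yl n) (\<lambda>X Y. \<Sum>i\<in>UNIV. gm n i x y * Y $ i + dgm n i x y X Y * y $ i) x y"
    by (rule hasD_cong_open[OF 1 open_\<Omega> assms]) (simp add: gf_sum[symmetric] y_simps)
  from hasD_unique[OF this hasD_yl'[OF assms]] show ?thesis .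
qed

lemma dyl_contract:
  assumes "(x, y) \<in> \<Omega>"
  shows "(\<Sum>i\<in>UNIV. yl i x y * Y $ i + dyl i x y X Y * y $ i) = dK2 x y X Y"
proof -
  have 1: "hasD (\<lambda>x y. \<Sum>i\<in>UNIV. yl i x y * y $ i)
    (\<lambda>X Y. \<Sum>i\<in>UNIV. yl i x y * Y $ i + dyl i x y X Y * y $ i) x y"
    by (intro hasD_sum hasD_mult hasD_yl' hasD_snd assms)
  have "hasD (\<lambda>x y. (K x y)\<^sup>2) (\<lambda>X Y. \<Sum>i\<in>UNIV. yl i x y * Y $ i + dyl i x y X Y * y $ i) x y"
    by (rule hasD_cong_open[OF 1 open_\<Omega> assms]) (simp add: ylf_sum[symmetric] y_simps K_sq)
  from hasD_unique[OF this hasD_K_sq'[OF assms]] show ?thesis .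
qed

lemma dgm_linear:
  assumes "(x, y) \<in> \<Omega>"
  shows "(\<Sum>m\<in>UNIV. X $ m * dgm i j x y (axis m 1) 0) = dgm i j x y X 0"
  using hasD_split[OF hasD_gm'[OF assms], of i j X 0] by simp

lemma fin_gamma_eq:
  assumes "(x, y) \<in> \<Omega>"
  shows "fin_gamma K k i j x y = 1/2 * (\<Sum>n\<in>UNIV. fund_inv K x y $ k $ n *
     (dgm n i x y (axis j 1) 0 + dgm n j x y (axis i 1) 0 - dgm j i x y (axis n 1) 0))"
  unfolding fin_gamma_def christoffel_def fund_inv_def[symmetric]
  using partial_x[OF assms hasD_gm'[OF assms] fund_tensor_eq] by simp

text \<open>\<open>GV\<close> is twice the spray, and \<open>NC x y k i\<close> is \<open>G\<^sup>k\<^sub>i\<close>.\<close>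

definition "pp x y = \<mu> x / 2 * (bb x y * q x y - BB x y * MM x y)"
definition "ss x y = \<mu> x * bb x y * MM x y - g x * q x y / BB x y * pp x y"
definition "DV x y = pp x y *\<^sub>R \<beta> x + ss x y *\<^sub>R y"
definition "GV x y = vert x y y 0 + DV x y"

lemma W_axis: "W x k i (axis n 1) = chr k n i x"
proof -
  have "W x k i (axis n 1) = (\<Sum>m\<in>UNIV. chr k m i x * axis n 1 $ m)"
    by (simp add: W_def mult.commute)
  also have "\<dots> = chr k n i x" by (rule sum_axis)
  finally show ?thesis .
qed

text \<open>Symmetry of the Christoffel symbols exchanges the direction of differentiation with the
  vector that is contracted.\<close>

lemma ylf_vert_axis:
  assumes "x \<in> U"
  shows "ylf x y (vert x y (axis n 1) 0) = wc x y n (\<lambda>k. yl k x y)"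
proof -
  show ?thesis
    unfolding ylf_sum vert_def wc_def W_def[of _ _ _ y] by (simp add: W_axis chr_sym[OF assms, of _ n] mult_ac)
qed

lemma gf_vert_axis:
  assumes "(x, y) \<in> \<Omega>"
  shows "gf i x y (vert x y (axis n 1) 0) = wc x y n (\<lambda>k. gm i k x y)"
proof -
  show ?thesis
    unfolding gf_sum[OF assms] vert_def wc_def W_def[of _ _ _ y] by (simp add: W_axis chr_sym[OF \<Omega>D(1)[OF assms], of _ n] mult_ac)
qed

text \<open>The origin of \<open>pp\<close> and \<open>ss\<close>. The charge part of the lowered
  spray is mu b M y_n + (mu/2) (b q - B M) E b_n. The coefficient of E b_n is \<open>pp\<close>; by
  \<open>gf_beta\<close> lowering beta also yields g q/B times y_n, and \<open>ss\<close>
  compensates for that.\<close>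

lemma gf_DV:
  assumes "(x, y) \<in> \<Omega>"
  shows "gf n x y (DV x y) = \<mu> x * (bb x y * yg n x y - 1/2 * b x $ n * (EE x y * (bb x y * q x y + BB x y * MM x y)))"
proof -
  have "gf n x y (DV x y) = pp x y * gf n x y (\<beta> x) + ss x y * yl n x y"
    unfolding DV_def by (simp add: linear_add[OF gf_linear[OF assms]] linear_cmul[OF gf_linear[OF assms]] y_simps[OF assms])
  also have "\<dots> = pp x y * EE x y * b x $ n + \<mu> x * bb x y * MM x y * yl n x y"
    unfolding gf_beta[OF assms] ss_def by (simp add: algebra_simps)
  also have "\<dots> = \<mu> x * (bb x y * yg n x y - 1/2 * b x $ n * (EE x y * (bb x y * q x y + BB x y * MM x y)))"
    unfolding yg_def pp_def by (simp add: algebra_simps)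
  finally show ?thesis .
qed

text \<open>By homogeneity the Christoffel expression is the Euler-Lagrange combination: twice the
  derivative of y_n along y minus the derivative of K^2 in direction n. The Levi-Civita terms leave
  \<open>vert x y y 0\<close>, the charge terms \<open>DV\<close>.\<close>

lemma spray_lowered:
  assumes "(x, y) \<in> \<Omega>"
  shows "(\<Sum>i\<in>UNIV. \<Sum>j\<in>UNIV. (dgm n i x y (axis j 1) 0 + dgm n j x y (axis i 1) 0
      - dgm j i x y (axis n 1) 0) * y $ i * y $ j) = 2 * gf n x y (GV x y)"
proof -
  have A: "(\<Sum>i\<in>UNIV. dgm n i x y X 0 * y $ i) = dyl n x y X 0" for X n
    using dgm_contract[OF assms, of n 0 X] by simp
  have A1: "(\<Sum>i\<in>UNIV. \<Sum>j\<in>UNIV. dgm n i x y (axis j 1) 0 * y $ i * y $ j) = dyl n x y y 0"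
  proof -
    have "(\<Sum>i\<in>UNIV. \<Sum>j\<in>UNIV. dgm n i x y (axis j 1) 0 * y $ i * y $ j) =
      (\<Sum>i\<in>UNIV. (\<Sum>j\<in>UNIV. y $ j * dgm n i x y (axis j 1) 0) * y $ i)"
      by (simp add: sum_distrib_left sum_distrib_right mult_ac)
    then show ?thesis unfolding dgm_linear[OF assms] A .
  qed
  have A2: "(\<Sum>i\<in>UNIV. \<Sum>j\<in>UNIV. dgm n j x y (axis i 1) 0 * y $ i * y $ j) = dyl n x y y 0"
    unfolding A1[symmetric] by (subst sum.swap) (simp add: mult_ac)
  have A3: "(\<Sum>i\<in>UNIV. \<Sum>j\<in>UNIV. dgm j i x y (axis n 1) 0 * y $ i * y $ j) = dK2 x y (axis n 1) 0"
  proof -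
    have "(\<Sum>i\<in>UNIV. \<Sum>j\<in>UNIV. dgm j i x y (axis n 1) 0 * y $ i * y $ j) =
      (\<Sum>j\<in>UNIV. (\<Sum>i\<in>UNIV. dgm j i x y (axis n 1) 0 * y $ i) * y $ j)"
      by (subst sum.swap) (simp add: sum_distrib_left sum_distrib_right mult_ac)
    then show ?thesis unfolding A using dyl_contract[OF assms, of 0 "axis n 1"] by simp
  qed
  have "(\<Sum>i\<in>UNIV. \<Sum>j\<in>UNIV. (dgm n i x y (axis j 1) 0 + dgm n j x y (axis i 1) 0
      - dgm j i x y (axis n 1) 0) * y $ i * y $ j) =
      (\<Sum>i\<in>UNIV. \<Sum>j\<in>UNIV. dgm n i x y (axis j 1) 0 * y $ i * y $ j)
      + (\<Sum>i\<in>UNIV. \<Sum>j\<in>UNIV. dgm n j x y (axis i 1) 0 * y $ i * y $ j)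
      - (\<Sum>i\<in>UNIV. \<Sum>j\<in>UNIV. dgm j i x y (axis n 1) 0 * y $ i * y $ j)"
    by (simp add: sum.distrib sum_subtractf left_diff_distrib distrib_right)
  also have "\<dots> = dyl n x y y 0 + dyl n x y y 0 - dK2 x y (axis n 1) 0"
    unfolding A1 A2 A3 ..
  also have "\<dots> = 2 * (gf n x y (vert x y y 0) + gf n x y (DV x y))"
    unfolding dyl_def dK2_def ylf_vert_axis[OF \<Omega>D(1)[OF assms]] gf_DV[OF assms] by (simp add: algebra_simps)
  finally show ?thesis by (simp add: GV_def linear_add[OF gf_linear[OF assms]])
qed

lemma spray_eq:
  assumes "(x, y) \<in> \<Omega>"
  shows "spray K k x y = 1/2 * GV x y $ k"
proof -
  have "(\<Sum>i\<in>UNIV. \<Sum>j\<in>UNIV. fin_gamma K k i j x y * y $ i * y $ j) =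
    1/2 * (\<Sum>n\<in>UNIV. fund_inv K x y $ k $ n * (\<Sum>i\<in>UNIV. \<Sum>j\<in>UNIV. (dgm n i x y (axis j 1) 0 + dgm n j x y (axis i 1) 0
      - dgm j i x y (axis n 1) 0) * y $ i * y $ j))"
  proof -
    have "(\<Sum>i\<in>UNIV. \<Sum>j\<in>UNIV. (1/2 * (\<Sum>n\<in>UNIV. c n * T n i j)) * y $ i * y $ j)
      = 1/2 * (\<Sum>n\<in>UNIV. c n * (\<Sum>i\<in>UNIV. \<Sum>j\<in>UNIV. T n i j * y $ i * y $ j))" for c :: "'n \<Rightarrow> real" and T
    proof -
      have "(\<Sum>i\<in>UNIV. \<Sum>j\<in>UNIV. (1/2 * (\<Sum>n\<in>UNIV. c n * T n i j)) * y $ i * y $ j)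
        = (\<Sum>i\<in>UNIV. \<Sum>j\<in>UNIV. \<Sum>n\<in>UNIV. 1/2 * (c n * (T n i j * y $ i * y $ j)))"
        by (simp add: sum_distrib_left sum_distrib_right mult_ac)
      also have "\<dots> = (\<Sum>i\<in>UNIV. \<Sum>n\<in>UNIV. \<Sum>j\<in>UNIV. 1/2 * (c n * (T n i j * y $ i * y $ j)))"
        by (rule sum.cong[OF refl]) (rule sum.swap)
      also have "\<dots> = (\<Sum>n\<in>UNIV. \<Sum>i\<in>UNIV. \<Sum>j\<in>UNIV. 1/2 * (c n * (T n i j * y $ i * y $ j)))"
        by (rule sum.swap)
      finally show ?thesis by (simp add: sum_distrib_left)
    qed
    then show ?thesis unfolding fin_gamma_eq[OF assms] .
  qed
  also have "\<dots> = 1/2 * (\<Sum>n\<in>UNIV. fund_inv K x y $ k $ n * (2 * gf n x y (GV x y)))"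
    unfolding spray_lowered[OF assms] ..
  also have "\<dots> = (\<Sum>n\<in>UNIV. fund_inv K x y $ k $ n * gf n x y (GV x y))"
    by (simp add: sum_distrib_left)
  finally show ?thesis by (simp add: spray_def gi_gf[OF assms])
qed

section \<open>The nonlinear connection as vertical derivative of the spray\<close>

definition "dB x y Y = (2 * bb x y + g x * q x y) * bb x Y + (g x * bb x y + 2 * q x y) * (vf x y Y / q x y)"
definition "dM x y Y = ((bb x y)\<^sup>2 + (q x y)\<^sup>2) / (BB x y)\<^sup>2 * whf x y Y"
definition "dp x y Y = \<mu> x / 2 * (q x y * bb x Y + bb x y * (vf x y Y / q x y) - (dB x y Y * MM x y + BB x y * dM x y Y))"
definition "ds x y Y = \<mu> x * (bb x Y * MM x y + bb x y * dM x y Y)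
   - g x * (vf x y Y / q x y * BB x y - q x y * dB x y Y) / (BB x y)\<^sup>2 * pp x y - g x * q x y / BB x y * dp x y Y"

lemma vertical_derivatives:
  assumes "(x, y) \<in> \<Omega>"
  shows "(bb x has_derivative bb x) (at y)"
    and "(q x has_derivative (\<lambda>Y. vf x y Y / q x y)) (at y)"
    and "(BB x has_derivative dB x y) (at y)"
    and "(MM x has_derivative dM x y) (at y)"
    and "(pp x has_derivative dp x y) (at y)"
    and "(ss x has_derivative ds x y) (at y)"
proof -
  show b: "(bb x has_derivative bb x) (at y)"
    using hasD_y[OF hasD_bb[OF \<Omega>D(1)[OF assms]]] by simp
  show q: "(q x has_derivative (\<lambda>Y. vf x y Y / q x y)) (at y)"
    using hasD_y[OF hasD_q[OF assms]] by simp
  show B: "(BB x has_derivative dB x y) (at y)"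
    using hasD_y[OF hasD_BB[OF assms]] by (simp add: dB_def[abs_def])
  show M: "(MM x has_derivative dM x y) (at y)"
    using fin_M_derivative[OF _ _ _ b q, of "g x"] g_range[OF \<Omega>D(1)[OF assms]] \<Omega>D(2)[OF assms]
    by (simp add: MM_def[abs_def] dM_def[abs_def] BB_def[abs_def] whf_def)
  show p: "(pp x has_derivative dp x y) (at y)"
    unfolding pp_def[abs_def] dp_def[abs_def]
    by (rule has_derivative_eq_rhs[OF has_derivative_mult_right[OF
        has_derivative_diff[OF has_derivative_mult[OF b q] has_derivative_mult[OF B M]]]])
      (simp add: algebra_simps)
  have qB: "((\<lambda>v. g x * q x v / BB x v) has_derivative
     (\<lambda>Y. g x * (vf x y Y / q x y * BB x y - q x y * dB x y Y) / (BB x y)\<^sup>2)) (at y)"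
    using BB_pos[OF assms]
    by (intro has_derivative_eq_rhs[OF has_derivative_divide'[OF has_derivative_mult_right[OF q] B]])
      (auto simp: field_simps power2_eq_square)
  show "(ss x has_derivative ds x y) (at y)"
    unfolding ss_def[abs_def] ds_def[abs_def]
    by (rule has_derivative_eq_rhs[OF has_derivative_diff[OF
        has_derivative_mult[OF has_derivative_mult_right[OF b] M] has_derivative_mult[OF qB p]]])
      (simp add: algebra_simps)
qed

definition "NC x y k i = W x k i y + 1/2 * (dp x y (axis i 1) * \<beta> x $ k + ds x y (axis i 1) * y $ k
   + ss x y * axis k 1 $ i)"

lemma nonlin_conn_eq:
  assumes "(x, y) \<in> \<Omega>"
  shows "nonlin_conn K k i x y = NC x y k i"
proof -
  have c: "((\<lambda>v. v $ j) has_derivative (\<lambda>Y. Y $ j)) (at y)" for j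
    by (rule bounded_linear_imp_has_derivative[OF bounded_linear_vec_nth])
  note [simp] = \<Omega>D(1)[OF assms]
  have "((\<lambda>v. \<Sum>i\<in>UNIV. W x k i v * v $ i) has_derivative
    (\<lambda>Y. \<Sum>i\<in>UNIV. W x k i y * Y $ i + W x k i Y * y $ i)) (at y)"
    unfolding W_def by (intro has_derivative_sum has_derivative_mult has_derivative_mult_left c)
  \<comment> \<open>The Levi-Civita part of the spray is a symmetric quadratic form in y, so both
    factors contribute equally and the 1/2 disappears.\<close>
  moreover have "(\<Sum>i\<in>UNIV. W x k i Y * y $ i) = (\<Sum>i\<in>UNIV. W x k i y * Y $ i)" for Y
    unfolding W_def sum_distrib_right by (subst sum.swap) (simp add: chr_sym[of x k] mult_ac)
  ultimately have V: "((\<lambda>v. \<Sum>i\<in>UNIV. W x k i v * v $ i) has_derivative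
    (\<lambda>Y. 2 * (\<Sum>i\<in>UNIV. W x k i y * Y $ i))) (at y)"
    by (simp add: sum.distrib)
  have "((\<lambda>v. 1/2 * ((\<Sum>i\<in>UNIV. W x k i v * v $ i) + (pp x v * \<beta> x $ k + ss x v * v $ k))) has_derivative
     (\<lambda>Y. 1/2 * (2 * (\<Sum>i\<in>UNIV. W x k i y * Y $ i) + (dp x y Y * \<beta> x $ k + (ss x y * Y $ k + ds x y Y * y $ k))))) (at y)"
    by (intro has_derivative_mult_right has_derivative_add V has_derivative_mult_left has_derivative_mult c
      vertical_derivatives assms)
  then have "((\<lambda>v. spray K k x v) has_derivative
     (\<lambda>Y. 1/2 * (2 * (\<Sum>i\<in>UNIV. W x k i y * Y $ i) + (dp x y Y * \<beta> x $ k + (ss x y * Y $ k + ds x y Y * y $ k))))) (at y)"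
    by (rule has_derivative_sub_open[OF _ open_slices(1)[of x]])
      (auto simp: assms spray_eq GV_def DV_def vert_def)
  from partial_deriv_eqI[OF this, of i] show ?thesis
    unfolding nonlin_conn_def NC_def sum_axis by (simp add: axis_def algebra_simps)
qed

text \<open>Euler's theorem: in y, B has degree 2, M degree 0, p degree 2 and s degree 1. So the
  spray has degree 2, and contraction with y doubles it, which is \<open>GV\<close>.\<close>

lemma NC_contract:
  assumes "(x, y) \<in> \<Omega>"
  shows "(\<Sum>i\<in>UNIV. NC x y k i * y $ i) = GV x y $ k"
proof -
  note lin = vertical_derivatives[OF assms, THEN has_derivative_linear]
  have e: "(\<Sum>i\<in>UNIV. D (axis i 1) * y $ i) = D y" if "linear D" for D :: "real^'n \<Rightarrow> real"
    using linear_vec_expand[OF that, of y] by (simp add: mult.commute)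
  have dBy: "dB x y y = 2 * BB x y"
    using \<Omega>D(2)[OF assms] by (simp add: dB_def y_simps[OF assms] BB_eq algebra_simps power2_eq_square)
  have dMy: "dM x y y = 0" by (simp add: dM_def y_simps[OF assms])
  have dpy: "dp x y y = 2 * pp x y"
    using \<Omega>D(2)[OF assms] by (simp add: dp_def pp_def dBy dMy y_simps[OF assms] algebra_simps power2_eq_square)
  have dsy: "ds x y y = ss x y"
    using \<Omega>D(2)[OF assms] BB_pos[OF assms]
    by (simp add: ds_def ss_def dBy dMy dpy y_simps[OF assms]) (simp add: field_simps power2_eq_square)
  have "(\<Sum>i\<in>UNIV. NC x y k i * y $ i) = (\<Sum>i\<in>UNIV. W x k i y * y $ i)
     + 1/2 * ((\<Sum>i\<in>UNIV. dp x y (axis i 1) * y $ i) * \<beta> x $ k + (\<Sum>i\<in>UNIV. ds x y (axis i 1) * y $ i) * y $ k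
       + ss x y * (\<Sum>i\<in>UNIV. y $ i * axis k 1 $ i))"
    unfolding NC_def by (simp add: sum.distrib sum_distrib_left sum_distrib_right algebra_simps)
  also have "\<dots> = GV x y $ k"
    unfolding e[OF lin(5)] e[OF lin(6)] sum_axis dpy dsy
    by (simp add: GV_def DV_def vert_def algebra_simps)
  finally show ?thesis .
qed

lemma Cf_sum: "Cf i j x y \<theta> = (\<Sum>k\<in>UNIV. Cf i j x y (axis k 1) * \<theta> $ k)"
proof -
  have e: "(\<Sum>k\<in>UNIV. c * (h * w k + p k * s + r k * d - e * (m * n * w k)) * \<theta> $ k)
    = c * (h * (\<Sum>k\<in>UNIV. w k * \<theta> $ k) + (\<Sum>k\<in>UNIV. p k * \<theta> $ k) * s + (\<Sum>k\<in>UNIV. r k * \<theta> $ k) * d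
      - e * (m * n * (\<Sum>k\<in>UNIV. w k * \<theta> $ k)))" for c h s d e m n :: real and w p r :: "'n \<Rightarrow> real"
    by (simp add: sum.distrib sum_subtractf sum_distrib_left algebra_simps)
  show ?thesis
    unfolding Cf_def whf_axis hf_axis e by (simp only: whf_sum[symmetric] hf_sum[symmetric])
qed

lemma Cf_linear: "linear (Cf i j x y)"
proof (rule linearI)
  fix u v :: "real^'n" and c :: real
  show "Cf i j x y (u + v) = Cf i j x y u + Cf i j x y v"
    unfolding Cf_sum[of i j x y "u + v"] Cf_sum[of i j x y u] Cf_sum[of i j x y v]
    by (simp add: sum.distrib distrib_left)
  show "Cf i j x y (c *\<^sub>R u) = c *\<^sub>R Cf i j x y u"
    unfolding Cf_sum[of i j x y "c *\<^sub>R u"] Cf_sum[of i j x y u]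
    by (simp add: sum_distrib_left mult_ac)
qed

subsection \<open>Parallel transport along the spray\<close>

lemma Cf_y:
  assumes "(x, y) \<in> \<Omega>"
  shows "Cf i j x y y = 0"
  by (simp add: Cf_def y_simps[OF assms])

lemma Cf_DV:
  assumes "(x, y) \<in> \<Omega>"
  shows "Cf i j x y (DV x y) = pp x y * Cf i j x y (\<beta> x)"
  unfolding DV_def
  by (simp add: linear_add[OF Cf_linear] linear_cmul[OF Cf_linear] Cf_y[OF assms])

lemma Cf_beta:
  assumes "(x, y) \<in> \<Omega>"
  shows "Cf i j x y (\<beta> x) = g x / BB x y * q x y * (hm i j x y + EE x y * (wh i x y * wh j x y) / BB x y)"
proof -
  have "hf i x y (\<beta> x) = EE x y * (wh i x y * q x y / BB x y)" for i
    by (simp add: hf_def beta_simps[OF assms])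
  then show ?thesis by (simp add: Cf_def beta_simps[OF assms] algebra_simps)
qed

lemma NC_lowered:
  assumes "(x, y) \<in> \<Omega>"
  shows "(\<Sum>k\<in>UNIV. gm n k x y * NC x y k i) = wc x y i (\<lambda>k. gm n k x y) +
    1/2 * (dp x y (axis i 1) * gf n x y (\<beta> x) + ds x y (axis i 1) * yl n x y + ss x y * gm n i x y)"
proof -
  have "(\<Sum>k\<in>UNIV. gm n k x y * NC x y k i) = (\<Sum>k\<in>UNIV. W x k i y * gm n k x y) +
    1/2 * (dp x y (axis i 1) * (\<Sum>k\<in>UNIV. gm n k x y * \<beta> x $ k) + ds x y (axis i 1) * (\<Sum>k\<in>UNIV. gm n k x y * y $ k)
     + ss x y * (\<Sum>k\<in>UNIV. gm n k x y * axis i 1 $ k))"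
    unfolding NC_def by (simp add: sum.distrib sum_distrib_left algebra_simps) (simp add: axis_def eq_commute)
  then show ?thesis
    unfolding sum_axis wc_def gf_sum[OF assms, symmetric] y_simps[OF assms] .
qed

text \<open>The explicit derivatives of p and s are brought into geometric form: the part symmetric
  in n and i is the charge and vertical part of the derivative of g_ni along the spray, and the
  \<open>yg\<close> terms are antisymmetric.\<close>

lemma connection_identity:
  assumes "(x, y) \<in> \<Omega>"
  shows "\<mu> x * bb x y * gg n i x y + \<mu> x * b x $ i * yg n x y - \<mu> x * b x $ n * yg i x y - pp x y * Cf n i x y (\<beta> x)
    = dp x y (axis i 1) * gf n x y (\<beta> x) + ds x y (axis i 1) * yl n x y + ss x y * gm n i x y"
proof -
  define lm where "lm = (\<lambda>n. vv n x y + (bb x y + g x * q x y) * b x $ n)"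
  define B where "B = BB x y"
  define E where "E = EE x y"
  have B: "B \<noteq> 0" and E: "E \<noteq> 0" using BB_pos[OF assms] EE_pos[of x y] by (auto simp: B_def E_def)
  have yl: "yl k x y = E * lm k" for k by (simp add: yl_def lm_def E_def)
  have gm: "gm n i x y = hm n i x y + E * (lm n * lm i) / B"
    unfolding gm_hm[OF assms] yl using B E by (simp add: B_def[symmetric] E_def[symmetric])
  have "\<mu> x * bb x y * ((BB x y - g x * (bb x y * q x y)) / (BB x y)\<^sup>2 * br n i x y + g x / BB x y * ((q x y)\<^sup>2 * (b x $ n * b x $ i)))
      - \<mu> x * b x $ n * MM x y * lm i - pp x y * g x * q x y * wh n x y * wh i x y / (BB x y)\<^sup>2
    = dp x y (axis i 1) * b x $ n + (\<mu> x * bb x y * dM x y (axis i 1) - g x * (vv i x y / q x y * BB x y - q x y * dB x y (axis i 1)) / (BB x y)\<^sup>2 * pp x y) * lm n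
     - g x * q x y / (BB x y)\<^sup>2 * pp x y * lm n * lm i" (is "?l = ?r")
    unfolding br_def dp_def dM_def dB_def pp_def lm_def wh_def bb_axis vf_axis whf_axis
    using BB_pos[OF assms] \<Omega>D(2)[OF assms] by (intro spray_algebra[OF BB_eq]) auto
  then have *: "E * ?l = E * ?r" by simp
  \<comment> \<open>The coefficient shared by \<open>gf_beta\<close>, \<open>Cf_beta\<close> and
    \<open>ss\<close>; separating it isolates the multiples of g_ni and h_ni.\<close>
  define c where "c = g x * q x y / B"
  have P: "E * ?l = \<mu> x * bb x y * (gg n i x y - MM x y * gm n i x y) + \<mu> x * b x $ i * (yg n x y - MM x y * yl n x y)
     - \<mu> x * b x $ n * yg i x y - pp x y * (Cf n i x y (\<beta> x) - c * hm n i x y)"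
    unfolding gg_def yg_def Cf_beta[OF assms] yl B_def[symmetric] E_def[symmetric] c_def
    by (simp add: algebra_simps power2_eq_square)
  have Q: "E * ?r = dp x y (axis i 1) * (gf n x y (\<beta> x) - c * yl n x y)
     + (ds x y (axis i 1) - \<mu> x * b x $ i * MM x y + c * dp x y (axis i 1)) * yl n x y
     - c * pp x y * (gm n i x y - hm n i x y)"
    unfolding gf_beta[OF assms] ds_def gm unfolding yl B_def[symmetric] E_def[symmetric] bb_axis vf_axis c_def
    by (simp add: algebra_simps power2_eq_square)
  have R: "ss x y * gm n i x y = \<mu> x * bb x y * MM x y * gm n i x y - c * pp x y * gm n i x y"
    by (simp add: ss_def B_def c_def algebra_simps)
  show ?thesis using *[unfolded P Q] R by (simp add: algebra_simps)
qed

lemma NC_lowered':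
  assumes "(x, y) \<in> \<Omega>"
  shows "(\<Sum>k\<in>UNIV. gm n k x y * NC x y k i) = wc x y i (\<lambda>k. gm n k x y) +
    1/2 * (\<mu> x * bb x y * gg n i x y + \<mu> x * b x $ i * yg n x y - \<mu> x * b x $ n * yg i x y - pp x y * Cf n i x y (\<beta> x))"
  unfolding NC_lowered[OF assms] connection_identity[OF assms] ..

lemma gg_sym:
  assumes "(x, y) \<in> \<Omega>"
  shows "gg i j x y = gg j i x y"
  unfolding gg_def gm_sym[OF assms, of i j] br_def by (simp add: mult_ac add_ac)

lemma Cf_sym:
  assumes "(x, y) \<in> \<Omega>"
  shows "Cf i j x y \<theta> = Cf j i x y \<theta>"
  unfolding Cf_def hm_sym[OF assms, of i j] by (simp add: algebra_simps)

lemma Cf_axis_sym: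
  assumes "(x, y) \<in> \<Omega>"
  shows "Cf i j x y (axis k 1) = Cf i k x y (axis j 1)"
  unfolding Cf_def hf_axis whf_axis hm_sym[OF assms, of j k] by (simp add: algebra_simps)

lemma vert_minus_GV: "vert x y y (- GV x y) = - DV x y"
  by (simp add: GV_def vert_def vec_eq_iff)

text \<open>Adding \<open>NC_lowered'\<close> for the two index orders cancels the antisymmetric
  terms and doubles the symmetric ones.\<close>

lemma dgm_parallel:
  assumes "(x, y) \<in> \<Omega>"
  shows "dgm i j x y y (- GV x y) = (\<Sum>k\<in>UNIV. NC x y k i * gm k j x y) + (\<Sum>k\<in>UNIV. NC x y k j * gm i k x y)"
proof -
  have "(\<Sum>k\<in>UNIV. NC x y k i * gm k j x y) = (\<Sum>k\<in>UNIV. gm j k x y * NC x y k i)"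
    "(\<Sum>k\<in>UNIV. NC x y k j * gm i k x y) = (\<Sum>k\<in>UNIV. gm i k x y * NC x y k j)"
    by (simp_all add: gm_sym[OF assms, of j] mult.commute)
  then show ?thesis
    unfolding NC_lowered'[OF assms] dgm_def vert_minus_GV gm_sym[OF assms, of _ j]
    using gg_sym[OF assms, of j i] Cf_sym[OF assms, of j i]
    by (simp add: linear_neg[OF Cf_linear] Cf_DV[OF assms] field_simps)
qed

text \<open>Metric parallelism contracted with y: along the spray y changes by \<open>- GV\<close>,
  which the nonlinear connection applied to y offsets.\<close>

lemma dyl_parallel:
  assumes "(x, y) \<in> \<Omega>"
  shows "dyl i x y y (- GV x y) = (\<Sum>k\<in>UNIV. NC x y k i * yl k x y)"
proof -
  have yl: "yl k x y = (\<Sum>j\<in>UNIV. gm k j x y * y $ j)" for k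
    by (simp add: gf_sum[OF assms, symmetric] y_simps[OF assms])
  have "dyl i x y y (- GV x y) = (\<Sum>j\<in>UNIV. dgm i j x y y (- GV x y) * y $ j) - (\<Sum>j\<in>UNIV. gm i j x y * GV x y $ j)"
    unfolding dgm_contract[OF assms, symmetric] by (simp add: sum_subtractf)
  also have "(\<Sum>j\<in>UNIV. dgm i j x y y (- GV x y) * y $ j) =
     (\<Sum>j\<in>UNIV. \<Sum>k\<in>UNIV. NC x y k i * gm k j x y * y $ j) + (\<Sum>j\<in>UNIV. \<Sum>k\<in>UNIV. NC x y k j * gm i k x y * y $ j)"
    unfolding dgm_parallel[OF assms] by (simp add: distrib_right sum.distrib sum_distrib_right)
  also have "(\<Sum>j\<in>UNIV. \<Sum>k\<in>UNIV. NC x y k i * gm k j x y * y $ j) = (\<Sum>k\<in>UNIV. NC x y k i * yl k x y)"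
    unfolding yl by (subst sum.swap) (simp add: sum_distrib_left mult_ac)
  also have "(\<Sum>j\<in>UNIV. \<Sum>k\<in>UNIV. NC x y k j * gm i k x y * y $ j) = (\<Sum>k\<in>UNIV. gm i k x y * GV x y $ k)"
    unfolding NC_contract[OF assms, symmetric] by (subst sum.swap) (simp add: sum_distrib_left mult_ac)
  finally show ?thesis by simp
qed

lemma dK2_parallel:
  assumes "(x, y) \<in> \<Omega>"
  shows "dK2 x y y (- GV x y) = 0"
proof -
  have "dK2 x y y (- GV x y) = (\<Sum>i\<in>UNIV. dyl i x y y (- GV x y) * y $ i) - (\<Sum>i\<in>UNIV. yl i x y * GV x y $ i)"
    unfolding dyl_contract[OF assms, symmetric] by (simp add: sum_subtractf)
  also have "(\<Sum>i\<in>UNIV. dyl i x y y (- GV x y) * y $ i) = (\<Sum>k\<in>UNIV. yl k x y * GV x y $ k)"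
    unfolding dyl_parallel[OF assms] NC_contract[OF assms, symmetric] sum_distrib_left sum_distrib_right
    by (subst sum.swap) (simp add: mult_ac)
  finally show ?thesis by simp
qed

text \<open>Since C_ijk y^k = 0, two of the three Cartan terms vanish; in the third, the nonlinear
  connection contracts to \<open>GV\<close>. After lowering k, what is left is the expression in
  \<open>NC_lowered'\<close>.\<close>

lemma fin_Gamma_contract:
  assumes "(x, y) \<in> \<Omega>"
  shows "(\<Sum>m\<in>UNIV. fin_Gamma K k i m x y * y $ m) = NC x y k i"
proof -
  let ?i = "\<lambda>i j. fund_inv K x y $ i $ j"
  have C: "cartan_C K n i j x y = 1/2 * Cf n i x y (axis j 1)" for n i j
    using Cf_axis[OF assms, of n i j] K_sq(2)[OF assms]
    unfolding cartan_C_def cartan_A_eq[OF assms] by (simp add: field_simps)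
  have C0: "(\<Sum>m\<in>UNIV. cartan_C K n i m x y * y $ m) = 0" for n i
    unfolding C using Cf_sum[of n i x y y] Cf_y[OF assms, of n i] by (simp add: sum_divide_distrib[symmetric])
  have Cm0: "(\<Sum>m\<in>UNIV. cartan_C_mixed K n k m x y * y $ m) = 0" for n
  proof -
    have "(\<Sum>m\<in>UNIV. cartan_C_mixed K n k m x y * y $ m) = (\<Sum>j\<in>UNIV. ?i k j * (\<Sum>m\<in>UNIV. cartan_C K n j m x y * y $ m))"
      unfolding cartan_C_mixed_def sum_distrib_left sum_distrib_right by (subst sum.swap) (simp add: mult_ac)
    then show ?thesis by (simp add: C0)
  qed
  have 1: "(\<Sum>m\<in>UNIV. (\<Sum>n\<in>UNIV. nonlin_conn K n i x y * cartan_C_mixed K n k m x y) * y $ m) = 0"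
  proof -
    have "(\<Sum>m\<in>UNIV. (\<Sum>n\<in>UNIV. nonlin_conn K n i x y * cartan_C_mixed K n k m x y) * y $ m)
      = (\<Sum>n\<in>UNIV. nonlin_conn K n i x y * (\<Sum>m\<in>UNIV. cartan_C_mixed K n k m x y * y $ m))"
      unfolding sum_distrib_left sum_distrib_right by (subst sum.swap) (simp add: mult_ac)
    then show ?thesis by (simp add: Cm0)
  qed
  have 2: "(\<Sum>m\<in>UNIV. (\<Sum>n\<in>UNIV. nonlin_conn_up K k n x y * cartan_C K n i m x y) * y $ m) = 0"
  proof -
    have "(\<Sum>m\<in>UNIV. (\<Sum>n\<in>UNIV. nonlin_conn_up K k n x y * cartan_C K n i m x y) * y $ m)
      = (\<Sum>n\<in>UNIV. nonlin_conn_up K k n x y * (\<Sum>m\<in>UNIV. cartan_C K n i m x y * y $ m))"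
      unfolding sum_distrib_left sum_distrib_right by (subst sum.swap) (simp add: mult_ac)
    then show ?thesis by (simp add: C0)
  qed
  have 3: "(\<Sum>m\<in>UNIV. (\<Sum>n\<in>UNIV. nonlin_conn K n m x y * cartan_C_mixed K n k i x y) * y $ m)
     = (\<Sum>n\<in>UNIV. ?i k n * (1/2 * Cf n i x y (GV x y)))"
  proof -
    have rot: "Cf n j x y (axis i 1) = Cf j i x y (axis n 1)" for n j
      using Cf_sym[OF assms, of n j "axis i 1"] Cf_axis_sym[OF assms, of j n i] by simp
    have "(\<Sum>m\<in>UNIV. (\<Sum>n\<in>UNIV. nonlin_conn K n m x y * cartan_C_mixed K n k i x y) * y $ m)
      = (\<Sum>n\<in>UNIV. (\<Sum>m\<in>UNIV. NC x y n m * y $ m) * cartan_C_mixed K n k i x y)"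
      unfolding sum_distrib_left sum_distrib_right nonlin_conn_eq[OF assms] by (subst sum.swap) (simp add: mult_ac)
    also have "\<dots> = (\<Sum>n\<in>UNIV. \<Sum>j\<in>UNIV. GV x y $ n * (?i k j * (1/2 * Cf j i x y (axis n 1))))"
      unfolding NC_contract[OF assms] cartan_C_mixed_def C sum_distrib_left
      by (simp add: rot mult_ac)
    also have "\<dots> = (\<Sum>j\<in>UNIV. ?i k j * (1/2 * (\<Sum>n\<in>UNIV. Cf j i x y (axis n 1) * GV x y $ n)))"
      by (subst sum.swap) (simp add: sum_distrib_left mult_ac)
    finally show ?thesis unfolding Cf_sum[symmetric] .
  qed
  have 4: "(\<Sum>m\<in>UNIV. fin_gamma K k i m x y * y $ m)
     = (\<Sum>n\<in>UNIV. ?i k n * (1/2 * (dgm n i x y y 0 + dyl n x y (axis i 1) 0 - dyl i x y (axis n 1) 0)))"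
  proof -
    have A: "(\<Sum>m\<in>UNIV. dgm n m x y X 0 * y $ m) = dyl n x y X 0" for X n
      using dgm_contract[OF assms, of n 0 X] by simp
    have S: "dgm m i x y X 0 = dgm i m x y X 0" for m X
      unfolding dgm_def gg_sym[OF assms, of m] Cf_sym[OF assms, of m] by (simp add: gm_sym[OF assms])
    have "(\<Sum>m\<in>UNIV. fin_gamma K k i m x y * y $ m) =
      (\<Sum>n\<in>UNIV. ?i k n * (1/2 * ((\<Sum>m\<in>UNIV. y $ m * dgm n i x y (axis m 1) 0) +
        (\<Sum>m\<in>UNIV. dgm n m x y (axis i 1) 0 * y $ m) - (\<Sum>m\<in>UNIV. dgm i m x y (axis n 1) 0 * y $ m))))"
      unfolding fin_gamma_eq[OF assms] S sum_distrib_left sum_distrib_right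
        sum.distrib[symmetric] sum_subtractf[symmetric]
      by (subst sum.swap) (simp add: algebra_simps)
    then show ?thesis unfolding dgm_linear[OF assms] A .
  qed
  \<comment> \<open>The connection terms of index n cancel and those of index i double; the
    Levi-Civita parts of the two \<open>Cf\<close> terms cancel, leaving only the contribution of
    \<open>DV\<close>.\<close>
  have 5: "1/2 * (dgm n i x y y 0 + dyl n x y (axis i 1) 0 - dyl i x y (axis n 1) 0) - 1/2 * Cf n i x y (GV x y)
     = gf n x y (\<chi> k. NC x y k i)" for n
  proof -
    have s: "wc x (axis i 1) n (\<lambda>k. yl k x y) = wc x (axis n 1) i (\<lambda>k. yl k x y)"
      unfolding wc_def W_axis by (simp add: chr_sym[OF \<Omega>D(1)[OF assms], of _ i n])
    show ?thesis
      unfolding gf_sum[OF assms, of n "\<chi> k. NC x y k i"] vec_lambda_beta NC_lowered'[OF assms] dgm_def dyl_def gf_vert_axis[OF assms] s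
        GV_def linear_add[OF Cf_linear] Cf_DV[OF assms] gm_sym[OF assms, of i]
      by (simp add: algebra_simps)
  qed
  have "(\<Sum>m\<in>UNIV. fin_Gamma K k i m x y * y $ m) = (\<Sum>n\<in>UNIV. ?i k n * gf n x y (\<chi> k. NC x y k i))"
    unfolding 5[symmetric] fin_Gamma_def
    by (simp only: left_diff_distrib distrib_right sum.distrib sum_subtractf 1 2 3 4 right_diff_distrib)
  then show ?thesis by (simp add: gi_gf[OF assms])
qed

section \<open>The normalized tensors along the spray\<close>

lemma hasD_sgn_g:
  assumes "(x, y) \<in> \<Omega>"
  shows "hasD (\<lambda>x y. sgn (g x)) (\<lambda>X Y. 0) x y"
proof -
  have gx: "(g has_derivative (\<lambda>X. \<mu> x * bb x X)) (at x)"
    using hasD_x[OF hasD_g[OF \<Omega>D(1)[OF assms], of y]] .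
  have "\<forall>\<^sub>F z in nhds x. sgn (g x) = sgn (g z)"
  proof (cases "g x > 0")
    case True
    then have "\<forall>\<^sub>F z in nhds x. g z \<in> {0<..}" using open_vimage_has_derivative[OF gx, of "{0<..}"] by simp
    then show ?thesis by eventually_elim (use True in simp)
  next
    case False
    then have "g x < 0" using g_nonzero[OF \<Omega>D(1)[OF assms]] by simp
    then have "\<forall>\<^sub>F z in nhds x. g z \<in> {..<0}" using open_vimage_has_derivative[OF gx, of "{..<0}"] by simp
    then show ?thesis by eventually_elim (use \<open>g x < 0\<close> in simp)
  qed
  then have "((\<lambda>z. sgn (g z)) has_derivative (\<lambda>X. 0)) (at x)"
    by (rule has_derivative_nhds[OF has_derivative_const])
  then have 2: "((\<lambda>z. sgn (g z)) has_derivative (\<lambda>X. 0)) (at (fst (x, y)))" by simp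
  have 1: "(fst has_derivative fst) (at (x, y))"
    by (rule bounded_linear_imp_has_derivative[OF bounded_linear_fst])
  show ?thesis
    unfolding hasD_def by (rule has_derivative_compose[OF 1 2])
qed

definition "dwh i x y \<theta> = vf x y \<theta> / q x y * b x $ i - ((bb x \<theta> / q x y - bb x y * (vf x y \<theta> / q x y) / (q x y * q x y)) * vv i x y
   + bb x y / q x y * (uu i x \<theta> - bb x \<theta> * b x $ i))"

lemma hasD_wh:
  assumes "(x, y) \<in> \<Omega>"
  shows "hasD (wh i) (\<lambda>X Y. wc x X i (\<lambda>k. wh k x y) + dwh i x y (vert x y X Y)) x y"
proof -
  note [simp] = \<Omega>D(1)[OF assms]
  have 1: "hasD (\<lambda>x y. q x y * b x $ i - bb x y / q x y * vv i x y)
    (\<lambda>X Y. (q x y * wc x X i (\<lambda>k. b x $ k) + vf x y (vert x y X Y) / q x y * b x $ i)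
      - (bb x y / q x y * (wc x X i (\<lambda>k. vv k x y) + vv i x (vert x y X Y)) +
      (bb x (vert x y X Y) / q x y - bb x y * (vf x y (vert x y X Y) / q x y) / (q x y * q x y)) * vv i x y)) x y"
    unfolding wc_def by (intro hasD_mult hasD_diff hasD_q hasD_b hasD_bdivq hasD_vv assms) auto
  show ?thesis
    by (rule hasD_cong[OF 1 wh_def]) (simp add: wh_def wc_simps dwh_def vv_def[of i x "vert x y X Y" for X Y] algebra_simps)
qed

lemma hasD_K:
  assumes "(x, y) \<in> \<Omega>"
  shows "hasD K (\<lambda>X Y. dK2 x y X Y / (2 * K x y)) x y"
proof (rule hasD_cong_open[OF _ open_\<Omega> assms])
  show "hasD (\<lambda>x y. sqrt ((K x y)\<^sup>2)) (\<lambda>X Y. dK2 x y X Y / (2 * K x y)) x y"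
    using has_derivative_real_sqrt[OF _ hasD_K_sq'[OF assms, unfolded hasD_def]] K_sq(2)[OF assms]
    unfolding hasD_def by (simp add: field_simps)
  show "sqrt ((K z v)\<^sup>2) = K z v" if "(z, v) \<in> \<Omega>" for z v
    using K_sq(2)[OF that] by simp
qed

definition "dB2 x y X Y = bb x y * q x y * (\<mu> x * bb x X)
     + (2 * bb x y + g x * q x y) * bb x (vert x y X Y)
     + (g x * bb x y + 2 * q x y) * (vf x y (vert x y X Y) / q x y)"

definition "dww i x y X Y = K x y / BB x y * (wc x X i (\<lambda>k. wh k x y) + dwh i x y (vert x y X Y))
   + (dK2 x y X Y / (2 * K x y) * BB x y - K x y * dB2 x y X Y) / (BB x y * BB x y) * wh i x y"

lemma hasD_ww:
  assumes "(x, y) \<in> \<Omega>"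
  shows "hasD (ww i) (dww i x y) x y"
proof -
  have "hasD (\<lambda>x y. K x y / BB x y * wh i x y) (dww i x y) x y"
    unfolding dww_def[abs_def] dB2_def
    using BB_pos[OF assms] by (intro hasD_mult hasD_divide hasD_K hasD_BB hasD_wh assms) auto
  then show ?thesis by (rule hasD_cong[OF _ ww_def refl])
qed

text \<open>As K is constant along the spray, only \<open>wh\<close> and B vary in w. Since w
  annihilates y, the derivative of s drops out of the contraction of the nonlinear connection with
  w; that of p enters through w(beta) = K q/B.\<close>

lemma dww_parallel:
  assumes "(x, y) \<in> \<Omega>"
  shows "dww i x y y (- GV x y) = (\<Sum>k\<in>UNIV. NC x y k i * ww k x y)"
proof -
  note nz = BB_pos[OF assms] \<Omega>D(2)[OF assms] K_sq(2)[OF assms] EE_pos[of x y]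
  have lin: "(\<Sum>j\<in>UNIV. c j * (- (p *\<^sub>R u + s *\<^sub>R v)) $ j)
      = - (p * (\<Sum>j\<in>UNIV. c j * u $ j) + s * (\<Sum>j\<in>UNIV. c j * v $ j))"
    for c and p s :: real and u v :: "real^'n"
  proof -
    have "(\<Sum>j\<in>UNIV. c j * (- (p *\<^sub>R u + s *\<^sub>R v)) $ j)
        = (\<Sum>j\<in>UNIV. - (p * (c j * u $ j) + s * (c j * v $ j)))"
      by (simp add: algebra_simps)
    then show ?thesis by (simp only: sum_negf sum.distrib sum_distrib_left)
  qed
  have bD: "bb x (- DV x y) = - (pp x y + ss x y * bb x y)"
    unfolding DV_def form_b_def lin unfolding form_b_def[symmetric] beta_simps[OF assms] by simp
  have vD: "vf x y (- DV x y) = - ss x y * (q x y)\<^sup>2"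
    unfolding DV_def vf_def lin unfolding vf_def[symmetric] beta_simps[OF assms] y_simps[OF assms] by simp
  have uD: "uu i x (- DV x y) = - (pp x y * b x $ i + ss x y * (vv i x y + bb x y * b x $ i))"
    unfolding DV_def uu_def lin unfolding uu_def[symmetric] beta_simps(1)[OF assms] by (simp add: vv_def)
  have dwh: "dwh i x y (- DV x y) = pp x y * (vv i x y / q x y) - ss x y * wh i x y"
    unfolding dwh_def bD vD uD wh_def using nz by (simp add: field_simps power2_eq_square)
  have dB2: "dB2 x y y (- GV x y) = \<mu> x * bb x y * (bb x y * q x y) - pp x y * (2 * bb x y + g x * q x y) - 2 * ss x y * BB x y"
    unfolding dB2_def vert_minus_GV bD vD BB_eq using nz by (simp add: field_simps power2_eq_square)
  have l: "dww i x y y (- GV x y) = wc x y i (\<lambda>k. ww k x y) + K x y / BB x y * (dwh i x y (- DV x y)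
      - dB2 x y y (- GV x y) / BB x y * wh i x y)"
    unfolding dww_def dK2_parallel[OF assms] vert_minus_GV ww_def wc_simps using nz by (simp add: field_simps)
  \<comment> \<open>Constancy of K^2 divided by E is a linear relation between p and s; below it
    eliminates s from \<open>?a\<close>.\<close>
  have dK: "0 = \<mu> x * bb x y * (bb x y * q x y + BB x y * MM x y) - 2 * pp x y * (bb x y + g x * q x y) - 2 * ss x y * BB x y"
  proof -
    have "EE x y * (\<mu> x * bb x y * (bb x y * q x y + BB x y * MM x y) - 2 * pp x y * (bb x y + g x * q x y) - 2 * ss x y * BB x y)
      = dK2 x y y (- GV x y)"
      unfolding dK2_def vert_minus_GV ylf_def bD vD BB_eq by (simp add: algebra_simps power2_eq_square)
    then show ?thesis using dK2_parallel[OF assms] nz by simp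
  qed
  have "\<mu> x * bb x y / 2 * (MM x y - bb x y * q x y / BB x y) * wh i x y + pp x y * (bb x y / BB x y * wh i x y + vv i x y / q x y)
     = dp x y (axis i 1) * q x y / 2 + ss x y * wh i x y / 2"
    unfolding ss_def pp_def dp_def dM_def dB_def wh_def bb_axis vf_axis whf_axis
    using nz by (intro transport_algebra[OF BB_eq]) auto
  moreover have "dwh i x y (- DV x y) - dB2 x y y (- GV x y) / BB x y * wh i x y =
     \<mu> x * bb x y / 2 * (MM x y - bb x y * q x y / BB x y) * wh i x y + pp x y * (bb x y / BB x y * wh i x y + vv i x y / q x y)"
    (is "?a = ?b")
  proof -
    have "2 * BB x y * ?a = 2 * BB x y * pp x y * (vv i x y / q x y) - 2 * BB x y * ss x y * wh i x y - 2 * dB2 x y y (- GV x y) * wh i x y"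
      unfolding dwh using nz by (simp add: right_diff_distrib)
    also have "\<dots> = 2 * BB x y * pp x y * (vv i x y / q x y) + (\<mu> x * bb x y * (BB x y * MM x y - bb x y * q x y) + 2 * pp x y * bb x y) * wh i x y
      - (\<mu> x * bb x y * (bb x y * q x y + BB x y * MM x y) - 2 * pp x y * (bb x y + g x * q x y) - 2 * ss x y * BB x y) * wh i x y"
      unfolding dB2 by algebra
    also have "\<dots> = 2 * BB x y * ?b"
      unfolding dK[symmetric] using nz by (simp add: field_simps)
    finally show ?thesis using nz by simp
  qed
  ultimately have L: "dww i x y y (- GV x y) = wc x y i (\<lambda>k. ww k x y) + K x y / BB x y * (dp x y (axis i 1) * q x y / 2 + ss x y * wh i x y / 2)"
    unfolding l by simp
  have wb: "(\<Sum>k\<in>UNIV. ww k x y * \<beta> x $ k) = K x y / BB x y * q x y"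
    unfolding beta_simps(4)[OF assms, symmetric] whf_sum ww_def by (simp add: sum_distrib_left mult_ac)
  have "(\<Sum>k\<in>UNIV. NC x y k i * ww k x y) = wc x y i (\<lambda>k. ww k x y) +
    1/2 * (dp x y (axis i 1) * (\<Sum>k\<in>UNIV. ww k x y * \<beta> x $ k) + ds x y (axis i 1) * (\<Sum>k\<in>UNIV. ww k x y * y $ k)
     + ss x y * (\<Sum>k\<in>UNIV. ww k x y * axis i 1 $ k))"
    unfolding NC_def wc_def by (simp add: sum.distrib sum_distrib_left algebra_simps) (simp add: axis_def eq_commute)
  also have "\<dots> = wc x y i (\<lambda>k. ww k x y) + K x y / BB x y * (dp x y (axis i 1) * q x y / 2 + ss x y * wh i x y / 2)"
    unfolding sum_axis wb ww_sums[OF assms] using nz by (simp add: ww_def field_simps)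
  finally show ?thesis unfolding L by simp
qed

text \<open>The derivative is taken of h_ij = g_ij - y_i y_j / K^2, not of the defining formula of
  \<open>hm\<close>, because all three ingredients are already known along the spray.\<close>

definition "dhm i j x y X Y = dgm i j x y X Y - ((yl i x y * dyl j x y X Y + dyl i x y X Y * yl j x y) * (K x y)\<^sup>2
   - yl i x y * yl j x y * dK2 x y X Y) / ((K x y)\<^sup>2 * (K x y)\<^sup>2)"

lemma hasD_hm:
  assumes "(x, y) \<in> \<Omega>"
  shows "hasD (hm i j) (dhm i j x y) x y"
proof (rule hasD_cong_open[OF _ open_\<Omega> assms])
  show "hasD (\<lambda>x y. gm i j x y - yl i x y * yl j x y / (K x y)\<^sup>2) (dhm i j x y) x y"
    unfolding dhm_def[abs_def] using K_sq(2)[OF assms]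
    by (intro hasD_diff hasD_divide hasD_mult hasD_gm' hasD_yl' hasD_K_sq' assms) auto
qed (simp add: gm_hm K_sq)

lemma dhm_parallel:
  assumes "(x, y) \<in> \<Omega>"
  shows "dhm i j x y y (- GV x y) = (\<Sum>k\<in>UNIV. NC x y k i * hm k j x y) + (\<Sum>k\<in>UNIV. NC x y k j * hm i k x y)"
proof -
  have "hm i j x y = gm i j x y - yl i x y * yl j x y / (K x y)\<^sup>2" for i j
    by (simp add: gm_hm[OF assms] K_sq[OF assms])
  note h = this
  define c where "c = 1 / (K x y)\<^sup>2"
  have h': "hm i j x y = gm i j x y - c * (yl i x y * yl j x y)" for i j
    by (simp add: h c_def)
  have "dhm i j x y y (- GV x y) = dgm i j x y y (- GV x y) - c * (yl i x y * dyl j x y y (- GV x y) + dyl i x y y (- GV x y) * yl j x y)"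
  proof -
    have "(A * k - z * 0) / (k * k) = 1 / k * A" if "k \<noteq> 0" for A k z :: real
      using that by simp
    then show ?thesis
      unfolding dhm_def dK2_parallel[OF assms] c_def using K_sq(2)[OF assms]
      by (metis less_irrefl power_eq_0_iff)
  qed
  then show ?thesis
    unfolding h' dgm_parallel[OF assms] dyl_parallel[OF assms]
    by (simp add: sum_subtractf sum_distrib_left algebra_simps)
qed

definition "dcubic i j k x y X Y = (hm i j x y * dww k x y X Y + dhm i j x y X Y * ww k x y)
  + (hm i k x y * dww j x y X Y + dhm i k x y X Y * ww j x y)
  + (hm j k x y * dww i x y X Y + dhm j k x y X Y * ww i x y)
  - (ww i x y * ww j x y * dww k x y X Y + (ww i x y * dww j x y X Y + dww i x y X Y * ww j x y) * ww k x y)"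

lemma hasD_cubic:
  assumes "(x, y) \<in> \<Omega>"
  shows "hasD (cubic i j k) (dcubic i j k x y) x y"
proof -
  have "hasD (\<lambda>x y. hm i j x y * ww k x y + hm i k x y * ww j x y + hm j k x y * ww i x y
   - ww i x y * ww j x y * ww k x y) (dcubic i j k x y) x y"
    unfolding dcubic_def[abs_def] by (intro hasD_add hasD_diff hasD_mult hasD_hm hasD_ww assms)
  then show ?thesis by (rule hasD_cong[OF _ cubic_def refl])
qed

lemma dcubic_parallel:
  assumes "(x, y) \<in> \<Omega>"
  shows "dcubic i j k x y y (- GV x y) = (\<Sum>n\<in>UNIV. NC x y n i * cubic n j k x y)
    + (\<Sum>n\<in>UNIV. NC x y n j * cubic i n k x y) + (\<Sum>n\<in>UNIV. NC x y n k * cubic i j n x y)"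
proof -
  have hs: "(\<Sum>n\<in>UNIV. NC x y n i * hm n j x y) = (\<Sum>n\<in>UNIV. NC x y n i * hm j n x y)" for i j
    by (simp add: hm_sym[OF assms, of j])
  \<comment> \<open>Only the first slot is expanded; total symmetry of \<open>cubic\<close> carries
    the formula over to the other two.\<close>
  have e1: "(\<Sum>n\<in>UNIV. NC x y n i * cubic n j k x y) = (\<Sum>n\<in>UNIV. NC x y n i * hm j n x y) * ww k x y
    + (\<Sum>n\<in>UNIV. NC x y n i * hm k n x y) * ww j x y + hm j k x y * (\<Sum>n\<in>UNIV. NC x y n i * ww n x y)
    - (\<Sum>n\<in>UNIV. NC x y n i * ww n x y) * (ww j x y * ww k x y)" for i j k
    unfolding hs[symmetric] cubic_def by (simp add: sum.distrib sum_subtractf sum_distrib_left sum_distrib_right algebra_simps)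
  have sym: "cubic i n k x y = cubic n i k x y" "cubic i j n x y = cubic n i j x y" for i j k n
    unfolding cubic_def hm_sym[OF assms, of i n] hm_sym[OF assms, of j n] by (simp_all add: algebra_simps)
  show ?thesis
    unfolding sym(1)[of i _ k] sym(2)[of i j] e1 unfolding dcubic_def dww_parallel[OF assms] dhm_parallel[OF assms] hs
    by (simp add: algebra_simps hm_sym[OF assms])
qed

text \<open>Since the nonlinear connection contracts with y to \<open>GV\<close>, the contracted
  horizontal derivative is the joint derivative in the single direction
  \<open>(y, - GV x y)\<close>.\<close>

lemma horiz_contract:
  assumes "(x, y) \<in> \<Omega>" "hasD S D x y" "\<And>x y. (x, y) \<in> \<Omega> \<Longrightarrow> T x y = S x y"
  shows "(\<Sum>m\<in>UNIV. horiz_deriv K T m x y * y $ m) = D y (- GV x y)"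
proof -
  have x: "partial_deriv m (\<lambda>z. T z y) x = D (axis m 1) 0" for m
    by (rule partial_x[OF assms(1,2)]) (rule assms(3))
  have y: "partial_deriv m (\<lambda>v. T x v) y = D 0 (axis m 1)" for m
    by (rule partial_y[OF assms(1,2)]) (rule assms(3))
  have "(\<Sum>m\<in>UNIV. horiz_deriv K T m x y * y $ m) = (\<Sum>m\<in>UNIV. y $ m * D (axis m 1) 0)
    - (\<Sum>m\<in>UNIV. (\<Sum>k\<in>UNIV. NC x y k m * D 0 (axis k 1)) * y $ m)"
    unfolding horiz_deriv_def x y nonlin_conn_eq[OF assms(1)]
    by (simp add: sum_subtractf right_diff_distrib mult.commute)
  also have "(\<Sum>m\<in>UNIV. (\<Sum>k\<in>UNIV. NC x y k m * D 0 (axis k 1)) * y $ m) =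
    (\<Sum>k\<in>UNIV. GV x y $ k * D 0 (axis k 1))"
    unfolding NC_contract[OF assms(1), symmetric] sum_distrib_right by (subst sum.swap) (simp add: mult_ac)
  finally show ?thesis
    unfolding hasD_split[OF assms(2), of y "- GV x y"] by (simp add: sum_negf)
qed

lemma Gamma_term_contract:
  assumes "(x, y) \<in> \<Omega>"
  shows "(\<Sum>m\<in>UNIV. (\<Sum>n\<in>UNIV. fin_Gamma K n i m x y * c n) * y $ m) = (\<Sum>n\<in>UNIV. NC x y n i * c n)"
  unfolding fin_Gamma_contract[OF assms, symmetric] sum_distrib_right by (subst sum.swap) (simp add: mult_ac)

section \<open>Vanishing of the overdot derivatives\<close>

lemma alpha_cov_dot_zero:
  assumes "(x, y) \<in> \<Omega>"
  shows "alpha_cov_dot K i x y = 0"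
proof -
  have D: "hasD (\<lambda>x y. sgn (g x) * ww i x y) (\<lambda>X Y. sgn (g x) * dww i x y X Y + 0 * ww i x y) x y"
    by (intro hasD_mult hasD_sgn_g hasD_ww assms)
  have H: "(\<Sum>m\<in>UNIV. horiz_deriv K (alpha_cov K i) m x y * y $ m) =
    sgn (g x) * dww i x y y (- GV x y) + 0 * ww i x y"
    by (rule horiz_contract[OF assms D]) (rule alpha_cov_eq)
  have "(\<Sum>m\<in>UNIV. h_cov1 K (alpha_cov K) i m x y * y $ m) =
    (\<Sum>m\<in>UNIV. horiz_deriv K (alpha_cov K i) m x y * y $ m)
    - (\<Sum>m\<in>UNIV. (\<Sum>n\<in>UNIV. fin_Gamma K n i m x y * alpha_cov K n x y) * y $ m)"
    unfolding h_cov1_def by (simp add: left_diff_distrib sum_subtractf)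
  also have "\<dots> = 0"
    unfolding Gamma_term_contract[OF assms] H dww_parallel[OF assms]
    by (simp add: alpha_cov_eq[OF assms] sum_distrib_left mult_ac)
  finally show ?thesis
    unfolding alpha_cov_dot_def unit_l_def by (simp add: sum_divide_distrib[symmetric])
qed

lemma alpha_tensor_dot_zero:
  assumes "(x, y) \<in> \<Omega>"
  shows "alpha_tensor_dot K i j k x y = 0"
proof -
  define c where "c = 1 / real CARD('n)"
  have D: "hasD (\<lambda>x y. sgn (g x) * (c * cubic i j k x y))
     (\<lambda>X Y. sgn (g x) * (c * dcubic i j k x y X Y + 0 * cubic i j k x y) + 0 * (c * cubic i j k x y)) x y"
    by (intro hasD_mult hasD_const hasD_sgn_g hasD_cubic assms)
  have H: "(\<Sum>m\<in>UNIV. horiz_deriv K (alpha_tensor K i j k) m x y * y $ m) =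
    sgn (g x) * (c * dcubic i j k x y y (- GV x y) + 0 * cubic i j k x y) + 0 * (c * cubic i j k x y)"
    by (rule horiz_contract[OF assms D]) (simp add: alpha_tensor_eq c_def)
  have "(\<Sum>m\<in>UNIV. h_cov3 K (alpha_tensor K) i j k m x y * y $ m) =
    (\<Sum>m\<in>UNIV. horiz_deriv K (alpha_tensor K i j k) m x y * y $ m)
    - (\<Sum>m\<in>UNIV. (\<Sum>n\<in>UNIV. fin_Gamma K n i m x y * alpha_tensor K n j k x y) * y $ m)
    - (\<Sum>m\<in>UNIV. (\<Sum>n\<in>UNIV. fin_Gamma K n j m x y * alpha_tensor K i n k x y) * y $ m)
    - (\<Sum>m\<in>UNIV. (\<Sum>n\<in>UNIV. fin_Gamma K n k m x y * alpha_tensor K i j n x y) * y $ m)"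
    unfolding h_cov3_def by (simp only: left_diff_distrib sum_subtractf)
  also have "\<dots> = 0"
    unfolding Gamma_term_contract[OF assms] H dcubic_parallel[OF assms]
    by (simp add: alpha_tensor_eq[OF assms] c_def[symmetric] sum_distrib_left sum.distrib algebra_simps)
  finally show ?thesis
    unfolding alpha_tensor_dot_def unit_l_def by (simp add: sum_divide_distrib[symmetric])
qed

end

section \<open>The theorem\<close>

lemma smooth_on_differentiable:
  assumes "smooth_on U f" "open U" "x \<in> U"
  shows "f differentiable (at x)"
proof -
  have "Ck_on (Suc 0) U f" using assms(1) unfolding smooth_on_def by blast
  then show ?thesis
    using assms(2,3) by (simp add: differentiable_on_eq_differentiable_at)
qed

theorem mainTheorem2:
  fixes \<A> :: "('m::{t2_space, second_countable_topology}, 'n::finite) chart set"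
    and a :: "('m, 'n) chart \<Rightarrow> real^'n \<Rightarrow> real^'n^'n"
    and b :: "('m, 'n) chart \<Rightarrow> real^'n \<Rightarrow> real^'n"
    and g \<mu> :: "'m \<Rightarrow> real"
  assumes "CARD('n) \<ge> 2"
    and "smooth_atlas \<A>"
    and "riemannian_metric \<A> a"
    and "smooth_one_form \<A> b"
    and "\<forall>c\<in>\<A>. \<forall>x\<in>chart_im c.
           (\<Sum>i\<in>UNIV. \<Sum>j\<in>UNIV. matrix_inv (a c x) $ i $ j * b c x $ i * b c x $ j) = 1"
    and "smooth_scalar \<A> g"
    and "\<forall>p. - 2 < g p \<and> g p < 2 \<and> g p \<noteq> 0"
    and "\<forall>c\<in>\<A>. \<forall>x\<in>chart_im c. \<forall>i j. nabla_one_form (a c) (b c) i j x = 0"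
    and "\<forall>c\<in>\<A>. \<forall>x\<in>chart_im c. \<forall>i.
           partial_deriv i (\<lambda>z. g (chart_inv c z)) x = \<mu> (chart_inv c x) * b c x $ i"
  shows "\<forall>c\<in>\<A>. \<forall>x\<in>chart_im c. \<forall>y. fin_q (a c) (b c) x y > 0 \<longrightarrow>
           (let K = finsleroid_K (a c) (b c) (\<lambda>z. g (chart_inv c z)) in
              (\<forall>i. alpha_cov_dot K i x y = 0) \<and>
              (\<forall>i j k. alpha_tensor_dot K i j k x y = 0))"
proof (intro ballI allI impI)
  fix c x y
  assume c: "c \<in> \<A>" and x: "x \<in> chart_im c" and y: "fin_q (a c) (b c) x y > 0"
  have U: "open (chart_im c)" using assms(2) c by (simp add: smooth_atlas_def)
  interpret finsleroid_chart "chart_im c" "a c" "b c" "\<lambda>z. g (chart_inv c z)" "\<lambda>z. \<mu> (chart_inv c z)"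
  proof
    show "(\<lambda>x. a c x $ i $ j) differentiable (at x)" if "x \<in> chart_im c" for x i j
      using assms(3) c by (intro smooth_on_differentiable[OF _ U that]) (simp add: riemannian_metric_def)
    show "(\<lambda>x. b c x $ i) differentiable (at x)" if "x \<in> chart_im c" for x i
      using assms(4) c by (intro smooth_on_differentiable[OF _ U that]) (simp add: smooth_one_form_def)
    show "(\<lambda>z. g (chart_inv c z)) differentiable (at x)" if "x \<in> chart_im c" for x
      using assms(6) c by (intro smooth_on_differentiable[OF _ U that]) (simp add: smooth_scalar_def)
    show "a c x $ i $ j = a c x $ j $ i" if "x \<in> chart_im c" for x i j
      using assms(3) c that unfolding riemannian_metric_def by blast
    show "v \<bullet> (a c x *v v) > 0" if "x \<in> chart_im c" "v \<noteq> 0" for x v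
      using assms(3) c that unfolding riemannian_metric_def by blast
  qed (use U assms(5,7-9) c in simp_all)
  have "(x, y) \<in> \<Omega>" using x y by (simp add: \<Omega>_def)
  then show "let K = finsleroid_K (a c) (b c) (\<lambda>z. g (chart_inv c z)) in
      (\<forall>i. alpha_cov_dot K i x y = 0) \<and> (\<forall>i j k. alpha_tensor_dot K i j k x y = 0)"
    by (simp add: alpha_cov_dot_zero alpha_tensor_dot_zero)
qed

end
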